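(* Let $\varphi_1,\dots,\varphi_l,\zeta_1,\dots,\zeta_r:\mathbb{R}^n\times\mathbb{R}^d\to\mathbb{R}$ be $\mathcal{C}^2$-smooth, let $m=l+r$, $\Xi:=(\varphi_1,\dots,\varphi_l)$, $\Upsilon:=(\zeta_1,\dots,\zeta_r)$, $\Phi:=(\Xi,\Upsilon):\mathbb{R}^n\times\mathbb{R}^d\to\mathbb{R}^{l+r}$, and $Z:=\{y\in\mathbb{R}^r:\langle c_t,y\rangle\le\tau_t,\ t=1,\dots,p\}$ with $(c_t,\tau_t)\in\mathbb{R}^r\times\mathbb{R}$. Let $\theta:\mathbb{R}^{l+r}\to\,]-\infty,\infty]$ be given by $\theta(y_1,y_2):=\max\{\langle e_1,y_1\rangle,\dots,\langle e_l,y_1\rangle\}+\delta(y_2;Z)$ for $(y_1,y_2)\in\mathbb{R}^l\times\mathbb{R}^r$, where $e_i\in\mathbb{R}^l$ are the unit vectors. Let $\bar x$ be a feasible solution, corresponding to $(\bar w,\bar v)\in\mathbb{R}^d\times\mathbb{R}^n$, to the minimax problem $$\text{minimize }\ \max\{\varphi_1(x,w),\dots,\varphi_l(x,w)\}+\delta(\Upsilon(x,w);Z)-\langle v,x\rangle\ \text{ over } x\in\mathbb{R}^n,\tag{$*$}$$ i.e., $\Upsilon(\bar x,\bar w)\in Z$, with $\bar v\in\partial_x(\theta\circ\Phi)(\bar x,\bar w)$, and put $\bar z_1=\Xi(\bar x,\bar w)$, $\bar z_2=\Upsilon(\bar x,\bar w)$. Assume the nondegeneracy condition $$\mathcal{D}\cap\ker\big(\nabla_x\Xi(\bar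 x,\bar w)^*,\nabla_x\Upsilon(\bar x,\bar w)^*\big)=\{0\},$$ $$\mathcal{D}:=\{(y_1,y_2)\in\mathbb{R}^l\times\mathbb{R}^r:\ y_1\in\operatorname{span}\{e_i-e_j:i,j\in\mathcal{K}(\bar z_1)\},\ y_2\in\operatorname{span}\{c_t:t\in\mathcal{I}(\bar z_2)\}\},$$ and let $\varpi=(\bar\lambda,\bar\mu)\in\mathbb{R}^l\times\mathbb{R}^r$ be the unique solution of the KKT system $$\bar v=\sum_{i=1}^l\bar\lambda_i\nabla_x\varphi_i(\bar x,\bar w)+\sum_{s=1}^r\bar\mu_s\nabla_x\zeta_s(\bar x,\bar w),\quad \bar\lambda_i\ge0,\ \sum_{i=1}^l\bar\lambda_i=1,\ \bar\lambda_i=0\text{ for }i\notin\mathcal{K}(\bar z_1),\quad \bar\mu\in N(\bar z_2;Z).$$ Then $\bar x$ is a fully stable local minimizer of $( * )$ for $(\bar w,\bar v)$ if and only if the minimax SSOSC holds: $$\sum_{i=1}^l\bar\lambda_i\langle u,\nabla^2_{xx}\varphi_i(\bar x,\bar w)u\rangle+\sum_{s=1}^r\bar\mu_s\langle u,\nabla^2_{xx}\zeta_s(\bar x,\bar w)u\rangle>0\quad\text{for all }0\neq u\in\mathcal{S},$$ where $\mathcal{S}$ is the set of all $u\in\mathbb{R}^n$ such that there is a constant $\gamma\in\mathbb{R}$ with $\langle\nabla_x\varphi_i(\bar x,\bar w),u\rangle=\gamma$ for all $i\in\Gamma(J_1)$, and $\langle c_t,\nabla_x\Upsilon(\bar x,\bar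 w)u\rangle=0$ for all $t\in\Gamma(J_2)$, with the index sets $\Gamma(J_1),\Gamma(J_2)$ defined in the context.
   Context: $\delta(\cdot;Z)$ is the indicator function of $Z$ ($0$ on $Z$, $\infty$ outside); $N(\bar z_2;Z)$ is the normal cone to the convex polyhedron $Z$; $\partial_x(\theta\circ\Phi)(\bar x,\bar w)$ is the limiting (Mordukhovich) subdifferential of $(\theta\circ\Phi)(\cdot,\bar w)$ at $\bar x$. Active index sets: $\mathcal{K}(\bar z_1)=\{i\in\{1,\dots,l\}:\varphi_i(\bar x,\bar w)=\max\{\varphi_1(\bar x,\bar w),\dots,\varphi_l(\bar x,\bar w)\}\}$, $\mathcal{I}(\bar z_2)=\{t\in\{1,\dots,p\}:\langle c_t,\bar z_2\rangle=\tau_t\}$. The operator $(\nabla_x\Xi(\bar x,\bar w)^*,\nabla_x\Upsilon(\bar x,\bar w)^* )$ maps $(y_1,y_2)$ to $\nabla_x\Xi(\bar x,\bar w)^*y_1+\nabla_x\Upsilon(\bar x,\bar w)^*y_2$. Index sets $\Gamma(J_1),\Gamma(J_2)$. Put $K=\mathcal{K}(\bar z_1)$, $I=\mathcal{I}(\bar z_2)$, $a_i=(e_i,0)$, $d_t=(0,c_t)\in\mathbb{R}^{l+r}$. Let $J_1=\{i\in K:\bar\lambda_i>0\}$; write $\bar\mu=\sum_{t\in I}\bar\nu_tc_t$ with $\bar\nu_t\ge0$ (any fixed such representation) and let $J_2=\{t\in I:\bar\nu_t>0\}$. Let $\mathcal{G}$ be the set of $y\in\mathbb{R}^{l+r}$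 with $\langle a_i-a_j,y\rangle=0$ for $i,j\in J_1$; $\langle a_i-a_j,y\rangle\le0$ for $(i,j)\in(K\setminus J_1)\times J_1$; $\langle d_t,y\rangle=0$ for $t\in J_2$; $\langle d_t,y\rangle\le0$ for $t\in I\setminus J_2$. Then $\Gamma(J_1)=\{i\in K:\langle a_i-a_j,y\rangle=0\ \forall j\in J_1,\ \forall y\in\mathcal{G}\}$ and $\Gamma(J_2)=\{t\in I:\langle d_t,y\rangle=0\ \forall y\in\mathcal{G}\}$. Full stability. Let $\varphi(x,w)=\max\{\varphi_1(x,w),\dots,\varphi_l(x,w)\}+\delta(\Upsilon(x,w);Z)$ and, for $\rho>0$, $m_\rho(w,v)=\inf_{\|x-\bar x\|\le\rho}\{\varphi(x,w)-\langle v,x\rangle\}$, $M_\rho(w,v)=\operatorname{argmin}_{\|x-\bar x\|\le\rho}\{\varphi(x,w)-\langle v,x\rangle\}$ (with argmin $=\emptyset$ if the minimized expression is $\infty$). The point $\bar x$ is a fully stable local minimizer for $(\bar w,\bar v)$ if there are $\rho>0$ and neighborhoods $W$ of $\bar w$, $V$ of $\bar v$ such that on $W\times V$ the mapping $M_\rho$ is single-valued and Lipschitz continuous with $M_\rho(\bar w,\bar v)=\{\bar x\}$, and $m_\rho$ is Lipschitz continuous. *)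

theory Defs
  imports "HOL-Analysis.Analysis"
begin

section \<open>Derivatives\<close>

definition C2_smooth :: "('a::euclidean_space \<Rightarrow> real) \<Rightarrow> bool" where
  "C2_smooth f \<longleftrightarrow>
     (\<exists>(f' :: 'a \<Rightarrow> 'a \<Rightarrow>\<^sub>L real) (f'' :: 'a \<Rightarrow> 'a \<Rightarrow>\<^sub>L ('a \<Rightarrow>\<^sub>L real)).
        (\<forall>x. (f has_derivative blinfun_apply (f' x)) (at x)) \<and>
        (\<forall>x. (f' has_derivative blinfun_apply (f'' x)) (at x)) \<and>
        continuous_on UNIV f'')"

definition grad :: "('a::real_inner \<Rightarrow> real) \<Rightarrow> 'a \<Rightarrow> 'a" where
  "grad f x = (THE D. GDERIV f x :> D)"

definition hessian :: "('a::real_inner \<Rightarrow> real) \<Rightarrow> 'a \<Rightarrow> 'a \<Rightarrow> 'a" where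
  "hessian f x = frechet_derivative (grad f) (at x)"

definition grad_x :: "('a::real_inner \<times> 'w \<Rightarrow> real) \<Rightarrow> 'a \<Rightarrow> 'w \<Rightarrow> 'a" where
  "grad_x f x w = grad (\<lambda>x'. f (x', w)) x"

definition hessian_xx :: "('a::real_inner \<times> 'w \<Rightarrow> real) \<Rightarrow> 'a \<Rightarrow> 'w \<Rightarrow> 'a \<Rightarrow> 'a" where
  "hessian_xx f x w = hessian (\<lambda>x'. f (x', w)) x"

definition deriv_x ::
  "('a::real_normed_vector \<times> 'w \<Rightarrow> 'b::real_normed_vector) \<Rightarrow> 'a \<Rightarrow> 'w \<Rightarrow> 'a \<Rightarrow> 'b" where
  "deriv_x F x w = frechet_derivative (\<lambda>x'. F (x', w)) (at x)"

section \<open>Variational analysis\<close>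

definition indicator_fn :: "'a \<Rightarrow> 'a set \<Rightarrow> ereal" where
  "indicator_fn y Z = (if y \<in> Z then 0 else \<infinity>)"

definition normal_cone :: "'a::real_inner \<Rightarrow> 'a set \<Rightarrow> 'a set" where
  "normal_cone z Z = {v. z \<in> Z \<and> (\<forall>y\<in>Z. v \<bullet> (y - z) \<le> 0)}"

definition regular_subdifferential :: "('a::real_inner \<Rightarrow> ereal) \<Rightarrow> 'a \<Rightarrow> 'a set" where
  "regular_subdifferential f x =
     {v. \<bar>f x\<bar> \<noteq> \<infinity> \<and>
         0 \<le> Liminf (at x) (\<lambda>u. (f u - f x - ereal (v \<bullet> (u - x))) / ereal (norm (u - x)))}"

definition limiting_subdifferential :: "('a::real_inner \<Rightarrow> ereal) \<Rightarrow> 'a \<Rightarrow> 'a set" where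
  "limiting_subdifferential f x =
     {v. \<bar>f x\<bar> \<noteq> \<infinity> \<and>
         (\<exists>X V. X \<longlonglongrightarrow> x \<and> (\<lambda>k. f (X k)) \<longlonglongrightarrow> f x \<and>
                (\<forall>k. V k \<in> regular_subdifferential f (X k)) \<and> V \<longlonglongrightarrow> v)}"

section \<open>Full stability\<close>

definition m_loc ::
  "('a::real_inner \<times> 'w \<Rightarrow> ereal) \<Rightarrow> 'a \<Rightarrow> real \<Rightarrow> 'w \<Rightarrow> 'a \<Rightarrow> ereal" where
  "m_loc f xb \<rho> w v = (INF x\<in>cball xb \<rho>. f (x, w) - ereal (v \<bullet> x))"

definition M_loc ::
  "('a::real_inner \<times> 'w \<Rightarrow> ereal) \<Rightarrow> 'a \<Rightarrow> real \<Rightarrow> 'w \<Rightarrow> 'a \<Rightarrow> 'a set" where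
  "M_loc f xb \<rho> w v =
     {x \<in> cball xb \<rho>. f (x, w) - ereal (v \<bullet> x) = m_loc f xb \<rho> w v \<and> m_loc f xb \<rho> w v \<noteq> \<infinity>}"

text \<open>Single-valuedness of the argmin mapping includes nonemptiness: it is given by a function
  \<open>s\<close> on the whole of \<open>W \<times> V\<close>. Lipschitz continuity of the infimum includes
  its finiteness there.\<close>

definition fully_stable_local_minimizer ::
  "('a::real_inner \<times> 'w::real_normed_vector \<Rightarrow> ereal) \<Rightarrow> 'a \<Rightarrow> 'w \<Rightarrow> 'a \<Rightarrow> bool" where
  "fully_stable_local_minimizer f xb wb vb \<longleftrightarrow>
     (\<exists>\<rho>>0. \<exists>W V. open W \<and> wb \<in> W \<and> open V \<and> vb \<in> V \<and>
        (\<exists>s L. (\<forall>w\<in>W. \<forall>v\<in>V. M_loc f xb \<rho> w v = {s (w, v)}) \<and> L-lipschitz_on (W \<times> V) s) \<and>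
        M_loc f xb \<rho> wb vb = {xb} \<and>
        (\<exists>g L. (\<forall>w\<in>W. \<forall>v\<in>V. m_loc f xb \<rho> w v = ereal (g (w, v))) \<and> L-lipschitz_on (W \<times> V) g))"

section \<open>The minimax problem\<close>

text \<open>The finite types \<open>'l\<close> and \<open>'r\<close> index the coordinates of the two factors of
  \<open>(real ^ 'l) \<times> (real ^ 'r)\<close>, and \<open>axis i 1\<close> is the \<open>i\<close>-th unit vector.\<close>

definition poly_set :: "nat \<Rightarrow> (nat \<Rightarrow> 'b::real_inner) \<Rightarrow> (nat \<Rightarrow> real) \<Rightarrow> 'b set" where
  "poly_set p c \<tau> = {y. \<forall>t\<in>{1..p}. c t \<bullet> y \<le> \<tau> t}"

definition theta :: "(real ^ 'r) set \<Rightarrow> (real ^ 'l) \<times> (real ^ 'r) \<Rightarrow> ereal" where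
  "theta Z = (\<lambda>(y1, y2). ereal (MAX i\<in>UNIV. axis i 1 \<bullet> y1) + indicator_fn y2 Z)"

definition minimax_objective ::
  "('l::finite \<Rightarrow> 'q \<Rightarrow> real) \<Rightarrow> ('q \<Rightarrow> 'b) \<Rightarrow> 'b set \<Rightarrow> 'q \<Rightarrow> ereal" where
  "minimax_objective \<phi> \<Upsilon> Z q = ereal (MAX i\<in>UNIV. \<phi> i q) + indicator_fn (\<Upsilon> q) Z"

definition active_max :: "real ^ 'l \<Rightarrow> 'l set" where
  "active_max z1 = {i. z1 $ i = (MAX j\<in>UNIV. z1 $ j)}"

definition active_constr ::
  "nat \<Rightarrow> (nat \<Rightarrow> 'b::real_inner) \<Rightarrow> (nat \<Rightarrow> real) \<Rightarrow> 'b \<Rightarrow> nat set" where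
  "active_constr p c \<tau> z2 = {t\<in>{1..p}. c t \<bullet> z2 = \<tau> t}"

definition D_space ::
  "'l set \<Rightarrow> nat set \<Rightarrow> (nat \<Rightarrow> real ^ 'r) \<Rightarrow> ((real ^ 'l) \<times> (real ^ 'r)) set" where
  "D_space K I c =
     {(y1, y2). y1 \<in> span {axis i 1 - axis j 1 | i j. i \<in> K \<and> j \<in> K} \<and> y2 \<in> span {c t | t. t \<in> I}}"

definition kernel_adj ::
  "('a::euclidean_space \<Rightarrow> real ^ 'l) \<Rightarrow> ('a \<Rightarrow> real ^ 'r) \<Rightarrow> ((real ^ 'l) \<times> (real ^ 'r)) set" where
  "kernel_adj A B = {(y1, y2). adjoint A y1 + adjoint B y2 = 0}"

definition G_cone ::
  "'l set \<Rightarrow> 'l set \<Rightarrow> nat set \<Rightarrow> nat set \<Rightarrow> (nat \<Rightarrow> real ^ 'r) \<Rightarrow> ((real ^ 'l) \<times> (real ^ 'r)) set" where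
  "G_cone K J1 I J2 c =
     {y. (\<forall>i\<in>J1. \<forall>j\<in>J1. ((axis i 1, 0) - (axis j 1, 0)) \<bullet> y = 0) \<and>
         (\<forall>i\<in>K - J1. \<forall>j\<in>J1. ((axis i 1, 0) - (axis j 1, 0)) \<bullet> y \<le> 0) \<and>
         (\<forall>t\<in>J2. (0, c t) \<bullet> y = 0) \<and>
         (\<forall>t\<in>I - J2. (0, c t) \<bullet> y \<le> 0)}"

definition Gamma1 ::
  "'l::finite set \<Rightarrow> 'l set \<Rightarrow> nat set \<Rightarrow> nat set \<Rightarrow> (nat \<Rightarrow> real ^ 'r) \<Rightarrow> 'l set" where
  "Gamma1 K J1 I J2 c =
     {i\<in>K. \<forall>j\<in>J1. \<forall>y\<in>G_cone K J1 I J2 c. ((axis i 1, 0) - (axis j 1, 0)) \<bullet> y = 0}"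

definition Gamma2 ::
  "'l::finite set \<Rightarrow> 'l set \<Rightarrow> nat set \<Rightarrow> nat set \<Rightarrow> (nat \<Rightarrow> real ^ 'r) \<Rightarrow> nat set" where
  "Gamma2 K J1 I J2 c = {t\<in>I. \<forall>y\<in>G_cone K J1 I J2 c. (0, c t) \<bullet> y = 0}"

end

theory Submission
  imports Defs
begin

text \<open>Write the objective as Lagrangian plus penalty: \<open>f (x, w) = L (x, w) + \<pi> (\<psi> (x, w) - xb)\<close>, where the
  penalty \<open>\<pi>\<close> is polyhedral, vanishes exactly on the critical cone \<open>C\<close> and grows linearly away from it.
  Nondegeneracy makes it possible to choose \<open>\<psi>\<close> with \<open>\<partial>\<^sub>x\<psi> = id\<close> at \<open>(xb, wb)\<close>, so \<open>x \<mapsto> \<psi> (x, w)\<close> is a chart in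
  which the polyhedral part no longer depends on the parameter. Near \<open>(xb, wb, vb)\<close> the
  gradient of \<open>L - v \<bullet> x\<close> is smaller than the slope of \<open>\<pi>\<close>, hence minimizers lie in \<open>xb + C\<close> in the chart, and one
  has to minimize a smooth function \<open>k\<close> over the convex cone \<open>C\<close>, whose second differences are close to the Hessian \<open>H\<close>
  of \<open>L\<close>. If \<open>H\<close> is positive definite on \<open>S = span C\<close>, this is a strongly convex problem with Lipschitz
  solutions. Conversely, full stability yields uniform quadratic growth at the minimizers, and minimizers
  in the relative interior of \<open>C\<close> occur; there the growth forces \<open>H\<close> to be positive on \<open>S\<close>.

  Smoothness of the chart is used only through bounds on parallelogram differences
  \<open>f d - f b - f c + f a\<close> with \<open>a + d = b + c\<close>, because these pass to inverse and composite maps without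
  differentiating them.\<close>

section \<open>Difference estimates for smooth functions\<close>

text \<open>Such a chart exists because the polyhedral part sees only functionals in
  \<open>D_space\<close>: differences of active pieces \<phi>_i - \<phi>_j and active constraints.
  Nondegeneracy supplies a linear \<open>T\<close> that realizes prescribed values of all their
  x-derivatives. Adding to x the image under \<open>T\<close> of the remainder of \<Phi> after
  linearization in x alone therefore turns these functions, exactly and for every w, into linear
  functionals of \<open>\<psi> - xb\<close>. A single \<phi>_i is straightened only up to a shift
  common to all active i; the shift cancels between the maximum and the convex combination of the
  \<phi>_i in the Lagrangian, because the multipliers sum to 1.

  Lipschitz dependence of minimizers on the parameter requires mixed differences of the reduced
  objective in z and (w, v) to be bounded by the product of the two displacements. A parallelogram
  with one side in z and one in w gives this; with two equal sides it bounds ordinary second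
  differences. The set \<open>S\<close> fits \<open>C\<close> because the index sets \<Gamma>
  collect the constraints of the cone that hold as equalities on all of it.\<close>

definition parallelogram_bound ::
  "real \<Rightarrow> 'a::real_normed_vector set \<Rightarrow> ('a \<Rightarrow> 'b::real_normed_vector) \<Rightarrow> bool" where
  "parallelogram_bound M U f \<longleftrightarrow>
     (\<forall>a\<in>U. \<forall>b\<in>U. \<forall>c\<in>U. \<forall>d\<in>U. a + d = b + c \<longrightarrow>
        norm (f d - f b - f c + f a) \<le> M * norm (b - a) * norm (c - a))"

lemma parallelogram_boundD:
  assumes "parallelogram_bound M U f" "a \<in> U" "b \<in> U" "c \<in> U" "d \<in> U" "a + d = b + c"
  shows "norm (f d - f b - f c + f a) \<le> M * norm (b - a) * norm (c - a)"
  using assms unfolding parallelogram_bound_def by blast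

lemma norm_increment_le:
  fixes g :: "real \<Rightarrow> 'b::real_normed_vector"
  assumes "\<And>s. s \<in> {0..1} \<Longrightarrow> (g has_derivative g' s) (at s)"
    and "\<And>s h. s \<in> {0..1} \<Longrightarrow> norm (g' s h) \<le> B * norm h"
  shows "norm (g 1 - g 0) \<le> B"
proof -
  have "norm (g 1 - g 0) \<le> B * norm (1 - 0 :: real)"
  proof (rule differentiable_bound[of "{0..1}" g g' B 1 0])
    fix x :: real assume x: "x \<in> {0..1}"
    show "(g has_derivative g' x) (at x within {0..1})"
      using assms(1)[OF x] by (rule has_derivative_at_withinI)
    show "onorm (g' x) \<le> B" using assms(2)[OF x] by (rule onorm_le)
  qed auto
  then show ?thesis by simp
qed

text \<open>Move the side from \<open>a\<close> to \<open>c\<close> in the direction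
  \<open>u = b - a\<close>: the difference of \<open>f\<close> along it has derivative
  \<open>(f' (c + s u) - f' (a + s u)) u\<close>, of norm at most
  \<open>M * norm (c - a) * norm u\<close>. Convexity keeps both moving endpoints in
  \<open>U\<close>.\<close>

lemma parallelogram_bound_C11:
  fixes f :: "'a::real_normed_vector \<Rightarrow> 'b::real_normed_vector" and f' :: "'a \<Rightarrow> 'a \<Rightarrow>\<^sub>L 'b"
  assumes U: "convex U" and f: "\<And>x. x \<in> U \<Longrightarrow> (f has_derivative blinfun_apply (f' x)) (at x)"
    and f': "M-lipschitz_on U f'"
  shows "parallelogram_bound M U f"
  unfolding parallelogram_bound_def
proof (intro ballI impI)
  fix a b c d assume U4: "a \<in> U" "b \<in> U" "c \<in> U" "d \<in> U" and eq: "a + d = b + c"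
  define u where "u = b - a"
  define g where "g s = f (c + s *\<^sub>R u) - f (a + s *\<^sub>R u)" for s
  have d: "d = c + u" using eq by (simp add: u_def algebra_simps)
  have b: "b = a + u" by (simp add: u_def)
  have cu: "c + s *\<^sub>R u \<in> U" if "s \<in> {0..1}" for s
  proof -
    have "c + s *\<^sub>R u = (1 - s) *\<^sub>R c + s *\<^sub>R d" by (simp add: d algebra_simps)
    then show ?thesis using convexD_alt[OF U U4(3,4)] that by auto
  qed
  have au: "a + s *\<^sub>R u \<in> U" if "s \<in> {0..1}" for s
  proof -
    have "a + s *\<^sub>R u = (1 - s) *\<^sub>R a + s *\<^sub>R b" by (simp add: b algebra_simps)
    then show ?thesis using convexD_alt[OF U U4(1,2)] that by auto
  qed
  have der: "((\<lambda>s. f (x + s *\<^sub>R u)) has_derivative (\<lambda>h. f' (x + s *\<^sub>R u) (h *\<^sub>R u))) (at s)"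
    if "x + s *\<^sub>R u \<in> U" for x s
  proof -
    have "((\<lambda>s. x + s *\<^sub>R u) has_derivative (\<lambda>h. h *\<^sub>R u)) (at s)"
      by (auto intro!: derivative_eq_intros)
    from has_derivative_compose[OF this f[OF that]] show ?thesis .
  qed
  have "norm (g 1 - g 0) \<le> M * norm u * norm (c - a)"
  proof (rule norm_increment_le)
    fix s :: real assume s: "s \<in> {0..1}"
    show "(g has_derivative (\<lambda>h. f' (c + s *\<^sub>R u) (h *\<^sub>R u) - f' (a + s *\<^sub>R u) (h *\<^sub>R u))) (at s)"
      unfolding g_def by (intro has_derivative_diff der cu au s)
    fix h :: real
    have "norm (f' (c + s *\<^sub>R u) (h *\<^sub>R u) - f' (a + s *\<^sub>R u) (h *\<^sub>R u))
        \<le> norm (f' (c + s *\<^sub>R u) - f' (a + s *\<^sub>R u)) * norm (h *\<^sub>R u)"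
      using norm_blinfun[of "f' (c + s *\<^sub>R u) - f' (a + s *\<^sub>R u)" "h *\<^sub>R u"] by (simp add: blinfun.diff_left)
    also have "\<dots> \<le> (M * norm (c - a)) * norm (h *\<^sub>R u)"
      using lipschitz_onD[OF f' cu[OF s] au[OF s]] by (intro mult_right_mono) (auto simp: dist_norm)
    finally show "norm (f' (c + s *\<^sub>R u) (h *\<^sub>R u) - f' (a + s *\<^sub>R u) (h *\<^sub>R u))
        \<le> M * norm u * norm (c - a) * norm h" by (simp add: mult_ac)
  qed
  moreover have "g 1 - g 0 = f d - f b - f c + f a" by (simp add: g_def d b)
  ultimately show "norm (f d - f b - f c + f a) \<le> M * norm (b - a) * norm (c - a)"
    by (simp add: u_def)
qed

lemma lipschitz_on_C1:
  fixes f :: "'a::euclidean_space \<Rightarrow> 'b::real_normed_vector" and f' :: "'a \<Rightarrow> 'a \<Rightarrow>\<^sub>L 'b"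
  assumes f: "\<And>x. (f has_derivative blinfun_apply (f' x)) (at x)" and f': "continuous_on UNIV f'"
  shows "\<exists>M. M-lipschitz_on (cball a r) f"
proof -
  have "bounded (f' ` cball a r)"
    by (rule compact_imp_bounded[OF compact_continuous_image[OF continuous_on_subset[OF f']]]) auto
  then obtain M where M: "\<And>x. x \<in> cball a r \<Longrightarrow> norm (f' x) \<le> M" unfolding bounded_iff by blast
  have "(max M 0)-lipschitz_on (cball a r) f"
  proof (rule lipschitz_onI)
    fix x y assume xy: "x \<in> cball a r" "y \<in> cball a r"
    have "norm (f x - f y) \<le> max M 0 * norm (x - y)"
    proof (rule differentiable_bound[of "cball a r" f "\<lambda>x. blinfun_apply (f' x)"])
      fix z assume "z \<in> cball a r"
      then have "norm (f' z) \<le> max M 0" using M by (auto simp: le_max_iff_disj)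
      then show "onorm (blinfun_apply (f' z)) \<le> max M 0" by (simp add: norm_blinfun.rep_eq)
      show "(f has_derivative blinfun_apply (f' z)) (at z within cball a r)"
        by (rule has_derivative_at_withinI[OF f])
    qed (use xy in auto)
    then show "dist (f x) (f y) \<le> max M 0 * dist x y" by (simp add: dist_norm)
  qed auto
  then show ?thesis by blast
qed

text \<open>The derivatives are explicit arguments so that those of Lagrangian and remainders can be
  written down as sums of given ones.\<close>

definition C2_witness ::
  "('a::euclidean_space \<Rightarrow> real) \<Rightarrow> ('a \<Rightarrow> 'a \<Rightarrow>\<^sub>L real) \<Rightarrow> ('a \<Rightarrow> 'a \<Rightarrow>\<^sub>L ('a \<Rightarrow>\<^sub>L real)) \<Rightarrow> bool" where
  "C2_witness f f' f'' \<longleftrightarrow>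
     (\<forall>x. (f has_derivative blinfun_apply (f' x)) (at x)) \<and>
     (\<forall>x. (f' has_derivative blinfun_apply (f'' x)) (at x)) \<and>
     continuous_on UNIV f''"

context
  fixes f :: "'a::euclidean_space \<Rightarrow> real" and f' :: "'a \<Rightarrow> 'a \<Rightarrow>\<^sub>L real" and f''
  assumes f: "C2_witness f f' f''"
begin

lemma C2_D1: "(f has_derivative blinfun_apply (f' x)) (at x)"
  and C2_D2: "(f' has_derivative blinfun_apply (f'' x)) (at x)"
  and C2_cont: "continuous_on UNIV f''"
  using f unfolding C2_witness_def by auto

lemma C2_cont1: "continuous_on A f'"
  by (rule has_derivative_continuous_on[OF has_derivative_at_withinI[OF C2_D2]])

lemma C2_lipschitz_parallelogram:
  "\<exists>M\<ge>0. M-lipschitz_on (cball a r) f \<and> parallelogram_bound M (cball a r) f"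
proof -
  obtain M1 where M1: "M1-lipschitz_on (cball a r) f" using lipschitz_on_C1[OF C2_D1 C2_cont1] by blast
  obtain M2 where M2: "M2-lipschitz_on (cball a r) f'" using lipschitz_on_C1[OF C2_D2 C2_cont] by blast
  have "(max M1 M2)-lipschitz_on (cball a r) f'" "(max M1 M2)-lipschitz_on (cball a r) f"
    using M1 M2 by (auto elim!: lipschitz_on_mono)
  moreover have "max M1 M2 \<ge> 0" using lipschitz_on_nonneg[OF M1] by auto
  ultimately show ?thesis using parallelogram_bound_C11[OF convex_cball C2_D1] by blast
qed

text \<open>Strict differentiability: \<open>f - f' a\<close> has derivative
  \<open>f' x - f' a\<close>, small on a whole ball around \<open>a\<close>. Both points may vary,
  which makes the later estimates uniform in w.\<close>

lemma C2_strict_derivative: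
  assumes "e > 0"
  shows "\<exists>r>0. \<forall>x\<in>cball a r. \<forall>y\<in>cball a r. \<bar>f x - f y - f' a (x - y)\<bar> \<le> e * norm (x - y)"
proof -
  have "isCont f' a" using C2_cont1[of UNIV] by (simp add: continuous_on_eq_continuous_at)
  then obtain r where r: "r > 0" "\<And>x. dist x a < r \<Longrightarrow> dist (f' x) (f' a) < e"
    using assms unfolding continuous_at_eps_delta by blast
  have "\<bar>f x - f y - f' a (x - y)\<bar> \<le> e * norm (x - y)" if xy: "x \<in> cball a (r/2)" "y \<in> cball a (r/2)" for x y
  proof -
    have "norm ((f x - f' a x) - (f y - f' a y)) \<le> e * norm (x - y)"
    proof (rule differentiable_bound[of "cball a (r/2)" "\<lambda>x. f x - f' a x" "\<lambda>x. blinfun_apply (f' x - f' a)"])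
      fix z assume z: "z \<in> cball a (r/2)"
      have "((\<lambda>x. f x - f' a x) has_derivative (\<lambda>h. f' z h - f' a h)) (at z within cball a (r/2))"
        by (rule has_derivative_at_withinI)
          (rule has_derivative_diff[OF C2_D1 bounded_linear_imp_has_derivative[OF blinfun.bounded_linear_right]])
      then show "((\<lambda>x. f x - f' a x) has_derivative blinfun_apply (f' z - f' a)) (at z within cball a (r/2))"
        unfolding fun_eq_iff[THEN iffD2, OF allI, OF blinfun.diff_left] .
      have "norm (f' z - f' a) \<le> e" using less_imp_le[OF r(2)[of z]] z r(1) by (simp add: dist_norm norm_minus_commute)
      then show "onorm (blinfun_apply (f' z - f' a)) \<le> e" by (simp add: norm_blinfun.rep_eq)
    qed (use xy in auto)
    moreover have "(f x - f' a x) - (f y - f' a y) = f x - f y - f' a (x - y)" by (simp add: blinfun.diff_right)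
    ultimately show ?thesis by simp
  qed
  then show ?thesis using r(1) by (intro exI[of _ "r/2"]) auto
qed

text \<open>The centre \<open>x\<close> may vary while the second derivative stays frozen at
  \<open>a\<close>. This uniformity is what allows the Hessian at the base point to control all
  nearby parameters.\<close>

lemma C2_second_difference:
  assumes "e > 0"
  shows "\<exists>r>0. \<forall>x u. x + u \<in> cball a r \<longrightarrow> x - u \<in> cball a r \<longrightarrow>
           \<bar>f (x + u) + f (x - u) - 2 * f x - f'' a u u\<bar> \<le> e * (norm u)\<^sup>2"
proof -
  have "isCont f'' a" using C2_cont by (simp add: continuous_on_eq_continuous_at)
  then obtain r where r: "r > 0" "\<And>x. dist x a < r \<Longrightarrow> dist (f'' x) (f'' a) < e/2"
    using half_gt_zero[OF assms] unfolding continuous_at_eps_delta by blast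
  have "\<bar>f (x + u) + f (x - u) - 2 * f x - f'' a u u\<bar> \<le> e * (norm u)\<^sup>2"
    if xu: "x + u \<in> cball a (r/2)" "x - u \<in> cball a (r/2)" for x u
  proof -
    define c where "c = f'' a u u"
    have seg: "x + s *\<^sub>R u \<in> cball a (r/2)" if "\<bar>s\<bar> \<le> 1" for s
    proof -
      have "x + s *\<^sub>R u = (1 - (1 + s)/2) *\<^sub>R (x - u) + ((1 + s)/2) *\<^sub>R (x + u)"
      proof -
        have gen: "(1 - t) *\<^sub>R (x - u) + t *\<^sub>R (x + u) = x + (t + t - 1) *\<^sub>R u" for t :: real
          unfolding scaleR_left_diff_distrib scaleR_left_distrib scaleR_right_diff_distrib scaleR_right_distrib by simp
        have "(1 + s)/2 + (1 + s)/2 - 1 = s" by simp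
        then show ?thesis unfolding gen by simp
      qed
      then show ?thesis using convexD_alt[OF convex_cball xu(2,1), of "(1+s)/2"] that by auto
    qed
    have line: "((\<lambda>s. x + s *\<^sub>R u) has_derivative (\<lambda>h. h *\<^sub>R u)) (at s)" for s :: real
      by (auto intro!: derivative_eq_intros)
    have d1: "((\<lambda>s. f (x + s *\<^sub>R u)) has_derivative (\<lambda>h. h * f' (x + s *\<^sub>R u) u)) (at s)" for s
      using has_derivative_compose[OF line C2_D1, of s] by (simp add: blinfun.scaleR_right)
    have d2: "((\<lambda>s. f' (x + s *\<^sub>R u) u) has_derivative (\<lambda>h. h * f'' (x + s *\<^sub>R u) u u)) (at s)" for s
      using bounded_linear.has_derivative[OF blinfun.bounded_linear_left[of u]
          has_derivative_compose[OF line C2_D2, of s]]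
      by (simp add: blinfun.scaleR_right blinfun.scaleR_left)
    have b1: "\<bar>f' (x + s *\<^sub>R u) u - f' (x - s *\<^sub>R u) u - 2 * s * c\<bar> \<le> e * (norm u)\<^sup>2" if s: "s \<in> {0..1}" for s
    proof -
      \<comment> \<open>Mean value estimate on an interval of length \<open>2 * s\<close>, at most
        2; this is why continuity of \<open>f''\<close> was used with \<open>e/2\<close>.\<close>
      have "norm ((f' (x + s *\<^sub>R u) u - s * c) - (f' (x + (-s) *\<^sub>R u) u - (-s) * c)) \<le> (e/2 * (norm u)\<^sup>2) * norm (s - (-s))"
      proof (rule differentiable_bound[of "{-1..1}" "\<lambda>s. f' (x + s *\<^sub>R u) u - s * c" "\<lambda>s h. h * f'' (x + s *\<^sub>R u) u u - h * c"])
        fix t :: real assume t: "t \<in> {-1..1}"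
        show "((\<lambda>s. f' (x + s *\<^sub>R u) u - s * c) has_derivative (\<lambda>h. h * f'' (x + t *\<^sub>R u) u u - h * c)) (at t within {-1..1})"
          by (rule has_derivative_at_withinI, rule has_derivative_diff[OF d2]) (auto intro!: derivative_eq_intros)
        have "\<bar>t\<bar> \<le> 1" using t by auto
        then have "dist (x + t *\<^sub>R u) a < r" using seg[of t] r(1) by (simp add: dist_commute)
        then have n: "norm (f'' (x + t *\<^sub>R u) - f'' a) \<le> e/2" using r(2) by (force simp: dist_norm)
        have "\<bar>(f'' (x + t *\<^sub>R u) - f'' a) u u\<bar> \<le> norm ((f'' (x + t *\<^sub>R u) - f'' a) u) * norm u"
          using norm_blinfun[of "(f'' (x + t *\<^sub>R u) - f'' a) u" u] by simp
        also have "\<dots> \<le> (e/2 * norm u) * norm u"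
          using norm_blinfun[of "f'' (x + t *\<^sub>R u) - f'' a" u] mult_right_mono[OF n, of "norm u"]
          by (intro mult_right_mono) auto
        finally have q: "\<bar>f'' (x + t *\<^sub>R u) u u - c\<bar> \<le> e/2 * (norm u)\<^sup>2"
          by (simp add: blinfun.diff_left c_def power2_eq_square mult_ac)
        show "onorm (\<lambda>h. h * f'' (x + t *\<^sub>R u) u u - h * c) \<le> e/2 * (norm u)\<^sup>2"
        proof (rule onorm_le)
          fix h :: real
          have "norm (h * f'' (x + t *\<^sub>R u) u u - h * c) = norm h * \<bar>f'' (x + t *\<^sub>R u) u u - c\<bar>"
            by (simp add: abs_mult flip: right_diff_distrib)
          then show "norm (h * f'' (x + t *\<^sub>R u) u u - h * c) \<le> e/2 * (norm u)\<^sup>2 * norm h"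
            using mult_left_mono[OF q, of "norm h"] by (simp add: mult_ac)
        qed
      qed (use s in auto)
      also have "\<dots> \<le> (e/2 * (norm u)\<^sup>2) * 2" using s assms by (intro mult_left_mono) auto
      finally show ?thesis by (simp add: algebra_simps)
    qed
    \<comment> \<open>The symmetric sum minus its quadratic model; \<open>b1\<close> bounds its
      derivative, and \<open>g 1 - g 0\<close> is the error to be estimated.\<close>
    define g where "g s = f (x + s *\<^sub>R u) + f (x + (-s) *\<^sub>R u) - s * s * c" for s
    have "norm (g 1 - g 0) \<le> e * (norm u)\<^sup>2"
    proof (rule norm_increment_le)
      fix s :: real assume s: "s \<in> {0..1}"
      have m: "((\<lambda>s. f (x + (-s) *\<^sub>R u)) has_derivative (\<lambda>h. (-h) * f' (x + (-s) *\<^sub>R u) u)) (at s)"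
        by (rule has_derivative_compose[where f=uminus and f'=uminus, OF _ d1]) (auto intro!: derivative_eq_intros)
      show "(g has_derivative (\<lambda>h. h * (f' (x + s *\<^sub>R u) u - f' (x - s *\<^sub>R u) u - 2 * s * c))) (at s)"
        unfolding g_def by (rule derivative_eq_intros d1 m refl)+ (auto simp: algebra_simps)
      show "norm (h * (f' (x + s *\<^sub>R u) u - f' (x - s *\<^sub>R u) u - 2 * s * c)) \<le> e * (norm u)\<^sup>2 * norm h" for h :: real
        using mult_left_mono[OF b1[OF s], of "norm h"] by (simp add: abs_mult mult_ac)
    qed
    moreover have "g 1 - g 0 = f (x + u) + f (x - u) - 2 * f x - f'' a u u" by (simp add: g_def c_def)
    ultimately show ?thesis by simp
  qed
  then show ?thesis using r(1) by (intro exI[of _ "r/2"]) auto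
qed

lemma C2_taylor1:
  "\<exists>M\<ge>0. \<forall>x\<in>cball a r. \<bar>f x - f a - f' a (x - a)\<bar> \<le> M * (norm (x - a))\<^sup>2"
proof -
  obtain M where M: "M-lipschitz_on (cball a r) f'" using lipschitz_on_C1[OF C2_D2 C2_cont] by blast
  have "\<bar>f x - f a - f' a (x - a)\<bar> \<le> M * (norm (x - a))\<^sup>2" if x: "x \<in> cball a r" for x
  proof -
    define u where "u = x - a"
    have r: "r \<ge> 0" using x zero_le_dist[of a x] unfolding mem_cball by linarith
    define g where "g s = f (a + s *\<^sub>R u) - s * f' a u" for s
    have line: "((\<lambda>s. a + s *\<^sub>R u) has_derivative (\<lambda>h. h *\<^sub>R u)) (at s)" for s :: real
      by (auto intro!: derivative_eq_intros)
    have d1: "((\<lambda>s. f (a + s *\<^sub>R u)) has_derivative (\<lambda>h. h * f' (a + s *\<^sub>R u) u)) (at s)" for s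
      using has_derivative_compose[OF line C2_D1, of s] by (simp add: blinfun.scaleR_right)
    have "norm (g 1 - g 0) \<le> M * norm u * norm u"
    proof (rule norm_increment_le)
      fix s :: real assume s: "s \<in> {0..1}"
      show "(g has_derivative (\<lambda>h. h * (f' (a + s *\<^sub>R u) - f' a) u)) (at s)"
        unfolding g_def by (rule derivative_eq_intros d1 refl)+ (auto simp: algebra_simps blinfun.diff_left)
      have in': "a + s *\<^sub>R u \<in> cball a r"
        using x s mult_left_le_one_le[of "norm u" s] by (auto simp: u_def dist_norm norm_minus_commute)
      have "norm (f' (a + s *\<^sub>R u) - f' a) \<le> M * norm (s *\<^sub>R u)"
        using lipschitz_onD[OF M in', of a] r by (simp add: dist_norm)
      also have "\<dots> \<le> M * norm u"
        using s lipschitz_on_nonneg[OF M] mult_left_le_one_le[of "norm u" s] by (intro mult_left_mono) auto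
      finally have n: "norm (f' (a + s *\<^sub>R u) - f' a) \<le> M * norm u" .
      have q: "\<bar>(f' (a + s *\<^sub>R u) - f' a) u\<bar> \<le> M * norm u * norm u"
        using norm_blinfun[of "f' (a + s *\<^sub>R u) - f' a" u] mult_right_mono[OF n, of "norm u"] by simp
      show "norm (h * (f' (a + s *\<^sub>R u) - f' a) u) \<le> M * norm u * norm u * norm h" for h :: real
        using mult_left_mono[OF q, of "norm h"] by (simp add: abs_mult mult_ac)
    qed
    then show ?thesis by (simp add: g_def u_def power2_eq_square mult_ac)
  qed
  then show ?thesis using lipschitz_on_nonneg[OF M] by blast
qed

end

section \<open>Polyhedral cones\<close>

definition poly_cone :: "'k set \<Rightarrow> ('k \<Rightarrow> 'a::real_inner) \<Rightarrow> 'a set" where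
  "poly_cone N b = {u. \<forall>k\<in>N. b k \<bullet> u \<le> 0}"

lemma zero_in_poly_cone [simp]: "0 \<in> poly_cone N b" by (simp add: poly_cone_def)

lemma closed_poly_cone: "closed (poly_cone N b)"
proof -
  have "poly_cone N b = (\<Inter>k\<in>N. {u. b k \<bullet> u \<le> 0})" by (auto simp: poly_cone_def)
  then show ?thesis by (auto intro: closed_INT closed_halfspace_le)
qed

lemma convex_poly_cone: "convex (poly_cone N b)"
proof -
  have "poly_cone N b = (\<Inter>k\<in>N. {u. b k \<bullet> u \<le> 0})" by (auto simp: poly_cone_def)
  then show ?thesis by (auto intro: convex_INT convex_halfspace_le)
qed

lemma poly_cone_scale: "u \<in> poly_cone N b \<Longrightarrow> 0 \<le> s \<Longrightarrow> s *\<^sub>R u \<in> poly_cone N b"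
  by (auto simp: poly_cone_def mult_nonneg_nonpos)

text \<open>If no \<open>b k\<close> is positive at a polar vector \<open>e\<close>, then
  \<open>e\<close> lies in the cone as well as in its polar, so
  \<open>e \<bullet> e \<le> 0\<close>. Hence the right-hand side is positive on the compact set of
  polar unit vectors, and homogeneity gives the linear bound.\<close>

lemma poly_cone_polar_bound:
  fixes b :: "'k \<Rightarrow> 'a::euclidean_space"
  assumes "finite N"
  shows "\<exists>\<alpha>>0. \<forall>e. (\<forall>y\<in>poly_cone N b. e \<bullet> y \<le> 0) \<longrightarrow> \<alpha> * norm e \<le> (\<Sum>k\<in>N. max 0 (b k \<bullet> e))"
proof -
  define T where "T = {e. \<forall>y\<in>poly_cone N b. e \<bullet> y \<le> 0} \<inter> sphere 0 1"
  define F where "F e = (\<Sum>k\<in>N. max 0 (b k \<bullet> e))" for e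
  have F0: "F e \<ge> 0" for e unfolding F_def by (intro sum_nonneg) auto
  have "closed {e. \<forall>y\<in>poly_cone N b. e \<bullet> y \<le> 0}"
  proof -
    have "{e. \<forall>y\<in>poly_cone N b. e \<bullet> y \<le> 0} = (\<Inter>y\<in>poly_cone N b. {e. y \<bullet> e \<le> 0})"
      by (auto simp: inner_commute)
    then show ?thesis by (auto intro: closed_INT closed_halfspace_le)
  qed
  then have cT: "compact T" unfolding T_def by (rule closed_Int_compact) auto
  have pos: "F e > 0" if "e \<in> T" for e
  proof (rule ccontr)
    assume "\<not> F e > 0"
    then have "F e = 0" using F0[of e] by simp
    then have "\<forall>k\<in>N. max 0 (b k \<bullet> e) = 0"
      unfolding F_def by (subst (asm) sum_nonneg_eq_0_iff[OF assms]) auto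
    then have "e \<in> poly_cone N b" by (auto simp: poly_cone_def max_def split: if_splits)
    then have "e \<bullet> e \<le> 0" using that by (auto simp: T_def)
    then have "e = 0" by (metis inner_gt_zero_iff not_le)
    then show False using that by (auto simp: T_def)
  qed
  have "\<exists>\<alpha>>0. \<forall>e\<in>T. \<alpha> \<le> F e"
  proof (cases "T = {}")
    case False
    have "continuous_on T F" unfolding F_def by (intro continuous_intros)
    from continuous_attains_inf[OF cT False this] obtain e0 where "e0 \<in> T" "\<forall>e\<in>T. F e0 \<le> F e" by blast
    then show ?thesis using pos by blast
  qed (auto intro: exI[of _ 1])
  then obtain \<alpha> where \<alpha>: "\<alpha> > 0" "\<And>e. e \<in> T \<Longrightarrow> \<alpha> \<le> F e" by blast
  have "\<alpha> * norm e \<le> F e" if e: "\<forall>y\<in>poly_cone N b. e \<bullet> y \<le> 0" for e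
  proof (cases "e = 0")
    case False
    have "e /\<^sub>R norm e \<in> T" using e False by (auto simp: T_def mult_nonneg_nonpos)
    from \<alpha>(2)[OF this] have "\<alpha> \<le> F (e /\<^sub>R norm e)" .
    also have "F (e /\<^sub>R norm e) = F e / norm e"
    proof -
      have "max 0 (b k \<bullet> (e /\<^sub>R norm e)) = max 0 (b k \<bullet> e) / norm e" for k
        using False by (auto simp: max_def divide_simps)
      then show ?thesis by (simp add: F_def sum_divide_distrib)
    qed
    finally show ?thesis using False by (simp add: field_simps)
  qed (use F0 in simp)
  then show ?thesis using \<alpha>(1) unfolding F_def by blast
qed

text \<open>At the projection \<open>c\<close> of \<open>u\<close>, the vector \<open>u - c\<close> lies in the polar of the tangent cone, which is
  the polyhedral cone of the constraints active at \<open>c\<close>; only these finitely many cones matter.\<close>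

lemma Hoffman_cone:
  fixes b :: "'k \<Rightarrow> 'a::euclidean_space"
  assumes N: "finite N"
  shows "\<exists>\<alpha>>0. \<forall>u. \<alpha> * norm (u - closest_point (poly_cone N b) u) \<le> (\<Sum>k\<in>N. max 0 (b k \<bullet> u))"
proof -
  have "\<forall>A\<in>Pow N. \<exists>\<alpha>>0. \<forall>e. (\<forall>y\<in>poly_cone A b. e \<bullet> y \<le> 0) \<longrightarrow> \<alpha> * norm e \<le> (\<Sum>k\<in>A. max 0 (b k \<bullet> e))"
    using poly_cone_polar_bound finite_subset[OF _ N] by blast
  then obtain al where al: "\<And>A. A \<subseteq> N \<Longrightarrow> al A > 0"
    "\<And>A e. A \<subseteq> N \<Longrightarrow> (\<forall>y\<in>poly_cone A b. e \<bullet> y \<le> 0) \<Longrightarrow> al A * norm e \<le> (\<Sum>k\<in>A. max 0 (b k \<bullet> e))"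
    by (metis PowI)
  define \<alpha> where "\<alpha> = Min (al ` Pow N)"
  have fin: "finite (al ` Pow N)" "al ` Pow N \<noteq> {}" using N by auto
  have "\<alpha> > 0" unfolding \<alpha>_def using fin al(1) by (subst Min_gr_iff) auto
  moreover have "\<alpha> * norm (u - closest_point (poly_cone N b) u) \<le> (\<Sum>k\<in>N. max 0 (b k \<bullet> u))" for u
  proof -
    define c where "c = closest_point (poly_cone N b) u"
    define A where "A = {k\<in>N. b k \<bullet> c = 0}"
    have ne: "poly_cone N b \<noteq> {}" using zero_in_poly_cone by blast
    have c: "c \<in> poly_cone N b" unfolding c_def by (rule closest_point_in_set[OF closed_poly_cone ne])
    have A: "A \<subseteq> N" by (auto simp: A_def)
    \<comment> \<open>From \<open>c\<close> one can move a short way in the direction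
      \<open>y\<close> without leaving the cone: constraints active at \<open>c\<close> do not
      increase, and the others are strict there. The projection inequality at the new point gives
      the claim.\<close>
    have "(u - c) \<bullet> y \<le> 0" if y: "y \<in> poly_cone A b" for y
    proof -
      have "\<forall>\<^sub>F s in at_right 0. b k \<bullet> (c + s *\<^sub>R y) \<le> 0" if k: "k \<in> N" for k
      proof (cases "k \<in> A")
        case True
        then have "b k \<bullet> y \<le> 0" "b k \<bullet> c = 0" using y by (auto simp: poly_cone_def A_def)
        then show ?thesis
          using eventually_at_right_less[of "0::real"] by (auto elim!: eventually_mono simp: inner_add_right mult_nonneg_nonpos)
      next
        case False
        then have "b k \<bullet> c < 0" using c k by (force simp: A_def poly_cone_def)
        moreover have "((\<lambda>s. b k \<bullet> (c + s *\<^sub>R y)) \<longlongrightarrow> b k \<bullet> (c + 0 *\<^sub>R y)) (at_right 0)"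
          by (intro tendsto_intros)
        ultimately have "\<forall>\<^sub>F s in at_right 0. b k \<bullet> (c + s *\<^sub>R y) < 0"
          by (intro order_tendstoD) auto
        then show ?thesis by eventually_elim simp
      qed
      then have "\<forall>\<^sub>F s in at_right 0. \<forall>k\<in>N. b k \<bullet> (c + s *\<^sub>R y) \<le> 0"
        using N by (simp add: eventually_ball_finite)
      then have "\<forall>\<^sub>F s in at_right (0::real). s > 0 \<and> (\<forall>k\<in>N. b k \<bullet> (c + s *\<^sub>R y) \<le> 0)"
        using eventually_at_right_less[of "0::real"] by eventually_elim auto
      then obtain s where s: "s > 0" "c + s *\<^sub>R y \<in> poly_cone N b"
        using eventually_happens'[OF trivial_limit_at_right_real] unfolding poly_cone_def by blast
      have "(u - c) \<bullet> (c + s *\<^sub>R y - c) \<le> 0"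
        unfolding c_def by (rule closest_point_dot[OF convex_poly_cone closed_poly_cone s(2)[unfolded c_def]])
      then show ?thesis using s(1) by (simp add: mult_le_0_iff)
    qed
    from al(2)[OF A] this have "al A * norm (u - c) \<le> (\<Sum>k\<in>A. max 0 (b k \<bullet> (u - c)))" by blast
    moreover have "\<alpha> \<le> al A" unfolding \<alpha>_def using fin A by (intro Min_le) auto
    ultimately have "\<alpha> * norm (u - c) \<le> (\<Sum>k\<in>A. max 0 (b k \<bullet> (u - c)))"
      by (meson mult_right_mono norm_ge_zero order_trans)
    \<comment> \<open>Active constraints vanish at \<open>c\<close>, so \<open>u - c\<close> and
      \<open>u\<close> have the same values.\<close>
    also have "\<dots> = (\<Sum>k\<in>A. max 0 (b k \<bullet> u))" by (rule sum.cong) (auto simp: A_def inner_diff_right)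
    also have "\<dots> \<le> (\<Sum>k\<in>N. max 0 (b k \<bullet> u))" using N A by (intro sum_mono2) auto
    finally show ?thesis by (simp add: c_def)
  qed
  ultimately show ?thesis by blast
qed

section \<open>Local chart\<close>

lemma Pair_in_cballI: "norm (x - a) + norm (y - b) \<le> r \<Longrightarrow> (x, y) \<in> cball (a, b) r"
  using norm_Pair_le[of "x - a" "y - b"] by (simp add: dist_norm norm_minus_commute del: dist_Pair_Pair)
    (metis diff_Pair dist_norm norm_minus_commute order_trans)

lemma Pair_in_cballD:
  assumes "(x, y) \<in> cball (a, b) r"
  shows "norm (x - a) \<le> r" "norm (y - b) \<le> r"
proof -
  have "norm ((x, y) - (a, b)) \<le> r" using assms by (simp only: mem_cball dist_norm norm_minus_commute)
  then show "norm (x - a) \<le> r" "norm (y - b) \<le> r"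
    using norm_fst_le[of "x - a" "y - b"] norm_snd_le[of "y - b" "x - a"] by auto
qed

lemma half_plus_half: "(1/2) *\<^sub>R w + (1/2) *\<^sub>R w = (w::'a::real_vector)"
  by (simp flip: scaleR_left_distrib)

lemma half_sum_diff:
  fixes a b :: "'a::real_vector"
  shows "(1/2) *\<^sub>R (a + b) + (1/2) *\<^sub>R (a - b) = a" "(1/2) *\<^sub>R (a + b) - (1/2) *\<^sub>R (a - b) = b"
  unfolding scaleR_right_distrib scaleR_right_diff_distrib using half_plus_half[of a] half_plus_half[of b] by auto

text \<open>One constant \<open>M\<close> serves all estimates. \<open>psi_half\<close> makes
  \<open>\<psi>\<close> invertible in x at fixed w; \<open>strict\<close> encodes that at the base
  point the x-derivative of \<open>\<psi>\<close> is the identity, the x-gradient of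
  \<open>L\<close> is \<open>vb\<close> and its x-Hessian is the form \<open>H\<close>. Of the
  quadratic form itself only homogeneity and the local Lipschitz bound are recorded.\<close>

locale chart =
  fixes \<psi> :: "'a::euclidean_space \<times> 'w::euclidean_space \<Rightarrow> 'a"
    and L :: "'a \<times> 'w \<Rightarrow> real" and H :: "'a \<Rightarrow> real"
    and xb :: 'a and wb :: 'w and vb :: 'a and r0 M :: real
  assumes r0: "r0 > 0" and M: "M \<ge> 0"
    and psi_base: "\<psi> (xb, wb) = xb"
    and psi_lip: "M-lipschitz_on (cball (xb, wb) r0) \<psi>"
    and psi_par: "parallelogram_bound M (cball (xb, wb) r0) \<psi>"
    and L_lip: "M-lipschitz_on (cball (xb, wb) r0) L"
    and L_par: "parallelogram_bound M (cball (xb, wb) r0) L"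
    and psi_half: "\<And>x x' w. (x, w) \<in> cball (xb, wb) r0 \<Longrightarrow> (x', w) \<in> cball (xb, wb) r0 \<Longrightarrow>
        norm (\<psi> (x, w) - \<psi> (x', w) - (x - x')) \<le> norm (x - x') / 2"
    and strict: "\<And>e. e > 0 \<Longrightarrow> \<exists>r>0.
        (\<forall>x x' w. (x, w) \<in> cball (xb, wb) r \<longrightarrow> (x', w) \<in> cball (xb, wb) r \<longrightarrow>
           norm (\<psi> (x, w) - \<psi> (x', w) - (x - x')) \<le> e * norm (x - x') \<and>
           \<bar>L (x, w) - L (x', w) - vb \<bullet> (x - x')\<bar> \<le> e * norm (x - x')) \<and>
        (\<forall>x u w. (x + u, w) \<in> cball (xb, wb) r \<longrightarrow> (x - u, w) \<in> cball (xb, wb) r \<longrightarrow>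
           \<bar>L (x + u, w) + L (x - u, w) - 2 * L (x, w) - H u\<bar> \<le> e * (norm u)\<^sup>2)"
    and taylor: "\<And>x. (x, wb) \<in> cball (xb, wb) r0 \<Longrightarrow>
        \<bar>L (x, wb) - L (xb, wb) - vb \<bullet> (x - xb)\<bar> \<le> M * (norm (x - xb))\<^sup>2"
    and H_lip: "\<And>u u'. \<bar>H u - H u'\<bar> \<le> M * norm (u - u') * (norm u + norm u')"
    and H_scale: "\<And>s u. H (s *\<^sub>R u) = s\<^sup>2 * H u"
begin

text \<open>\<open>X (z, w)\<close> is the inverse chart at parameter w, and \<open>k\<close> is the
  tilted Lagrangian in chart coordinates. The radius satisfies \<open>(1 + M) * r1 = r0/16\<close>,
  the displacement of the centre that the fixed point argument in \<open>X_exists\<close> tolerates.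
  \<open>K1\<close> adds the Lipschitz constant 2 (1 + M) of \<open>X\<close> and the constant 1 of
  the second component of \<open>G\<close>.\<close>

definition "r1 = r0 / (16 * (1 + M))"
definition "K1 = 2 * (1 + M) + 1"
definition "X q = (THE x. (x, snd q) \<in> cball (xb, wb) (r0/4) \<and> \<psi> (x, snd q) = fst q)"
definition "G q = (X q, snd q)"
definition "k q v = L (G q) - v \<bullet> X q"

lemma r1: "r1 > 0" using r0 M by (simp add: r1_def)

lemma r1_M: "(1 + M) * r1 = r0/16" using M by (simp add: r1_def field_simps)

lemma r1_le: "r1 \<le> r0/16"
  using mult_right_mono[of 1 "1 + M" r1] r1 M unfolding r1_M by simp

lemma psi_expand:
  assumes "(x, w) \<in> cball (xb, wb) r0" "(x', w) \<in> cball (xb, wb) r0"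
  shows "norm (x - x') \<le> 2 * norm (\<psi> (x, w) - \<psi> (x', w))"
proof -
  have "norm (x - x') \<le> norm (\<psi> (x, w) - \<psi> (x', w)) + norm (\<psi> (x, w) - \<psi> (x', w) - (x - x'))"
    using norm_triangle_ineq4[of "\<psi> (x, w) - \<psi> (x', w)" "\<psi> (x, w) - \<psi> (x', w) - (x - x')"] by simp
  then show ?thesis using psi_half[OF assms] by simp
qed

text \<open>A solution is a fixed point of \<open>x - \<psi> (x, w) + z\<close>, a contraction with
  factor 1/2 by \<open>psi_half\<close>. It moves \<open>xb\<close> by at most r0/16, so the ball of
  radius r0/8 is mapped into itself.\<close>

lemma X_exists:
  assumes "(z, w) \<in> cball (xb, wb) r1"
  shows "\<exists>x. x \<in> cball xb (r0/8) \<and> \<psi> (x, w) = z"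
proof -
  have zw: "norm (z - xb) \<le> r1" "norm (w - wb) \<le> r1" using Pair_in_cballD[OF assms] by auto
  have r18: "r1 \<le> r0/8" using r1_le r0 by simp
  have inb: "(x, w) \<in> cball (xb, wb) r0" if "x \<in> cball xb (r0/8)" for x
    using that zw r18 r0 by (intro Pair_in_cballI) (simp add: dist_norm norm_minus_commute)
  define T where "T x = x - \<psi> (x, w) + z" for x
  have Td: "dist (T x) (T y) \<le> 1/2 * dist x y" if "x \<in> cball xb (r0/8)" "y \<in> cball xb (r0/8)" for x y
  proof -
    have "T x - T y = - (\<psi> (x, w) - \<psi> (y, w) - (x - y))" by (simp add: T_def algebra_simps)
    then show ?thesis using psi_half[OF inb[OF that(1)] inb[OF that(2)]] by (simp add: dist_norm del: minus_diff_eq)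
  qed
  have c: "xb \<in> cball xb (r0/8)" using r0 by simp
  have Tb: "norm (T xb - xb) \<le> r0/16"
  proof -
    have "T xb - xb = (z - xb) - (\<psi> (xb, w) - \<psi> (xb, wb))" by (simp add: T_def psi_base)
    then have "norm (T xb - xb) \<le> norm (z - xb) + norm (\<psi> (xb, w) - \<psi> (xb, wb))"
      by (simp only: norm_triangle_ineq4)
    also have "norm (\<psi> (xb, w) - \<psi> (xb, wb)) \<le> M * norm (w - wb)"
      using lipschitz_onD[OF psi_lip inb[OF c], of "(xb, wb)"] r0 by (simp add: dist_norm)
    also have "norm (z - xb) + M * norm (w - wb) \<le> r1 + M * r1"
      using zw M by (intro add_mono mult_left_mono) auto
    also have "\<dots> = r0/16" using r1_M by (simp add: algebra_simps)
    finally show ?thesis by simp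
  qed
  have "\<exists>!x. x \<in> cball xb (r0/8) \<and> T x = x"
  proof (rule Banach_fix[where c="1/2"])
    show "complete (cball xb (r0/8))" by (simp add: compact_imp_complete)
    show "cball xb (r0/8) \<noteq> {}" using c by blast
    show "T ` cball xb (r0/8) \<subseteq> cball xb (r0/8)"
    proof (intro image_subsetI)
      fix x assume x: "x \<in> cball xb (r0/8)"
      have "dist (T x) xb \<le> dist (T x) (T xb) + dist (T xb) xb" by (rule dist_triangle)
      also have "\<dots> \<le> 1/2 * dist x xb + r0/16" using Td[OF x c] Tb by (simp add: dist_norm)
      also have "\<dots> \<le> r0/8" using x by (simp add: dist_commute)
      finally show "T x \<in> cball xb (r0/8)" by (simp add: dist_commute)
    qed
  qed (use Td in auto)
  then show ?thesis by (auto simp: T_def)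
qed

lemma X_unique:
  assumes "(x, w) \<in> cball (xb, wb) (r0/4)" "\<psi> (x, w) = z"
  shows "X (z, w) = x"
proof -
  have sub: "cball (xb, wb) (r0/4) \<subseteq> cball (xb, wb) r0" using r0 by (intro subset_cball) simp
  have "x' = x" if "(x', w) \<in> cball (xb, wb) (r0/4)" "\<psi> (x', w) = z" for x'
    using psi_expand[OF subsetD[OF sub that(1)] subsetD[OF sub assms(1)]] unfolding that(2) assms(2) by simp
  then show ?thesis unfolding X_def fst_conv snd_conv using assms by (intro the_equality) blast+
qed

lemma X_props:
  assumes "q \<in> cball (xb, wb) r1"
  shows "norm (X q - xb) \<le> r0/8" "\<psi> (G q) = fst q" "G q \<in> cball (xb, wb) (r0/4)" "G q \<in> cball (xb, wb) r0"
proof -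
  obtain z w where q: "q = (z, w)" by force
  obtain x where x: "x \<in> cball xb (r0/8)" "\<psi> (x, w) = z" using X_exists assms q by blast
  have n: "norm (x - xb) \<le> r0/8" using x by (simp add: dist_norm norm_minus_commute)
  have "norm (w - wb) \<le> r1" using Pair_in_cballD assms q by blast
  then have i: "(x, w) \<in> cball (xb, wb) (r0/4)" using n r1_le r0 by (intro Pair_in_cballI) simp
  have "X q = x" unfolding q by (rule X_unique[OF i x(2)])
  then show "norm (X q - xb) \<le> r0/8" "\<psi> (G q) = fst q" "G q \<in> cball (xb, wb) (r0/4)" "G q \<in> cball (xb, wb) r0"
    using n x(2) i subsetD[OF subset_cball i, of r0] r0 unfolding G_def q fst_conv snd_conv by simp_all
qed

lemma G_base: "X (xb, wb) = xb" "G (xb, wb) = (xb, wb)"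
proof -
  show "X (xb, wb) = xb" using r0 by (intro X_unique) (auto simp: psi_base)
  then show "G (xb, wb) = (xb, wb)" by (simp add: G_def)
qed

lemma X_lip:
  assumes "p \<in> cball (xb, wb) r1" "q \<in> cball (xb, wb) r1"
  shows "norm (X p - X q) \<le> 2 * (1 + M) * norm (p - q)"
proof -
  obtain z w z' w' where pq: "p = (z, w)" "q = (z', w')" by (metis surj_pair)
  note Xp = X_props[OF assms(1)] and Xq = X_props[OF assms(2)]
  have w: "norm (w - wb) \<le> r1" using Pair_in_cballD assms(1) pq by blast
  \<comment> \<open>Mixed point: \<open>psi_expand\<close> compares only points with the same w, so
    the change of w is charged separately to the Lipschitz constant of
    \<open>\<psi>\<close>.\<close>
  have i: "(X q, w) \<in> cball (xb, wb) r0" using Xq(1) w r1_le r0 by (intro Pair_in_cballI) simp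
  have "norm (X p - X q) \<le> 2 * norm (\<psi> (X p, w) - \<psi> (X q, w))"
    using Xp(4) i by (intro psi_expand) (auto simp: G_def pq)
  also have "\<psi> (X p, w) - \<psi> (X q, w) = (z - z') - (\<psi> (X q, w) - \<psi> (X q, w'))"
    using Xp(2) Xq(2) by (simp add: G_def pq)
  also have "norm \<dots> \<le> norm (z - z') + norm (\<psi> (X q, w) - \<psi> (X q, w'))" by (rule norm_triangle_ineq4)
  also have "norm (\<psi> (X q, w) - \<psi> (X q, w')) \<le> M * norm (w - w')"
    using lipschitz_onD[OF psi_lip i, of "(X q, w')"] Xq(4) by (simp add: dist_norm G_def pq)
  also have "norm (z - z') \<le> norm (p - q)" using norm_fst_le[of "z - z'" "w - w'"] by (simp add: pq)
  also have "M * norm (w - w') \<le> M * norm (p - q)"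
    using norm_snd_le[of "w - w'" "z - z'"] M by (intro mult_left_mono) (auto simp: pq)
  finally show ?thesis by (simp add: algebra_simps)
qed

lemma K1: "K1 \<ge> 1" using M by (simp add: K1_def)

lemma G_lip:
  assumes "p \<in> cball (xb, wb) r1" "q \<in> cball (xb, wb) r1"
  shows "norm (G p - G q) \<le> K1 * norm (p - q)"
proof -
  have "norm (G p - G q) \<le> norm (X p - X q) + norm (snd p - snd q)"
    using norm_Pair_le[of "X p - X q" "snd p - snd q"] by (simp add: G_def)
  moreover have "norm (snd p - snd q) \<le> norm (p - q)" 
    using norm_snd_le[of "snd p - snd q" "fst p - fst q"] by (simp add: minus_prod_def)
  ultimately show ?thesis using X_lip[OF assms] by (simp add: K1_def algebra_simps)
qed

lemma X_lip_fst:
  assumes "(z, w) \<in> cball (xb, wb) r1" "(z', w) \<in> cball (xb, wb) r1"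
  shows "norm (X (z, w) - X (z', w)) \<le> 2 * norm (z - z')"
    "norm (X (z, w) - X (z', w) - (z - z')) \<le> norm (X (z, w) - X (z', w)) / 2"
    "norm (z - z') \<le> 3/2 * norm (X (z, w) - X (z', w))"
proof -
  note P = X_props[OF assms(1)] and Q = X_props[OF assms(2)]
  show "norm (X (z, w) - X (z', w)) \<le> 2 * norm (z - z')"
    using psi_expand[of "X (z, w)" w "X (z', w)"] P(2,4) Q(2,4) by (simp add: G_def)
  have "norm (\<psi> (X (z, w), w) - \<psi> (X (z', w), w) - (X (z, w) - X (z', w))) \<le> norm (X (z, w) - X (z', w)) / 2"
    using P(4) Q(4) by (intro psi_half) (auto simp: G_def)
  then show *: "norm (X (z, w) - X (z', w) - (z - z')) \<le> norm (X (z, w) - X (z', w)) / 2"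
    using P(2) Q(2) by (simp add: G_def norm_minus_commute)
  have "norm (z - z') \<le> norm (X (z, w) - X (z', w)) + norm (X (z, w) - X (z', w) - (z - z'))"
    using norm_triangle_ineq4[of "X (z, w) - X (z', w)" "X (z, w) - X (z', w) - (z - z')"] by simp
  then show "norm (z - z') \<le> 3/2 * norm (X (z, w) - X (z', w))" using * by simp
qed

text \<open>\<open>G\<close> does not preserve parallelograms, so three image corners are completed
  by \<open>e = G b + G c - G a\<close>. By \<open>psi_par\<close>, \<open>\<psi> e\<close> misses
  \<open>fst d = \<psi> (G d)\<close> only by a second-order term. As \<open>e\<close> and
  \<open>G d\<close> have the same w-component, \<open>psi_expand\<close> turns this into a bound on
  their distance, with a factor 2. For \<open>L\<close>, its own bound at \<open>e\<close> and its
  Lipschitz constant times that distance add up to \<open>2 * M * M + M\<close>; the two sides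
  contribute \<open>K1\<^sup>2\<close>.\<close>

lemma G_parallelogram:
  assumes U: "a \<in> cball (xb, wb) r1" "b \<in> cball (xb, wb) r1" "c \<in> cball (xb, wb) r1" "d \<in> cball (xb, wb) r1"
    and eq: "a + d = b + c"
  shows "norm (X d - X b - X c + X a) \<le> 2 * M * K1\<^sup>2 * norm (b - a) * norm (c - a)"
    and "\<bar>L (G d) - L (G b) - L (G c) + L (G a)\<bar> \<le> (2 * M * M + M) * K1\<^sup>2 * norm (b - a) * norm (c - a)"
proof -
  define e where "e = G b + G c - G a"
  have sd: "snd e = snd d" using arg_cong[OF eq, of snd] by (simp add: e_def G_def algebra_simps)
  have fd: "fst d = fst b + fst c - fst a" using arg_cong[OF eq, of fst] by (simp add: algebra_simps)
  have prod: "norm (G b - G a) * norm (G c - G a) \<le> K1\<^sup>2 * norm (b - a) * norm (c - a)"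
    using mult_mono[OF G_lip[OF U(2,1)] G_lip[OF U(3,1)]] K1 by (simp add: power2_eq_square mult_ac)
  have e: "e \<in> cball (xb, wb) r0"
  proof -
    have fe: "fst e - xb = (X b - xb) + (X c - xb) - (X a - xb)" by (simp add: e_def G_def)
    have "norm (fst e - xb) \<le> norm (X b - xb) + norm (X c - xb) + norm (X a - xb)"
      using norm_triangle_ineq4[of "(X b - xb) + (X c - xb)" "X a - xb"] norm_triangle_ineq[of "X b - xb" "X c - xb"]
      unfolding fe by linarith
    moreover have "norm (snd d - wb) \<le> r1" using Pair_in_cballD[of "fst d" "snd d"] U(4) by simp
    ultimately have "norm (fst e - xb) + norm (snd e - wb) \<le> r0"
      using X_props(1)[OF U(1)] X_props(1)[OF U(2)] X_props(1)[OF U(3)] r1_le r0 sd by simp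
    then show ?thesis using Pair_in_cballI[of "fst e" xb "snd e" wb r0] by simp
  qed
  have ae: "G a + e = G b + G c" by (simp add: e_def)
  have ba: "norm (f e - f (G b) - f (G c) + f (G a)) \<le> M * K1\<^sup>2 * norm (b - a) * norm (c - a)"
    if "parallelogram_bound M (cball (xb, wb) r0) f" for f :: "'a \<times> 'w \<Rightarrow> 'c::real_normed_vector"
    using parallelogram_boundD[OF that X_props(4)[OF U(1)] X_props(4)[OF U(2)] X_props(4)[OF U(3)] e ae]
      mult_left_mono[OF prod M] by (simp add: mult_ac)
  have Xe: "norm (X d - fst e) \<le> 2 * (M * K1\<^sup>2 * norm (b - a) * norm (c - a))"
  proof -
    have e2: "(fst e, snd d) = e" by (simp add: sd[symmetric])
    have "norm (X d - fst e) \<le> 2 * norm (\<psi> (X d, snd d) - \<psi> (fst e, snd d))"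
      using X_props(4)[OF U(4)] e unfolding G_def by (intro psi_expand) (auto simp: e2)
    also have "\<psi> (X d, snd d) - \<psi> (fst e, snd d) = - (\<psi> e - \<psi> (G b) - \<psi> (G c) + \<psi> (G a))"
      using X_props(2)[OF U(4)] X_props(2)[OF U(1)] X_props(2)[OF U(2)] X_props(2)[OF U(3)]
      unfolding e2 by (simp add: G_def fd)
    finally show ?thesis using ba[OF psi_par] by (simp only: norm_minus_cancel)
  qed
  have "X d - X b - X c + X a = X d - fst e" by (simp add: e_def G_def)
  from this[symmetric] show "norm (X d - X b - X c + X a) \<le> 2 * M * K1\<^sup>2 * norm (b - a) * norm (c - a)"
    using Xe by (simp only: mult.assoc)
  have "\<bar>L (G d) - L e\<bar> \<le> M * norm (G d - e)"
    using lipschitz_onD[OF L_lip X_props(4)[OF U(4)] e] by (simp add: dist_norm)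
  also have "norm (G d - e) \<le> norm (X d - fst e)"
    using norm_Pair_le[of "X d - fst e" "snd d - snd e"] by (simp add: G_def sd minus_prod_def)
  also have "M * norm (X d - fst e) \<le> M * (2 * (M * K1\<^sup>2 * norm (b - a) * norm (c - a)))"
    by (rule mult_left_mono[OF Xe M])
  finally have "\<bar>L (G d) - L e\<bar> \<le> M * (2 * (M * K1\<^sup>2 * norm (b - a) * norm (c - a)))" using M by (simp add: mult_left_mono)
  then have "\<bar>L (G d) - L (G b) - L (G c) + L (G a)\<bar>
      \<le> M * (2 * (M * K1\<^sup>2 * norm (b - a) * norm (c - a))) + M * K1\<^sup>2 * norm (b - a) * norm (c - a)"
    using ba[OF L_par] by simp
  then show "\<bar>L (G d) - L (G b) - L (G c) + L (G a)\<bar> \<le> (2 * M * M + M) * K1\<^sup>2 * norm (b - a) * norm (c - a)"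
    by (simp add: algebra_simps)
qed

text \<open>The estimate behind Lipschitz continuity of minimizers. The bilinear term
  \<open>v \<bullet> X\<close> splits into \<open>v - v'\<close> against a difference of
  \<open>X\<close> in z, and \<open>v'\<close> against a mixed difference of \<open>X\<close>; the
  latter is where the bound \<open>B\<close> enters.\<close>

lemma k_double_difference:
  "\<exists>C\<ge>0. \<forall>z z' w w' v v'. (z, w) \<in> cball (xb, wb) r1 \<longrightarrow> (z', w) \<in> cball (xb, wb) r1 \<longrightarrow>
     (z, w') \<in> cball (xb, wb) r1 \<longrightarrow> (z', w') \<in> cball (xb, wb) r1 \<longrightarrow> norm v' \<le> B \<longrightarrow>
     \<bar>k (z, w) v - k (z', w) v - k (z, w') v' + k (z', w') v'\<bar> \<le> C * norm (z - z') * norm ((w, v) - (w', v'))"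
proof (intro exI conjI allI impI)
  let ?C = "(2 * M * M + M) * K1\<^sup>2 + 2 + \<bar>B\<bar> * (2 * M * K1\<^sup>2)"
  show "?C \<ge> 0" using M by simp
  fix z z' :: 'a and w w' :: 'w and v v' :: 'a assume U: "(z, w) \<in> cball (xb, wb) r1" "(z', w) \<in> cball (xb, wb) r1"
    "(z, w') \<in> cball (xb, wb) r1" "(z', w') \<in> cball (xb, wb) r1" and B: "norm v' \<le> B"
  let ?D = "norm (z - z') * norm ((w, v) - (w', v'))"
  have par: "(z', w') + (z, w) = (z, w') + (z', w)" by simp
  note P = G_parallelogram[OF U(4,3,2,1) par]
  have nw: "norm (w - w') \<le> norm ((w, v) - (w', v'))" and nv: "norm (v - v') \<le> norm ((w, v) - (w', v'))"
    using norm_fst_le[of "w - w'" "v - v'"] norm_snd_le[of "v - v'" "w - w'"] by auto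
  have n1: "norm ((z, w') - (z', w')) = norm (z - z')" by simp
  have n2: "norm ((z', w) - (z', w')) = norm (w - w')" by simp
  have zz: "norm (z - z') * norm (w - w') \<le> ?D" by (rule mult_left_mono[OF nw]) simp
  have tri: "\<bar>a - (b + c)\<bar> \<le> \<bar>a\<bar> + (\<bar>b\<bar> + \<bar>c\<bar>)" for a b c :: real by linarith
  let ?LL = "L (G (z, w)) - L (G (z, w')) - L (G (z', w)) + L (G (z', w'))"
  let ?XX = "X (z, w) - X (z, w') - X (z', w) + X (z', w')"
  have c: "(2 * M * M + M) * K1\<^sup>2 \<ge> 0" "2 * M * K1\<^sup>2 \<ge> 0" using M by auto
  have a1: "\<bar>?LL\<bar> \<le> ((2 * M * M + M) * K1\<^sup>2) * ?D"
  proof -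
    have "\<bar>?LL\<bar> \<le> ((2 * M * M + M) * K1\<^sup>2) * (norm (z - z') * norm (w - w'))"
      using P(2) unfolding n1 n2 by (simp only: mult.assoc)
    also have "\<dots> \<le> ((2 * M * M + M) * K1\<^sup>2) * ?D" by (rule mult_left_mono[OF zz c(1)])
    finally show ?thesis .
  qed
  have a2: "\<bar>(v - v') \<bullet> (X (z, w) - X (z', w))\<bar> \<le> 2 * ?D"
  proof -
    have "\<bar>(v - v') \<bullet> (X (z, w) - X (z', w))\<bar> \<le> norm (v - v') * norm (X (z, w) - X (z', w))"
      by (rule Cauchy_Schwarz_ineq2)
    also have "\<dots> \<le> norm ((w, v) - (w', v')) * (2 * norm (z - z'))"
      by (rule mult_mono[OF nv X_lip_fst(1)[OF U(1,2)]]) auto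
    finally show ?thesis by (simp only: mult_ac)
  qed
  have a3: "\<bar>v' \<bullet> ?XX\<bar> \<le> (\<bar>B\<bar> * (2 * M * K1\<^sup>2)) * ?D"
  proof -
    have "norm ?XX \<le> (2 * M * K1\<^sup>2) * (norm (z - z') * norm (w - w'))"
      using P(1) unfolding n1 n2 by (simp only: mult.assoc)
    also have "\<dots> \<le> (2 * M * K1\<^sup>2) * ?D" by (rule mult_left_mono[OF zz c(2)])
    finally have "norm ?XX \<le> (2 * M * K1\<^sup>2) * ?D" .
    moreover have "norm v' \<le> \<bar>B\<bar>" using B by simp
    ultimately have "norm v' * norm ?XX \<le> \<bar>B\<bar> * ((2 * M * K1\<^sup>2) * ?D)" by (intro mult_mono) auto
    then show ?thesis using order_trans[OF Cauchy_Schwarz_ineq2[of v' ?XX]] by (simp only: mult.assoc)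
  qed
  have "\<bar>k (z, w) v - k (z', w) v - k (z, w') v' + k (z', w') v'\<bar>
      = \<bar>?LL - ((v - v') \<bullet> (X (z, w) - X (z', w)) + v' \<bullet> ?XX)\<bar>"
    by (simp add: k_def inner_diff_left inner_diff_right inner_add_right)
  also have "\<dots> \<le> ((2 * M * M + M) * K1\<^sup>2) * ?D + (2 * ?D + (\<bar>B\<bar> * (2 * M * K1\<^sup>2)) * ?D)"
    by (rule order_trans[OF tri add_mono[OF a1 add_mono[OF a2 a3]]])
  also have "\<dots> = ?C * ?D" by (simp only: distrib_right add.assoc)
  finally show "\<bar>k (z, w) v - k (z', w) v - k (z, w') v' + k (z', w') v'\<bar> \<le> ?C * norm (z - z') * norm ((w, v) - (w', v'))"
    by (simp only: mult.assoc)
qed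

text \<open>Since the chart is tangent to the identity at the base point, \<open>k\<close> inherits
  the first- and second-order behaviour of \<open>L - v \<bullet> x\<close>: slope nearly zero for v
  near \<open>vb\<close>, and second differences close to \<open>H\<close>.\<close>

lemma k_local:
  assumes "e > 0"
  shows "\<exists>r>0. r \<le> r1 \<and>
    (\<forall>z z' w v. (z, w) \<in> cball (xb, wb) r \<longrightarrow> (z', w) \<in> cball (xb, wb) r \<longrightarrow> norm (v - vb) \<le> r \<longrightarrow>
       \<bar>k (z, w) v - k (z', w) v\<bar> \<le> e * norm (z - z')) \<and>
    (\<forall>z u w v. (z + u, w) \<in> cball (xb, wb) r \<longrightarrow> (z - u, w) \<in> cball (xb, wb) r \<longrightarrow> norm (v - vb) \<le> r \<longrightarrow>
       \<bar>k (z + u, w) v + k (z - u, w) v - 2 * k (z, w) v - H u\<bar> \<le> e * (norm u)\<^sup>2)"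
proof -
  \<comment> \<open>The denominator collects three errors of the second-difference estimate: 4 from
    a half-difference of norm up to \<open>2 * norm u\<close>, \<open>6 * M\<close> from replacing
    \<open>H y\<close> by \<open>H u\<close>, and \<open>4 * M * K1\<^sup>2\<close> from the shift
    of the midpoint.\<close>
  define d where "d = e / (4 + 6 * M + 4 * M * K1\<^sup>2)"
  have den: "4 + 6 * M + 4 * M * K1\<^sup>2 > 0" using M K1 by (intro add_pos_nonneg) auto
  have d: "d > 0" using assms den by (simp add: d_def)
  have de: "d * (4 + 6 * M + 4 * M * K1\<^sup>2) = e" using den by (simp add: d_def)
  obtain \<rho> where \<rho>: "\<rho> > 0"
    "\<And>x x' w. (x, w) \<in> cball (xb, wb) \<rho> \<Longrightarrow> (x', w) \<in> cball (xb, wb) \<rho> \<Longrightarrow>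
       norm (\<psi> (x, w) - \<psi> (x', w) - (x - x')) \<le> d * norm (x - x')"
    "\<And>x x' w. (x, w) \<in> cball (xb, wb) \<rho> \<Longrightarrow> (x', w) \<in> cball (xb, wb) \<rho> \<Longrightarrow>
       \<bar>L (x, w) - L (x', w) - vb \<bullet> (x - x')\<bar> \<le> d * norm (x - x')"
    "\<And>x u w. (x + u, w) \<in> cball (xb, wb) \<rho> \<Longrightarrow> (x - u, w) \<in> cball (xb, wb) \<rho> \<Longrightarrow>
       \<bar>L (x + u, w) + L (x - u, w) - 2 * L (x, w) - H u\<bar> \<le> d * (norm u)\<^sup>2"
    using strict[OF d] by blast
  define r where "r = min (min r1 d) (\<rho> / K1)"
  have r: "r > 0" "r \<le> r1" "r \<le> d" "K1 * r \<le> \<rho>"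
  proof -
    have "r \<le> \<rho> / K1" by (simp add: r_def)
    then show "K1 * r \<le> \<rho>" using K1 by (simp add: field_simps)
  qed (use r1 d \<rho>(1) K1 in \<open>auto simp: r_def\<close>)
  have in1: "q \<in> cball (xb, wb) r1" if "q \<in> cball (xb, wb) r" for q using that r(2) by auto
  have inG: "G q \<in> cball (xb, wb) \<rho>" if "q \<in> cball (xb, wb) r" for q
  proof -
    have "norm (G q - G (xb, wb)) \<le> K1 * norm (q - (xb, wb))" using in1[OF that] r1 by (intro G_lip) auto
    also have "\<dots> \<le> K1 * r" using that K1 by (intro mult_left_mono) (auto simp: dist_norm norm_minus_commute)
    finally show ?thesis using r(4) by (simp add: G_base dist_norm norm_minus_commute)
  qed
  have lin: "\<bar>(L (x, w) - v \<bullet> x) - (L (x', w) - v \<bullet> x')\<bar> \<le> 2 * d * norm (x - x')"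
    if "(x, w) \<in> cball (xb, wb) \<rho>" "(x', w) \<in> cball (xb, wb) \<rho>" "norm (v - vb) \<le> r" for x x' w v
  proof -
    have "(L (x, w) - v \<bullet> x) - (L (x', w) - v \<bullet> x') = (L (x, w) - L (x', w) - vb \<bullet> (x - x')) - (v - vb) \<bullet> (x - x')"
      by (simp add: algebra_simps)
    moreover have "\<bar>(v - vb) \<bullet> (x - x')\<bar> \<le> d * norm (x - x')"
      using Cauchy_Schwarz_ineq2[of "v - vb" "x - x'"] mult_right_mono[of "norm (v - vb)" d "norm (x - x')"] that(3) r(3)
      by simp
    ultimately show ?thesis using \<rho>(3)[OF that(1,2)] by linarith
  qed
  have tri: "\<bar>p + q - 2 * x - hu\<bar> \<le> A + B + 2 * C"
    if "\<bar>p + q - 2 * m - hy\<bar> \<le> A" "\<bar>hy - hu\<bar> \<le> B" "\<bar>m - x\<bar> \<le> C" for p q m x hy hu A B C :: real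
    using that by linarith
  have de4: "4 * d \<le> e"
    using mult_left_mono[of 4 "4 + 6 * M + 4 * M * K1\<^sup>2" d] M d de by simp
  show ?thesis
  proof (intro exI conjI allI impI)
    show "r > 0" "r \<le> r1" by (rule r)+
    fix z z' w v assume U: "(z, w) \<in> cball (xb, wb) r" "(z', w) \<in> cball (xb, wb) r" and v: "norm (v - vb) \<le> r"
    have "\<bar>k (z, w) v - k (z', w) v\<bar> \<le> 2 * d * norm (X (z, w) - X (z', w))"
      using lin[OF _ _ v, of "X (z, w)" w "X (z', w)"] inG[OF U(1)] inG[OF U(2)] by (simp add: k_def G_def)
    also have "\<dots> \<le> 2 * d * (2 * norm (z - z'))"
      using X_lip_fst(1)[OF in1[OF U(1)] in1[OF U(2)]] d by (intro mult_left_mono) auto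
    also have "\<dots> \<le> e * norm (z - z')" using mult_right_mono[OF de4, of "norm (z - z')"] by simp
    finally show "\<bar>k (z, w) v - k (z', w) v\<bar> \<le> e * norm (z - z')" .
  next
    fix z u w v assume U: "(z + u, w) \<in> cball (xb, wb) r" "(z - u, w) \<in> cball (xb, wb) r" and v: "norm (v - vb) \<le> r"
    have U0: "(z, w) \<in> cball (xb, wb) r"
    proof -
      have "(z, w) = (1 - 1/2) *\<^sub>R (z + u, w) + (1/2) *\<^sub>R (z - u, w)"
        by (simp add: half_sum_diff half_plus_half)
      then show ?thesis using convexD_alt[OF convex_cball U, of "1/2"] by simp
    qed
    let ?xp = "X (z + u, w)" and ?xm = "X (z - u, w)" and ?x0 = "X (z, w)"
    \<comment> \<open>The inverse chart does not send the midpoint \<open>z\<close> to the midpoint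
      \<open>m\<close>. The second difference is taken around \<open>m\<close> with half-difference
      \<open>y\<close>; then \<open>m\<close> is replaced by \<open>?x0\<close>, at distance of
      order \<open>(norm u)\<^sup>2\<close> and with slope at most \<open>2 * d\<close>, and
      \<open>y\<close> by \<open>u\<close>.\<close>
    define m where "m = (1/2) *\<^sub>R (?xp + ?xm)"
    define y where "y = (1/2) *\<^sub>R (?xp - ?xm)"
    have my: "m + y = ?xp" "m - y = ?xm"
      by (auto simp: m_def y_def half_sum_diff)
    note Gp = inG[OF U(1), unfolded G_def snd_conv] and Gm = inG[OF U(2), unfolded G_def snd_conv]
      and G0 = inG[OF U0, unfolded G_def snd_conv]
    have mw: "(m, w) \<in> cball (xb, wb) \<rho>"
    proof -
      have "(m, w) = (1 - 1/2) *\<^sub>R (?xp, w) + (1/2) *\<^sub>R (?xm, w)"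
        by (simp add: m_def half_plus_half scaleR_right_distrib)
      then show ?thesis using convexD_alt[OF convex_cball Gp Gm, of "1/2"] by simp
    qed
    have mx: "norm (m - ?x0) \<le> M * K1\<^sup>2 * (norm u)\<^sup>2"
    proof -
      have "norm (?xm - ?x0 - ?x0 + ?xp) \<le> 2 * M * K1\<^sup>2 * norm ((z, w) - (z + u, w)) * norm ((z, w) - (z + u, w))"
        using U U0 in1 by (intro G_parallelogram(1)) auto
      also have "norm ((z, w) - (z + u, w)) = norm u" by simp
      also have "?xm - ?x0 - ?x0 + ?xp = 2 *\<^sub>R (m - ?x0)"
        by (simp add: m_def algebra_simps scaleR_2)
      finally show ?thesis by (simp add: power2_eq_square)
    qed
    have ny: "norm y \<le> 2 * norm u"
    proof -
      have "norm (?xp - ?xm) \<le> 2 * norm ((z + u) - (z - u))"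
        by (rule X_lip_fst(1)[OF in1[OF U(1)] in1[OF U(2)]])
      also have "(z + u) - (z - u) = 2 *\<^sub>R u" by (simp add: scaleR_2)
      finally show ?thesis by (simp add: y_def)
    qed
    have yu: "norm (y - u) \<le> d * (2 * norm u)"
    proof -
      have "norm (\<psi> (?xp, w) - \<psi> (?xm, w) - (?xp - ?xm)) \<le> d * norm (?xp - ?xm)"
        by (rule \<rho>(2)[OF Gp Gm])
      also have "\<psi> (?xp, w) - \<psi> (?xm, w) - (?xp - ?xm) = 2 *\<^sub>R (u - y)"
        using X_props(2)[OF in1[OF U(1)]] X_props(2)[OF in1[OF U(2)]]
        by (simp add: G_def y_def algebra_simps scaleR_2)
      also have "norm (?xp - ?xm) = 2 * norm y" by (simp add: y_def)
      finally have "norm (y - u) \<le> d * norm y" by (simp add: norm_minus_commute)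
      also have "d * norm y \<le> d * (2 * norm u)" using ny d by (intro mult_left_mono) auto
      finally show ?thesis .
    qed
    let ?h = "\<lambda>x. L (x, w) - v \<bullet> x"
    have "\<bar>H y - H u\<bar> \<le> M * norm (y - u) * (norm y + norm u)" by (rule H_lip)
    also have "\<dots> \<le> M * (d * (2 * norm u)) * (3 * norm u)"
      using yu ny M d by (intro mult_mono mult_left_mono) auto
    finally have e1: "\<bar>H y - H u\<bar> \<le> 6 * M * d * (norm u)\<^sup>2" by (simp add: power2_eq_square mult_ac)
    have "\<bar>?h ?xp + ?h ?xm - 2 * ?h m - H y\<bar> \<le> d * (norm y)\<^sup>2"
    proof -
      have i: "v \<bullet> ?xp + v \<bullet> ?xm = 2 * (v \<bullet> m)" by (simp add: m_def inner_add_right)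
      show ?thesis using \<rho>(4)[of m y w] Gp Gm i unfolding my by (simp add: algebra_simps)
    qed
    also have "\<dots> \<le> d * (2 * norm u)\<^sup>2" using d ny by (intro mult_left_mono power_mono) auto
    finally have e2: "\<bar>?h ?xp + ?h ?xm - 2 * ?h m - H y\<bar> \<le> 4 * d * (norm u)\<^sup>2" by (simp add: power_mult_distrib)
    have "\<bar>?h m - ?h ?x0\<bar> \<le> 2 * d * norm (m - ?x0)" by (rule lin[OF mw G0 v])
    also have "\<dots> \<le> 2 * d * (M * K1\<^sup>2 * (norm u)\<^sup>2)" using mx d by (intro mult_left_mono) auto
    finally have e3: "\<bar>?h m - ?h ?x0\<bar> \<le> 2 * d * (M * K1\<^sup>2 * (norm u)\<^sup>2)" .
    have "\<bar>?h ?xp + ?h ?xm - 2 * ?h ?x0 - H u\<bar>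
        \<le> 4 * d * (norm u)\<^sup>2 + 6 * M * d * (norm u)\<^sup>2 + 2 * (2 * d * (M * K1\<^sup>2 * (norm u)\<^sup>2))"
      by (rule tri[OF e2 e1 e3])
    also have "\<dots> = (d * (4 + 6 * M + 4 * M * K1\<^sup>2)) * (norm u)\<^sup>2" by (simp add: algebra_simps)
    finally show "\<bar>k (z + u, w) v + k (z - u, w) v - 2 * k (z, w) v - H u\<bar> \<le> e * (norm u)\<^sup>2"
      unfolding de by (simp add: k_def G_def)
  qed
qed

end

section \<open>Smooth plus polyhedral objectives\<close>

text \<open>The inclusion of \<open>C\<close> in \<open>S\<close> serves the sufficiency of positive
  definiteness. That \<open>S\<close> is not too large enters only in the converse, as the
  hypothesis that some point of \<open>C\<close> has a neighbourhood relative to \<open>S\<close>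
  inside \<open>C\<close>.\<close>

locale composite = chart \<psi> L H xb wb vb r0 M
  for \<psi> :: "'a::euclidean_space \<times> 'w::euclidean_space \<Rightarrow> 'a"
    and L :: "'a \<times> 'w \<Rightarrow> real" and H :: "'a \<Rightarrow> real"
    and xb :: 'a and wb :: 'w and vb :: 'a and r0 M :: real +
  fixes f :: "'a \<times> 'w \<Rightarrow> ereal" and \<pi> :: "'a \<Rightarrow> ereal" and C S :: "'a set" and \<alpha> :: real
  assumes f_eq: "\<forall>\<^sub>F q in nhds (xb, wb). f q = ereal (L q) + \<pi> (\<psi> q - xb)"
    and alpha: "\<alpha> > 0"
    and C_closed: "closed C" and C_convex: "convex C" and C_zero: "0 \<in> C"
    and C_scale: "\<And>s u. u \<in> C \<Longrightarrow> 0 \<le> s \<Longrightarrow> s *\<^sub>R u \<in> C"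
    and C_S: "C \<subseteq> S" and S: "subspace S"
    and pi_zero: "\<And>u. u \<in> C \<Longrightarrow> \<pi> u = 0"
    and pi_sharp: "\<And>u. ereal (\<alpha> * norm (u - closest_point C u)) \<le> \<pi> u"
begin

lemma norm_closest_point_C: "norm (closest_point C u) \<le> norm u"
  using closest_point_lipschitz[OF C_convex C_closed, of u 0] C_zero closest_point_self[OF C_zero]
  by (auto simp: dist_norm)

text \<open>Exact penalization. Replacing \<open>z - xb\<close> by its projection \<open>c\<close>
  to \<open>C\<close> changes \<open>k\<close> by at most \<open>\<alpha>/2\<close> times the
  distance, while \<open>\<pi>\<close> was at least \<open>\<alpha>\<close> times the distance. So a
  point off the image of \<open>xb + C\<close> is strictly beaten by one on it, where the objective
  equals \<open>k\<close>.\<close>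

lemma reduction:
  assumes "e > 0" "b > 0"
  obtains r \<rho> where "r > 0" "\<rho> > 0" "r \<le> b" "2 * r \<le> r1"
    "\<And>z z' w v. norm (z - xb) \<le> r \<Longrightarrow> norm (z' - xb) \<le> r \<Longrightarrow> norm (w - wb) \<le> r \<Longrightarrow> norm (v - vb) \<le> r \<Longrightarrow>
       \<bar>k (z, w) v - k (z', w) v\<bar> \<le> e * norm (z - z')"
    "\<And>z u w v. norm (z + u - xb) \<le> r \<Longrightarrow> norm (z - u - xb) \<le> r \<Longrightarrow> norm (w - wb) \<le> r \<Longrightarrow> norm (v - vb) \<le> r \<Longrightarrow>
       \<bar>k (z + u, w) v + k (z - u, w) v - 2 * k (z, w) v - H u\<bar> \<le> e * (norm u)\<^sup>2"
    "\<And>c w v. c \<in> C \<Longrightarrow> norm c \<le> r \<Longrightarrow> norm (w - wb) \<le> r \<Longrightarrow>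
       f (X (xb + c, w), w) - ereal (v \<bullet> X (xb + c, w)) = ereal (k (xb + c, w) v)"
    "\<And>x w v. norm (x - xb) \<le> \<rho> \<Longrightarrow> norm (w - wb) \<le> \<rho> \<Longrightarrow> norm (v - vb) \<le> r \<Longrightarrow>
       \<exists>c\<in>C. norm c \<le> r \<and> (x = X (xb + c, w) \<or> ereal (k (xb + c, w) v) < f (x, w) - ereal (v \<bullet> x))"
proof -
  define e' where "e' = min e (\<alpha>/2)"
  have e': "e' > 0" "e' \<le> e" "e' \<le> \<alpha>/2" using assms alpha by (auto simp: e'_def)
  obtain ra where ra: "ra > 0" "ra \<le> r1"
    "\<And>z z' w v. (z, w) \<in> cball (xb, wb) ra \<Longrightarrow> (z', w) \<in> cball (xb, wb) ra \<Longrightarrow> norm (v - vb) \<le> ra \<Longrightarrow>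
       \<bar>k (z, w) v - k (z', w) v\<bar> \<le> e' * norm (z - z')"
    "\<And>z u w v. (z + u, w) \<in> cball (xb, wb) ra \<Longrightarrow> (z - u, w) \<in> cball (xb, wb) ra \<Longrightarrow> norm (v - vb) \<le> ra \<Longrightarrow>
       \<bar>k (z + u, w) v + k (z - u, w) v - 2 * k (z, w) v - H u\<bar> \<le> e' * (norm u)\<^sup>2"
    using k_local[OF e'(1)] by metis
  obtain rf where rf: "rf > 0" "\<And>q. q \<in> cball (xb, wb) rf \<Longrightarrow> f q = ereal (L q) + \<pi> (\<psi> q - xb)"
    using f_eq unfolding eventually_nhds_metric_le by (auto simp: dist_commute)
  \<comment> \<open>The bound by \<open>rf / (2 * K1)\<close> keeps \<open>G (xb + c, w)\<close> in
    the ball where the decomposition of \<open>f\<close> holds.\<close>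
  define r where "r = min b (min (ra/2) (rf / (2 * K1)))"
  have r: "r > 0" "r \<le> b" "2 * r \<le> ra" using assms ra(1) rf(1) K1 by (auto simp: r_def)
  have rK: "K1 * (2 * r) \<le> rf"
  proof -
    have "r \<le> rf / (2 * K1)" by (simp add: r_def)
    then show ?thesis using K1 by (simp add: field_simps)
  qed
  \<comment> \<open>In turn: \<open>\<psi>\<close> sends the \<open>\<rho>\<close>-neighbourhood
    into the \<open>r\<close>-ball around \<open>xb\<close>, the decomposition of \<open>f\<close>
    is valid there, \<open>X_unique\<close> applies, and \<open>w\<close> satisfies the bounds
    stated with \<open>r\<close>.\<close>
  define \<rho> where "\<rho> = min (r/(2 * (M + 1))) (min (rf/2) (min (r0/8) r))"
  have \<rho>: "\<rho> > 0" "2 * \<rho> \<le> rf" "2 * \<rho> \<le> r0/4" "\<rho> \<le> r" using r(1) rf(1) M r0 by (auto simp: \<rho>_def)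
  have \<rho>M: "(M + 1) * (2 * \<rho>) \<le> r"
  proof -
    have "\<rho> \<le> r / (2 * (M + 1))" by (simp add: \<rho>_def)
    then show ?thesis using M by (simp add: field_simps)
  qed
  have inr: "(z, w) \<in> cball (xb, wb) ra" if "norm (z - xb) \<le> r" "norm (w - wb) \<le> r" for z w
    using that r(3) by (intro Pair_in_cballI) simp
  have val: "f (X (xb + c, w), w) - ereal (v \<bullet> X (xb + c, w)) = ereal (k (xb + c, w) v)"
    if c: "c \<in> C" "norm c \<le> r" and w: "norm (w - wb) \<le> r" for c w v
  proof -
    have "(xb + c, w) \<in> cball (xb, wb) (2 * r)" using c(2) w by (intro Pair_in_cballI) simp
    then have i: "(xb + c, w) \<in> cball (xb, wb) r1" and n: "norm ((xb + c, w) - (xb, wb)) \<le> 2 * r"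
      using r(3) ra(2) by (auto simp: dist_norm norm_minus_commute simp del: diff_Pair)
    have "norm (G (xb + c, w) - G (xb, wb)) \<le> K1 * norm ((xb + c, w) - (xb, wb))"
      using i r1 by (intro G_lip) auto
    also have "\<dots> \<le> K1 * (2 * r)" using n K1 by (intro mult_left_mono) auto
    finally have "G (xb + c, w) \<in> cball (xb, wb) rf"
      using rK by (simp add: G_base dist_norm norm_minus_commute)
    from rf(2)[OF this] have "f (G (xb + c, w)) = ereal (L (G (xb + c, w))) + \<pi> c"
      using X_props(2)[OF i] by simp
    then show ?thesis using pi_zero[OF c(1)] by (simp add: G_def k_def)
  qed
  have red: "\<exists>c\<in>C. norm c \<le> r \<and> (x = X (xb + c, w) \<or> ereal (k (xb + c, w) v) < f (x, w) - ereal (v \<bullet> x))"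
    if x: "norm (x - xb) \<le> \<rho>" and w: "norm (w - wb) \<le> \<rho>" and v: "norm (v - vb) \<le> r" for x w v
  proof -
    have i: "(x, w) \<in> cball (xb, wb) (2 * \<rho>)" using x w by (intro Pair_in_cballI) simp
    then have i0: "(x, w) \<in> cball (xb, wb) (r0/4)" and i1: "(x, w) \<in> cball (xb, wb) rf"
      and i2: "(x, w) \<in> cball (xb, wb) r0" using \<rho> r0 by auto
    define z where "z = \<psi> (x, w)"
    define c where "c = closest_point C (z - xb)"
    have Xz: "X (z, w) = x" using X_unique[OF i0] by (simp add: z_def)
    have kz: "k (z, w) v = L (x, w) - v \<bullet> x" by (simp add: k_def G_def Xz)
    have "norm (z - xb) \<le> M * norm ((x, w) - (xb, wb))"
      using lipschitz_onD[OF psi_lip i2, of "(xb, wb)"] r0 by (simp add: dist_norm psi_base z_def)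
    also have "\<dots> \<le> (M + 1) * (2 * \<rho>)" using i M by (intro mult_mono) (auto simp: dist_norm norm_minus_commute simp del: diff_Pair)
    finally have zn: "norm (z - xb) \<le> r" using \<rho>M by simp
    then have cn: "norm c \<le> r" using norm_closest_point_C[of "z - xb"] by (simp add: c_def)
    have cC: "c \<in> C" unfolding c_def using C_zero by (intro closest_point_in_set C_closed) auto
    define n where "n = norm (z - xb - c)"
    have wr: "norm (w - wb) \<le> r" and vr: "norm (v - vb) \<le> ra" using w v \<rho>(4) r(1,3) by auto
    have "\<bar>k (z, w) v - k (xb + c, w) v\<bar> \<le> e' * norm (z - (xb + c))"
      using zn cn by (intro ra(3) inr wr vr) auto
    also have "\<dots> \<le> \<alpha>/2 * n" using mult_right_mono[OF e'(3), of n] by (simp add: n_def diff_diff_eq)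
    finally have kc: "k (xb + c, w) v \<le> k (z, w) v + \<alpha>/2 * n" by linarith
    show ?thesis
    proof (cases "n = 0")
      case True
      then have "z - xb = c" by (simp add: n_def)
      then have "z = xb + c" by (simp only: diff_eq_eq add.commute)
      then show ?thesis using cC cn Xz by auto
    next
      case False
      then have "n > 0" by (simp add: n_def)
      then have "\<alpha> * n > \<alpha>/2 * n" using alpha by simp
      then have "ereal (k (xb + c, w) v) < ereal (L (x, w) - v \<bullet> x + \<alpha> * n)" using kc kz by simp
      also have "\<dots> = ereal (L (x, w)) + ereal (\<alpha> * n) - ereal (v \<bullet> x)" by simp
      also have "\<dots> \<le> ereal (L (x, w)) + \<pi> (z - xb) - ereal (v \<bullet> x)"
        using pi_sharp[of "z - xb"] by (intro ereal_minus_mono add_left_mono) (auto simp: n_def c_def)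
      also have "\<dots> = f (x, w) - ereal (v \<bullet> x)" using rf(2)[OF i1] by (simp add: z_def)
      finally show ?thesis using cC cn by blast
    qed
  qed
  have A: "\<bar>k (z, w) v - k (z', w) v\<bar> \<le> e * norm (z - z')"
    if "norm (z - xb) \<le> r" "norm (z' - xb) \<le> r" "norm (w - wb) \<le> r" "norm (v - vb) \<le> r" for z z' w v
  proof -
    have "\<bar>k (z, w) v - k (z', w) v\<bar> \<le> e' * norm (z - z')"
      using that r(1,3) by (intro ra(3) inr) auto
    also have "\<dots> \<le> e * norm (z - z')" using e'(2) by (intro mult_right_mono) auto
    finally show ?thesis .
  qed
  have B: "\<bar>k (z + u, w) v + k (z - u, w) v - 2 * k (z, w) v - H u\<bar> \<le> e * (norm u)\<^sup>2"
    if "norm (z + u - xb) \<le> r" "norm (z - u - xb) \<le> r" "norm (w - wb) \<le> r" "norm (v - vb) \<le> r" for z u w v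
  proof -
    have "\<bar>k (z + u, w) v + k (z - u, w) v - 2 * k (z, w) v - H u\<bar> \<le> e' * (norm u)\<^sup>2"
      using that r(1,3) by (intro ra(4) inr) auto
    also have "\<dots> \<le> e * (norm u)\<^sup>2" using e'(2) by (intro mult_right_mono) auto
    finally show ?thesis .
  qed
  have "2 * r \<le> r1" using r(3) ra(2) by simp
  then show thesis by (rule that[OF r(1) \<rho>(1) r(2) _ A B val red])
qed

lemma H_coercive:
  assumes "\<And>u. u \<in> S \<Longrightarrow> u \<noteq> 0 \<Longrightarrow> H u > 0"
  shows "\<exists>\<kappa>>0. \<forall>u\<in>S. \<kappa> * (norm u)\<^sup>2 \<le> H u"
proof -
  have cH: "continuous_on UNIV H"
    unfolding continuous_on_def
  proof
    fix a :: 'a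
    have "((\<lambda>u. M * norm (u - a) * (norm u + norm a)) \<longlongrightarrow> M * norm (a - a) * (norm a + norm a)) (at a)"
      by (intro tendsto_intros)
    then have "((\<lambda>u. M * norm (u - a) * (norm u + norm a)) \<longlongrightarrow> 0) (at a)" by simp
    then have "((\<lambda>u. H u - H a) \<longlongrightarrow> 0) (at a)"
      by (rule Lim_null_comparison[rotated]) (use H_lip in auto)
    then show "(H \<longlongrightarrow> H a) (at a within UNIV)" by (simp add: LIM_zero_iff)
  qed
  have H0: "H 0 = 0" using H_scale[of 0 0] by simp
  have comp: "compact (S \<inter> sphere 0 1)" by (intro closed_Int_compact closed_subspace S) auto
  show ?thesis
  proof (cases "S \<inter> sphere 0 1 = {}")
    case True
    have z: "u = 0" if "u \<in> S" for u
    proof (rule ccontr)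
      assume "u \<noteq> 0"
      then have "u /\<^sub>R norm u \<in> S \<inter> sphere 0 1" using subspace_scale[OF S that] by simp
      then show False using True by blast
    qed
    have "1 * (norm u)\<^sup>2 \<le> H u" if "u \<in> S" for u using H0 z[OF that] by simp
    then show ?thesis using zero_less_one by blast
  next
    case False
    from continuous_attains_inf[OF comp False continuous_on_subset[OF cH]]
    obtain a where a: "a \<in> S \<inter> sphere 0 1" "\<And>y. y \<in> S \<inter> sphere 0 1 \<Longrightarrow> H a \<le> H y" by auto
    have pos: "H a > 0" using a(1) by (intro assms) auto
    have "H a * (norm u)\<^sup>2 \<le> H u" if u: "u \<in> S" for u
    proof (cases "u = 0")
      case False
      have "H a \<le> H (u /\<^sub>R norm u)" using u False by (intro a(2)) (simp add: subspace_scale[OF S])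
      also have "\<dots> = H u / (norm u)\<^sup>2" by (simp add: H_scale divide_inverse power_inverse)
      finally show ?thesis using False by (simp add: field_simps)
    qed (simp add: H0)
    then show ?thesis using pos by blast
  qed
qed

lemma X_lip_pair:
  assumes "(z, w) \<in> cball (xb, wb) r1" "(z', w') \<in> cball (xb, wb) r1"
  shows "norm (X (z, w) - X (z', w')) \<le> 2 * (1 + M) * (norm (z - z') + norm (w - w'))"
proof -
  have "norm (X (z, w) - X (z', w')) \<le> 2 * (1 + M) * norm ((z, w) - (z', w'))" by (rule X_lip[OF assms])
  also have "\<dots> \<le> 2 * (1 + M) * (norm (z - z') + norm (w - w'))"
    using norm_Pair_le[of "z - z'" "w - w'"] M by (intro mult_left_mono) auto
  finally show ?thesis .
qed

text \<open>Here z is fixed. Comparing two parameters at a common z yields Lipschitz continuity of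
  the infimum.\<close>

lemma k_parameter_lip:
  "\<exists>C\<ge>0. \<forall>z w w' v v'. (z, w) \<in> cball (xb, wb) r1 \<longrightarrow> (z, w') \<in> cball (xb, wb) r1 \<longrightarrow> norm v' \<le> B \<longrightarrow>
     \<bar>k (z, w) v - k (z, w') v'\<bar> \<le> C * norm ((w, v) - (w', v'))"
proof (intro exI conjI allI impI)
  let ?C = "M * K1 + (norm xb + r0) + \<bar>B\<bar> * (2 * (1 + M))"
  show "?C \<ge> 0" using M K1 r0 by simp
  fix z :: 'a and w w' :: 'w and v v' :: 'a assume U: "(z, w) \<in> cball (xb, wb) r1" "(z, w') \<in> cball (xb, wb) r1" and B: "norm v' \<le> B"
  let ?d = "norm ((w, v) - (w', v'))"
  have nw: "norm (w - w') \<le> ?d" and nv: "norm (v - v') \<le> ?d"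
    using norm_fst_le[of "w - w'" "v - v'"] norm_snd_le[of "v - v'" "w - w'"] by auto
  have "\<bar>L (G (z, w)) - L (G (z, w'))\<bar> \<le> M * norm (G (z, w) - G (z, w'))"
    using lipschitz_onD[OF L_lip X_props(4)[OF U(1)] X_props(4)[OF U(2)]] by (simp add: dist_norm)
  also have "\<dots> \<le> M * (K1 * norm ((z, w) - (z, w')))" using G_lip[OF U] M by (intro mult_left_mono) auto
  also have "norm ((z, w) - (z, w')) = norm (w - w')" by simp
  also have "M * (K1 * norm (w - w')) \<le> M * (K1 * ?d)" using nw M K1 by (intro mult_left_mono) auto
  finally have a1: "\<bar>L (G (z, w)) - L (G (z, w'))\<bar> \<le> (M * K1) * ?d" by (simp only: mult.assoc)
  have "norm (X (z, w)) \<le> norm xb + r0"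
    using X_props(1)[OF U(1)] norm_triangle_sub[of "X (z, w)" xb] r0 by simp
  then have "norm (v - v') * norm (X (z, w)) \<le> ?d * (norm xb + r0)" using nv by (intro mult_mono) auto
  then have a2: "\<bar>(v - v') \<bullet> X (z, w)\<bar> \<le> (norm xb + r0) * ?d"
    using order_trans[OF Cauchy_Schwarz_ineq2[of "v - v'" "X (z, w)"]] by (simp only: mult_ac)
  have "norm (X (z, w) - X (z, w')) \<le> 2 * (1 + M) * norm (w - w')" using X_lip_pair[OF U] by simp
  also have "\<dots> \<le> 2 * (1 + M) * ?d" using nw M by (intro mult_left_mono) auto
  finally have "norm v' * norm (X (z, w) - X (z, w')) \<le> \<bar>B\<bar> * (2 * (1 + M) * ?d)" using B by (intro mult_mono) auto
  then have a3: "\<bar>v' \<bullet> (X (z, w) - X (z, w'))\<bar> \<le> \<bar>B\<bar> * (2 * (1 + M)) * ?d"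
    using order_trans[OF Cauchy_Schwarz_ineq2[of v' "X (z, w) - X (z, w')"]] by (simp only: mult.assoc)
  have tri: "\<bar>a - (b + c)\<bar> \<le> \<bar>a\<bar> + \<bar>b\<bar> + \<bar>c\<bar>" for a b c :: real by linarith
  have "\<bar>k (z, w) v - k (z, w') v'\<bar>
      = \<bar>(L (G (z, w)) - L (G (z, w'))) - ((v - v') \<bullet> X (z, w) + v' \<bullet> (X (z, w) - X (z, w')))\<bar>"
    by (simp add: k_def inner_diff_left inner_diff_right)
  also have "\<dots> \<le> (M * K1) * ?d + (norm xb + r0) * ?d + \<bar>B\<bar> * (2 * (1 + M)) * ?d"
    by (rule order_trans[OF tri add_mono[OF add_mono[OF a1 a2] a3]])
  also have "\<dots> = ?C * ?d" by (simp only: distrib_right)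
  finally show "\<bar>k (z, w) v - k (z, w') v'\<bar> \<le> ?C * ?d" .
qed

text \<open>Differences of points of \<open>C\<close> lie in \<open>S\<close>, so \<open>k\<close>
  is uniformly midpoint convex on bounded parts of \<open>xb + C\<close>; its minimizer is unique
  with quadratic growth. Adding the growth inequalities at two parameters and bounding the outcome
  by the mixed difference of \<open>k\<close> makes the minimizer Lipschitz.\<close>

lemma fully_stable_if_positive_definite:
  assumes pd: "\<And>u. u \<in> S \<Longrightarrow> u \<noteq> 0 \<Longrightarrow> H u > 0"
  shows "fully_stable_local_minimizer f xb wb vb"
proof -
  obtain \<kappa> where \<kappa>: "\<kappa> > 0" "\<And>u. u \<in> S \<Longrightarrow> \<kappa> * (norm u)\<^sup>2 \<le> H u" using H_coercive[OF pd] by blast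
  \<comment> \<open>Second differences then deviate from \<open>H\<close> by at most half of what
    coercivity provides.\<close>
  have "\<kappa>/2 > 0" using \<kappa>(1) by simp
  from reduction[OF this zero_less_one] obtain r \<rho> where r: "r > 0" "\<rho> > 0" "r \<le> 1" "2 * r \<le> r1"
    and A: "\<And>z z' w v. norm (z - xb) \<le> r \<Longrightarrow> norm (z' - xb) \<le> r \<Longrightarrow> norm (w - wb) \<le> r \<Longrightarrow> norm (v - vb) \<le> r \<Longrightarrow>
       \<bar>k (z, w) v - k (z', w) v\<bar> \<le> \<kappa>/2 * norm (z - z')"
    and B: "\<And>z u w v. norm (z + u - xb) \<le> r \<Longrightarrow> norm (z - u - xb) \<le> r \<Longrightarrow> norm (w - wb) \<le> r \<Longrightarrow> norm (v - vb) \<le> r \<Longrightarrow>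
       \<bar>k (z + u, w) v + k (z - u, w) v - 2 * k (z, w) v - H u\<bar> \<le> \<kappa>/2 * (norm u)\<^sup>2"
    and val: "\<And>c w v. c \<in> C \<Longrightarrow> norm c \<le> r \<Longrightarrow> norm (w - wb) \<le> r \<Longrightarrow>
       f (X (xb + c, w), w) - ereal (v \<bullet> X (xb + c, w)) = ereal (k (xb + c, w) v)"
    and red: "\<And>x w v. norm (x - xb) \<le> \<rho> \<Longrightarrow> norm (w - wb) \<le> \<rho> \<Longrightarrow> norm (v - vb) \<le> r \<Longrightarrow>
       \<exists>c\<in>C. norm c \<le> r \<and> (x = X (xb + c, w) \<or> ereal (k (xb + c, w) v) < f (x, w) - ereal (v \<bullet> x))"
    by blast
  define Cr where "Cr = C \<inter> cball 0 r"
  have Cr: "compact Cr" "convex Cr" "0 \<in> Cr" unfolding Cr_def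
    using C_closed C_convex C_zero r(1) by (auto intro: closed_Int_compact convex_Int)
  have Cr_norm: "norm (xb + c - xb) \<le> r" if "c \<in> Cr" for c using that by (simp add: Cr_def)
  have in1: "(xb + c, w) \<in> cball (xb, wb) r1" if "c \<in> Cr" "norm (w - wb) \<le> r" for c w
    using that r(4) by (intro Pair_in_cballI) (simp add: Cr_def)
  define near where "near w v \<longleftrightarrow> norm (w - wb) \<le> r \<and> norm (v - vb) \<le> r" for w v
  have "\<exists>c\<in>Cr. \<forall>y\<in>Cr. k (xb + c, w) v \<le> k (xb + y, w) v" if "near w v" for w v
  proof (rule continuous_attains_inf[OF Cr(1)])
    show "Cr \<noteq> {}" using Cr(3) by blast
    have "(\<kappa>/2)-lipschitz_on Cr (\<lambda>c. k (xb + c, w) v)"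
    proof (rule lipschitz_onI)
      fix c y assume cy: "c \<in> Cr" "y \<in> Cr"
      show "dist (k (xb + c, w) v) (k (xb + y, w) v) \<le> \<kappa>/2 * dist c y"
        using A[OF Cr_norm[OF cy(1)] Cr_norm[OF cy(2)], of w v] that by (simp add: near_def dist_norm)
    qed (use \<kappa> in simp)
    then show "continuous_on Cr (\<lambda>c. k (xb + c, w) v)" by (rule lipschitz_on_continuous_on)
  qed
  then obtain cs where cs: "\<And>w v. near w v \<Longrightarrow> cs w v \<in> Cr"
    "\<And>w v y. near w v \<Longrightarrow> y \<in> Cr \<Longrightarrow> k (xb + cs w v, w) v \<le> k (xb + y, w) v" by metis
  \<comment> \<open>With half-difference \<open>u\<close>, what remains is \<open>\<kappa>/2 * (norm
    u)\<^sup>2 = \<kappa>/8 * (norm (a - b))\<^sup>2\<close>.\<close>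
  have conv: "2 * k (xb + (1/2) *\<^sub>R (a + b), w) v + \<kappa>/8 * (norm (a - b))\<^sup>2 \<le> k (xb + a, w) v + k (xb + b, w) v"
    if ab: "a \<in> Cr" "b \<in> Cr" and n: "near w v" for a b w v
  proof -
    define m u where "m = (1/2) *\<^sub>R (a + b)" and "u = (1/2) *\<^sub>R (a - b)"
    have mu: "m + u = a" "m - u = b" by (simp_all add: m_def u_def half_sum_diff)
    have "a \<in> S" "b \<in> S" using ab C_S by (auto simp: Cr_def)
    then have "u \<in> S" unfolding u_def by (intro subspace_scale subspace_diff S)
    then have "\<kappa> * (norm u)\<^sup>2 \<le> H u" by (rule \<kappa>(2))
    moreover have "\<bar>k (xb + a, w) v + k (xb + b, w) v - 2 * k (xb + m, w) v - H u\<bar> \<le> \<kappa>/2 * (norm u)\<^sup>2"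
      using B[of "xb + m" u w v] Cr_norm[OF ab(1)] Cr_norm[OF ab(2)] n
      by (simp add: near_def mu add.assoc add_diff_eq[symmetric])
    moreover have "(norm u)\<^sup>2 = (norm (a - b))\<^sup>2 / 4" by (simp add: u_def power_divide)
    moreover from this have "\<kappa> * (norm u)\<^sup>2 = 2 * (\<kappa>/8 * (norm (a - b))\<^sup>2)" "\<kappa>/2 * (norm u)\<^sup>2 = \<kappa>/8 * (norm (a - b))\<^sup>2"
      by simp_all
    ultimately show ?thesis unfolding m_def by linarith
  qed
  have mid: "(1/2) *\<^sub>R (a + b) \<in> Cr" if "a \<in> Cr" "b \<in> Cr" for a b
    using convexD_alt[OF Cr(2) that, of "1/2"] by (simp add: scaleR_right_distrib)
  have growth: "k (xb + cs w v, w) v + \<kappa>/8 * (norm (y - cs w v))\<^sup>2 \<le> k (xb + y, w) v"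
    if "y \<in> Cr" and n: "near w v" for y w v
    using conv[OF that(1) cs(1)[OF n] n] cs(2)[OF n mid[OF that(1) cs(1)[OF n]]] by linarith
  have nb: "near wb vb" using r(1) by (simp add: near_def)
  \<comment> \<open>At the base parameter \<open>k\<close> has slope zero at \<open>xb\<close>, by
    \<open>k_local\<close> for every \<open>e\<close>. Midpoint convexity under repeated halving
    bounds the descent from 0 to \<open>a\<close> by 2^n times the descent from 0 to 2^(-n)
    \<open>a\<close>, hence by \<open>e * norm a\<close>. So there is no descent, and the growth
    inequality forces \<open>a = 0\<close>.\<close>
  have cs0: "cs wb vb = 0"
  proof -
    define a where "a = cs wb vb"
    define g where "g s = k (xb + s *\<^sub>R a, wb) vb" for s
    have aC: "a \<in> Cr" unfolding a_def by (rule cs(1)[OF nb])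
    have sa: "s *\<^sub>R a \<in> Cr" if "s \<in> {0..1}" for s
      using convexD_alt[OF Cr(2) Cr(3) aC, of s] that by simp
    have half: "g 0 - g 1 \<le> 2^n * (g 0 - g ((1/2)^n))" for n
    proof (induction n)
      case (Suc n)
      have i: "(1/2)^n *\<^sub>R a \<in> Cr" by (intro sa) (auto simp: power_le_one)
      have "(1/2) *\<^sub>R ((1/2)^n *\<^sub>R a + 0) = (1/2)^Suc n *\<^sub>R a" by simp
      then have "2 * g ((1/2)^Suc n) \<le> g ((1/2)^n) + g 0"
        using conv[OF i Cr(3) nb] \<kappa>(1) unfolding g_def
        by (smt (verit) add.right_neutral divide_nonneg_nonneg mult_nonneg_nonneg scaleR_zero_left zero_le_power2)
      then have "g 0 - g ((1/2)^n) \<le> 2 * (g 0 - g ((1/2)^Suc n))" by simp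
      then have "2^n * (g 0 - g ((1/2)^n)) \<le> 2^n * (2 * (g 0 - g ((1/2)^Suc n)))" by (intro mult_left_mono) auto
      with Suc.IH have "g 0 - g 1 \<le> 2^n * (2 * (g 0 - g ((1/2)^Suc n)))" by (rule order_trans)
      then show ?case by (simp only: power_Suc mult_ac)
    qed simp
    have small: "g 0 - g 1 \<le> e * norm a" if e: "e > 0" for e
    proof -
      obtain q where q: "q > 0" "q \<le> r1"
        "\<And>z z' w v. (z, w) \<in> cball (xb, wb) q \<Longrightarrow> (z', w) \<in> cball (xb, wb) q \<Longrightarrow> norm (v - vb) \<le> q \<Longrightarrow>
           \<bar>k (z, w) v - k (z', w) v\<bar> \<le> e * norm (z - z')"
        using k_local[OF e] by metis
      have "(\<lambda>n. (1/2)^n * norm a) \<longlonglongrightarrow> 0 * norm a"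
        by (intro tendsto_mult tendsto_const LIMSEQ_power_zero) auto
      then have "\<forall>\<^sub>F n in sequentially. (1/2)^n * norm a < q" using q(1) by (auto dest: order_tendstoD(2))
      then obtain n where n: "(1/2)^n * norm a < q" by (auto simp: eventually_sequentially)
      have "\<bar>k (xb, wb) vb - k (xb + (1/2)^n *\<^sub>R a, wb) vb\<bar> \<le> e * norm (xb - (xb + (1/2)^n *\<^sub>R a))"
        using n q(1) by (intro q(3) Pair_in_cballI) auto
      then have "g 0 - g ((1/2)^n) \<le> e * ((1/2)^n * norm a)" by (simp add: g_def)
      then have "2^n * (g 0 - g ((1/2)^n)) \<le> 2^n * (e * ((1/2)^n * norm a))" by (intro mult_left_mono) auto
      also have "\<dots> = e * norm a" by (simp add: power_divide)
      finally show ?thesis using half[of n] by simp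
    qed
    have "g 0 - g 1 \<le> 0"
    proof (rule field_le_epsilon)
      fix e :: real assume "e > 0"
      then have "e / (norm a + 1) > 0" by (simp add: add_nonneg_pos)
      from small[OF this] have "g 0 - g 1 \<le> e * (norm a / (norm a + 1))" by simp
      also have "\<dots> \<le> e * 1" using \<open>e > 0\<close> by (intro mult_left_mono) (auto simp: divide_le_eq_1 add_nonneg_pos)
      finally show "g 0 - g 1 \<le> 0 + e" by simp
    qed
    moreover have "g 1 + \<kappa>/8 * (norm a)\<^sup>2 \<le> g 0" using growth[OF Cr(3) nb] by (simp add: g_def a_def)
    ultimately have "\<kappa>/8 * (norm a)\<^sup>2 \<le> 0" by linarith
    then show ?thesis using \<kappa>(1) by (simp add: a_def mult_le_0_iff)
  qed
  have vB: "norm v \<le> norm vb + r" if "near w v" for w v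
    using that norm_triangle_sub[of v vb] by (simp add: near_def)
  obtain Kd where Kd: "Kd \<ge> 0" "\<And>z z' w w' v v'. (z, w) \<in> cball (xb, wb) r1 \<Longrightarrow> (z', w) \<in> cball (xb, wb) r1 \<Longrightarrow>
     (z, w') \<in> cball (xb, wb) r1 \<Longrightarrow> (z', w') \<in> cball (xb, wb) r1 \<Longrightarrow> norm v' \<le> norm vb + r \<Longrightarrow>
     \<bar>k (z, w) v - k (z', w) v - k (z, w') v' + k (z', w') v'\<bar> \<le> Kd * norm (z - z') * norm ((w, v) - (w', v'))"
    using k_double_difference[of "norm vb + r"] by metis
  obtain Kp where Kp: "Kp \<ge> 0" "\<And>z w w' v v'. (z, w) \<in> cball (xb, wb) r1 \<Longrightarrow> (z, w') \<in> cball (xb, wb) r1 \<Longrightarrow>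
     norm v' \<le> norm vb + r \<Longrightarrow> \<bar>k (z, w) v - k (z, w') v'\<bar> \<le> Kp * norm ((w, v) - (w', v'))"
    using k_parameter_lip[of "norm vb + r"] by metis
  define Lc where "Lc = 4 * Kd / \<kappa>"
  have Lc: "Lc \<ge> 0" using Kd(1) \<kappa>(1) by (simp add: Lc_def)
  have cs_lip: "norm (cs w v - cs w' v') \<le> Lc * norm ((w, v) - (w', v'))" if n: "near w v" "near w' v'" for w v w' v'
  proof -
    define d where "d = norm (cs w v - cs w' v')"
    let ?c = "cs w v" and ?c' = "cs w' v'"
    note c = cs(1)[OF n(1)] and c' = cs(1)[OF n(2)]
    have w: "norm (w - wb) \<le> r" "norm (w' - wb) \<le> r" using n by (auto simp: near_def)
    have g1: "k (xb + ?c, w) v + \<kappa>/8 * d\<^sup>2 \<le> k (xb + ?c', w) v"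
      using growth[OF c' n(1)] by (simp add: d_def norm_minus_commute)
    have g2: "k (xb + ?c', w') v' + \<kappa>/8 * d\<^sup>2 \<le> k (xb + ?c, w') v'"
      using growth[OF c n(2)] by (simp add: d_def)
    \<comment> \<open>The sum of \<open>g1\<close> and \<open>g2\<close> is a statement on exactly
      this mixed difference: it is at most \<open>- \<kappa>/4 * d\<^sup>2\<close>. One factor
      \<open>d\<close> then cancels.\<close>
    have "\<bar>k (xb + ?c, w) v - k (xb + ?c', w) v - k (xb + ?c, w') v' + k (xb + ?c', w') v'\<bar>
        \<le> Kd * norm ((xb + ?c) - (xb + ?c')) * norm ((w, v) - (w', v'))"
      using c c' w n by (intro Kd(2) in1 vB) auto
    then have "\<kappa>/4 * d\<^sup>2 \<le> Kd * d * norm ((w, v) - (w', v'))"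
      using g1 g2 by (simp add: d_def)
    then have "d * (\<kappa>/4 * d) \<le> d * (Kd * norm ((w, v) - (w', v')))" by (simp add: power2_eq_square mult_ac)
    moreover have "0 \<le> Kd * norm ((w, v) - (w', v'))" using Kd(1) by simp
    ultimately have "\<kappa>/4 * d \<le> Kd * norm ((w, v) - (w', v'))"
      by (cases "d = 0") (auto simp: d_def dest: mult_left_le_imp_le)
    then show ?thesis using \<kappa>(1) unfolding Lc_def d_def[symmetric] by (simp add: field_simps)
  qed
  define sol where "sol = (\<lambda>(w, v). X (xb + cs w v, w))"
  define K2 where "K2 = 2 * (1 + M) * (Lc + 1)"
  have K2: "K2 > 0" unfolding K2_def using M Lc by (intro mult_pos_pos) auto
  have sol_lip: "norm (sol (w, v) - sol (w', v')) \<le> K2 * norm ((w, v) - (w', v'))" if n: "near w v" "near w' v'" for w v w' v'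
  proof -
    have "norm (X (xb + cs w v, w) - X (xb + cs w' v', w')) \<le> 2 * (1 + M) * (norm ((xb + cs w v) - (xb + cs w' v')) + norm (w - w'))"
      using n cs(1)[OF n(1)] cs(1)[OF n(2)] by (intro X_lip_pair in1) (auto simp: near_def)
    also have "\<dots> \<le> 2 * (1 + M) * (Lc * norm ((w, v) - (w', v')) + norm ((w, v) - (w', v')))"
      using cs_lip[OF n] norm_fst_le[of "w - w'" "v - v'"] M by (intro mult_left_mono add_mono) auto
    finally show ?thesis by (simp add: sol_def K2_def algebra_simps)
  qed
  \<comment> \<open>\<open>sol\<close> takes the value \<open>xb\<close> at the base and has
    Lipschitz constant \<open>K2\<close>. Parameters with both components within
    \<open>\<eta>\<close> lie within \<open>2 * \<eta>\<close> of it, so the solution stays in the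
    ball of radius \<open>\<rho>\<close> over which the infimum is taken.\<close>
  define \<eta> where "\<eta> = min (min r \<rho>) (\<rho> / (2 * K2))"
  have \<eta>: "\<eta> > 0" "\<eta> \<le> r" "\<eta> \<le> \<rho>" "K2 * (2 * \<eta>) \<le> \<rho>"
  proof -
    have "\<eta> \<le> \<rho> / (2 * K2)" by (simp add: \<eta>_def)
    then show "K2 * (2 * \<eta>) \<le> \<rho>" using K2 by (simp add: field_simps)
  qed (use r K2 in \<open>auto simp: \<eta>_def\<close>)
  have nearI: "near w v" if "w \<in> ball wb \<eta>" "v \<in> ball vb \<eta>" for w v
    using that \<eta>(2) by (auto simp: near_def dist_norm norm_minus_commute)
  define gm where "gm = (\<lambda>(w, v). k (xb + cs w v, w) v)"
  have sol_b: "sol (wb, vb) = xb" by (simp add: sol_def cs0 G_base)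
  have main: "m_loc f xb \<rho> w v = ereal (gm (w, v)) \<and> M_loc f xb \<rho> w v = {sol (w, v)}"
    if wv: "w \<in> ball wb \<eta>" "v \<in> ball vb \<eta>" for w v
  proof -
    note n = nearI[OF wv]
    have w\<rho>: "norm (w - wb) \<le> \<rho>" and wr: "norm (w - wb) \<le> r" and vr: "norm (v - vb) \<le> r"
      using wv \<eta> by (auto simp: dist_norm norm_minus_commute)
    have c: "cs w v \<in> C" "norm (cs w v) \<le> r" using cs(1)[OF n] by (auto simp: Cr_def)
    have "norm (sol (w, v) - sol (wb, vb)) \<le> K2 * norm ((w, v) - (wb, vb))" by (rule sol_lip[OF n nb])
    also have "\<dots> \<le> K2 * (2 * \<eta>)"
      using norm_Pair_le[of "w - wb" "v - vb"] wv K2 by (intro mult_left_mono) (auto simp: dist_norm norm_minus_commute)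
    finally have s_in: "sol (w, v) \<in> cball xb \<rho>" using \<eta>(4) by (simp add: sol_b dist_norm norm_minus_commute)
    have s_val: "f (sol (w, v), w) - ereal (v \<bullet> sol (w, v)) = ereal (gm (w, v))"
      using val[OF c wr] by (simp add: sol_def gm_def)
    \<comment> \<open>Every competitor in the x-ball is matched by some \<open>c\<close> in
      \<open>Cr\<close> that is at least as good. Equality excludes the strict alternative, and then
      growth gives \<open>c = cs w v\<close>.\<close>
    have le: "ereal (gm (w, v)) \<le> f (x, w) - ereal (v \<bullet> x) \<and>
        (f (x, w) - ereal (v \<bullet> x) = ereal (gm (w, v)) \<longrightarrow> x = sol (w, v))" if x: "x \<in> cball xb \<rho>" for x
    proof -
      obtain c where c: "c \<in> C" "norm c \<le> r" "x = X (xb + c, w) \<or> ereal (k (xb + c, w) v) < f (x, w) - ereal (v \<bullet> x)"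
        using red[OF _ w\<rho> vr, of x] x by (auto simp: dist_norm norm_minus_commute)
      have cCr: "c \<in> Cr" using c by (simp add: Cr_def)
      note g = growth[OF cCr n]
      have g': "gm (w, v) \<le> k (xb + c, w) v" using cs(2)[OF n cCr] by (simp add: gm_def)
      from c(3) show ?thesis
      proof
        assume xc: "x = X (xb + c, w)"
        have v: "f (x, w) - ereal (v \<bullet> x) = ereal (k (xb + c, w) v)" using val[OF c(1,2) wr] by (simp add: xc)
        have "x = sol (w, v)" if "k (xb + c, w) v = gm (w, v)"
        proof -
          have "\<kappa>/8 * (norm (c - cs w v))\<^sup>2 \<le> 0" using g that by (simp add: gm_def)
          then have "c = cs w v" using \<kappa>(1) by (simp add: mult_le_0_iff)
          then show ?thesis by (simp add: xc sol_def)
        qed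
        then show ?thesis using g' v by simp
      next
        assume "ereal (k (xb + c, w) v) < f (x, w) - ereal (v \<bullet> x)"
        moreover have "ereal (gm (w, v)) \<le> ereal (k (xb + c, w) v)" using g' by simp
        ultimately show ?thesis by (metis less_imp_le not_le order_le_less_trans)
      qed
    qed
    have m: "m_loc f xb \<rho> w v = ereal (gm (w, v))" unfolding m_loc_def
    proof (rule antisym)
      show "(INF x\<in>cball xb \<rho>. f (x, w) - ereal (v \<bullet> x)) \<le> ereal (gm (w, v))"
        by (rule INF_lower2[OF s_in]) (simp add: s_val)
      show "ereal (gm (w, v)) \<le> (INF x\<in>cball xb \<rho>. f (x, w) - ereal (v \<bullet> x))"
        by (rule INF_greatest) (use le in blast)
    qed
    moreover have "M_loc f xb \<rho> w v = {sol (w, v)}"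
      unfolding M_loc_def m
    proof (intro equalityI subsetI)
      fix x assume "x \<in> {x \<in> cball xb \<rho>. f (x, w) - ereal (v \<bullet> x) = ereal (gm (w, v)) \<and> ereal (gm (w, v)) \<noteq> \<infinity>}"
      then show "x \<in> {sol (w, v)}" using le by blast
    next
      fix x assume "x \<in> {sol (w, v)}"
      then have "x = sol (w, v)" by blast
      then show "x \<in> {x \<in> cball xb \<rho>. f (x, w) - ereal (v \<bullet> x) = ereal (gm (w, v)) \<and> ereal (gm (w, v)) \<noteq> \<infinity>}"
        using s_in s_val by (simp only: mem_Collect_eq) simp
    qed
    ultimately show ?thesis by blast
  qed
  show ?thesis unfolding fully_stable_local_minimizer_def
  proof (intro exI[of _ \<rho>] conjI exI[of _ "ball wb \<eta>"] exI[of _ "ball vb \<eta>"])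
    show "\<exists>s L. (\<forall>w\<in>ball wb \<eta>. \<forall>v\<in>ball vb \<eta>. M_loc f xb \<rho> w v = {s (w, v)}) \<and> L-lipschitz_on (ball wb \<eta> \<times> ball vb \<eta>) s"
    proof (intro exI conjI)
      show "\<forall>w\<in>ball wb \<eta>. \<forall>v\<in>ball vb \<eta>. M_loc f xb \<rho> w v = {sol (w, v)}" using main by blast
      show "K2-lipschitz_on (ball wb \<eta> \<times> ball vb \<eta>) sol"
      proof (rule lipschitz_onI)
        fix p q assume "p \<in> ball wb \<eta> \<times> ball vb \<eta>" "q \<in> ball wb \<eta> \<times> ball vb \<eta>"
        then show "dist (sol p) (sol q) \<le> K2 * dist p q"
          using sol_lip[OF nearI nearI, of "fst p" "snd p" "fst q" "snd q"] by (auto simp: dist_norm mem_Times_iff)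
      qed (use K2 in simp)
    qed
    show "M_loc f xb \<rho> wb vb = {xb}" using main[of wb vb] \<eta>(1) by (simp add: sol_b)
    show "\<exists>g L. (\<forall>w\<in>ball wb \<eta>. \<forall>v\<in>ball vb \<eta>. m_loc f xb \<rho> w v = ereal (g (w, v))) \<and> L-lipschitz_on (ball wb \<eta> \<times> ball vb \<eta>) g"
    proof (intro exI conjI)
      show "\<forall>w\<in>ball wb \<eta>. \<forall>v\<in>ball vb \<eta>. m_loc f xb \<rho> w v = ereal (gm (w, v))" using main by blast
      have gm_le: "gm (w, v) - gm (w', v') \<le> Kp * norm ((w, v) - (w', v'))" if n: "near w v" "near w' v'" for w v w' v'
      proof -
        have "gm (w, v) \<le> k (xb + cs w' v', w) v" using cs(2)[OF n(1) cs(1)[OF n(2)]] by (simp add: gm_def)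
        moreover have "\<bar>k (xb + cs w' v', w) v - k (xb + cs w' v', w') v'\<bar> \<le> Kp * norm ((w, v) - (w', v'))"
          using n cs(1)[OF n(2)] by (intro Kp(2) in1 vB) (auto simp: near_def)
        ultimately show ?thesis unfolding gm_def prod.case by linarith
      qed
      show "Kp-lipschitz_on (ball wb \<eta> \<times> ball vb \<eta>) gm"
      proof (rule lipschitz_onI)
        fix p q assume pq: "p \<in> ball wb \<eta> \<times> ball vb \<eta>" "q \<in> ball wb \<eta> \<times> ball vb \<eta>"
        then have "near (fst p) (snd p)" "near (fst q) (snd q)" using nearI by (auto simp: mem_Times_iff)
        from gm_le[OF this] gm_le[OF this(2,1)] show "dist (gm p) (gm q) \<le> Kp * dist p q"
          by (simp add: dist_norm norm_minus_commute abs_le_iff)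
      qed (use Kp in simp)
    qed
  qed (use \<eta>(1) r(2) in auto)
qed

text \<open>The point \<open>x\<^sub>t = X (xb + t u0)\<close> is a minimizer for some tilt \<open>v\<close> near \<open>vb\<close>: minimizing the convex
  function \<open>v \<mapsto> - m v - v \<bullet> x\<^sub>t\<close> over a small ball of \<open>vb + S\<close> gives an interior minimum, where the
  projection of \<open>x v - x\<^sub>t\<close> to \<open>S\<close> vanishes. Lipschitz continuity of the argmin then yields quadratic
  growth at \<open>x\<^sub>t\<close>, from which both \<open>d\<close> and \<open>- d\<close> are feasible directions.\<close>

lemma positive_definite_if_fully_stable:
  assumes fs: "fully_stable_local_minimizer f xb wb vb"
    and u0: "u0 \<in> C" and \<epsilon>: "\<epsilon> > 0" and u0_int: "\<And>d. d \<in> S \<Longrightarrow> norm d \<le> \<epsilon> \<Longrightarrow> u0 + d \<in> C"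
    and d: "d \<in> S" "d \<noteq> 0"
  shows "H d > 0"
proof -
  from fs obtain P W V s Ls g Lg where P: "P > 0" and W: "wb \<in> W" and V: "open V" "vb \<in> V"
    and Mb: "M_loc f xb P wb vb = {xb}"
    and s': "\<forall>w\<in>W. \<forall>v\<in>V. M_loc f xb P w v = {s (w, v)}" and sL: "Ls-lipschitz_on (W \<times> V) s"
    and g': "\<forall>w\<in>W. \<forall>v\<in>V. m_loc f xb P w v = ereal (g (w, v))" and gL: "Lg-lipschitz_on (W \<times> V) g"
    unfolding fully_stable_local_minimizer_def by (elim exE conjE) (rule that; assumption)
  have s: "M_loc f xb P wb v = {s (wb, v)}" and g: "m_loc f xb P wb v = ereal (g (wb, v))" if "v \<in> V" for v
    using s' g' W that by auto
  define x where "x v = s (wb, v)" for v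
  define m where "m v = g (wb, v)" for v
  define \<Lambda> where "\<Lambda> = max Ls 1"
  have \<Lambda>: "\<Lambda> > 0" by (simp add: \<Lambda>_def)
  have x_lip: "norm (x v - x v') \<le> \<Lambda> * norm (v - v')" if "v \<in> V" "v' \<in> V" for v v'
  proof -
    have "norm (x v - x v') \<le> Ls * norm (v - v')"
      using lipschitz_onD[OF sL, of "(wb, v)" "(wb, v')"] that W by (simp add: dist_norm x_def)
    also have "\<dots> \<le> \<Lambda> * norm (v - v')" by (intro mult_right_mono) (auto simp: \<Lambda>_def)
    finally show ?thesis .
  qed
  have m_le: "ereal (m v) \<le> f (y, wb) - ereal (v \<bullet> y)" if "v \<in> V" "y \<in> cball xb P" for v y
    using INF_lower[OF that(2), of "\<lambda>y. f (y, wb) - ereal (v \<bullet> y)"] g[OF that(1)] by (simp add: m_loc_def m_def)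
  have x_in: "x v \<in> cball xb P" and x_val: "f (x v, wb) - ereal (v \<bullet> x v) = ereal (m v)" if "v \<in> V" for v
  proof -
    have "x v \<in> M_loc f xb P wb v" using s[OF that] by (simp add: x_def)
    then show "x v \<in> cball xb P" "f (x v, wb) - ereal (v \<bullet> x v) = ereal (m v)"
      using g[OF that] by (auto simp: M_loc_def m_def)
  qed
  have x_val': "f (x v, wb) = ereal (m v + v \<bullet> x v)" if "v \<in> V" for v
    using x_val[OF that] by (cases "f (x v, wb)") auto
  have m_diff: "m v \<le> m v' + (v' - v) \<bullet> x v'" if "v \<in> V" "v' \<in> V" for v v'
    using m_le[OF that(1) x_in[OF that(2)]] by (simp add: x_val'[OF that(2)] inner_diff_left)
  have xb: "x vb = xb" using s[OF V(2)] Mb by (simp add: x_def)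
  \<comment> \<open>Compare with the minimizer for the tilt
    \<open>v' = v + \<sigma> (y - x v)\<close>. For \<open>\<sigma> = 1 / (2 * \<Lambda>)\<close> it
    moves by at most half of \<open>norm (y - x v)\<close>, so
    \<open>(y - x v) \<bullet> (y - x v')\<close> is at least half of the square; times
    \<open>\<sigma>\<close> this is the growth term.\<close>
  have growth: "ereal (m v + (norm (y - x v))\<^sup>2 / (4 * \<Lambda>)) \<le> f (y, wb) - ereal (v \<bullet> y)"
    if v: "v \<in> V" and y: "y \<in> cball xb P" and v': "v + (1 / (2 * \<Lambda>)) *\<^sub>R (y - x v) \<in> V" for v y
  proof -
    let ?h = "y - x v"
    define \<sigma> where "\<sigma> = 1 / (2 * \<Lambda>)"
    define v' where "v' = v + \<sigma> *\<^sub>R ?h"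
    have vV: "v' \<in> V" using v' by (simp add: v'_def \<sigma>_def)
    have \<sigma>: "\<sigma> > 0" "\<Lambda> * \<sigma> = 1/2" using \<Lambda> by (auto simp: \<sigma>_def)
    have "norm (x v' - x v) \<le> \<Lambda> * norm (v' - v)" by (rule x_lip[OF vV v])
    also have "\<dots> = (\<Lambda> * \<sigma>) * norm ?h" using \<sigma>(1) by (simp add: v'_def)
    finally have xd: "norm (x v' - x v) \<le> norm ?h / 2" unfolding \<sigma>(2) by simp
    have "\<bar>?h \<bullet> (x v' - x v)\<bar> \<le> norm ?h * (norm ?h / 2)"
      by (rule order_trans[OF Cauchy_Schwarz_ineq2 mult_left_mono[OF xd norm_ge_zero]])
    then have "?h \<bullet> (x v' - x v) \<le> (norm ?h)\<^sup>2 / 2" by (simp add: power2_eq_square)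
    moreover have "?h \<bullet> ?h = (norm ?h)\<^sup>2" by (simp add: power2_norm_eq_inner)
    ultimately have "(norm ?h)\<^sup>2 / 2 \<le> ?h \<bullet> (y - x v')" by (simp add: inner_diff_right)
    then have "\<sigma> * ((norm ?h)\<^sup>2 / 2) \<le> \<sigma> * (?h \<bullet> (y - x v'))" using \<sigma>(1) by (intro mult_left_mono) auto
    then have "(norm ?h)\<^sup>2 / (4 * \<Lambda>) \<le> \<sigma> * (?h \<bullet> y) - \<sigma> * (?h \<bullet> x v')"
      by (simp add: \<sigma>_def inner_diff_right diff_divide_distrib)
    moreover have "(v' - v) \<bullet> x v' = \<sigma> * (?h \<bullet> x v')" "v' \<bullet> y = v \<bullet> y + \<sigma> * (?h \<bullet> y)"
      by (simp_all add: v'_def inner_add_left)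
    ultimately have "m v + (norm ?h)\<^sup>2 / (4 * \<Lambda>) \<le> m v' + v' \<bullet> y - v \<bullet> y" using m_diff[OF v vV] by linarith
    then show ?thesis using m_le[OF vV y] by (cases "f (y, wb)") auto
  qed
  \<comment> \<open>Growth with coefficient 1/(4 \<Lambda>) in x becomes 1/(9 \<Lambda>) in the
    chart, where lengths are at most 3/2 times longer. Growth on both sides yields twice this
    coefficient, so a second-difference error of the same size still leaves a positive
    amount.\<close>
  have "1 / (9 * \<Lambda>) > 0" "min (P/2) 1 > 0" using \<Lambda> P by auto
  from reduction[OF this] obtain r \<rho> where r: "r > 0" "\<rho> > 0" "r \<le> min (P/2) 1" "2 * r \<le> r1"
    and A: "\<And>z z' w v. norm (z - xb) \<le> r \<Longrightarrow> norm (z' - xb) \<le> r \<Longrightarrow> norm (w - wb) \<le> r \<Longrightarrow> norm (v - vb) \<le> r \<Longrightarrow>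
       \<bar>k (z, w) v - k (z', w) v\<bar> \<le> 1 / (9 * \<Lambda>) * norm (z - z')"
    and B: "\<And>z u w v. norm (z + u - xb) \<le> r \<Longrightarrow> norm (z - u - xb) \<le> r \<Longrightarrow> norm (w - wb) \<le> r \<Longrightarrow> norm (v - vb) \<le> r \<Longrightarrow>
       \<bar>k (z + u, w) v + k (z - u, w) v - 2 * k (z, w) v - H u\<bar> \<le> 1 / (9 * \<Lambda>) * (norm u)\<^sup>2"
    and val: "\<And>c w v. c \<in> C \<Longrightarrow> norm c \<le> r \<Longrightarrow> norm (w - wb) \<le> r \<Longrightarrow>
       f (X (xb + c, w), w) - ereal (v \<bullet> X (xb + c, w)) = ereal (k (xb + c, w) v)"
    and red: "\<And>x w v. norm (x - xb) \<le> \<rho> \<Longrightarrow> norm (w - wb) \<le> \<rho> \<Longrightarrow> norm (v - vb) \<le> r \<Longrightarrow>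
       \<exists>c\<in>C. norm c \<le> r \<and> (x = X (xb + c, w) \<or> ereal (k (xb + c, w) v) < f (x, w) - ereal (v \<bullet> x))"
    by blast
  obtain \<delta> where \<delta>: "\<delta> > 0" "ball vb \<delta> \<subseteq> V" using V by (meson open_contains_ball)
  have wb0: "norm (wb - wb) \<le> r" "norm (wb - wb) \<le> \<rho>" using r by auto
  have in1: "(xb + c, wb) \<in> cball (xb, wb) r1" if "norm c \<le> r" for c
    using that r(1,4) by (intro Pair_in_cballI) simp
  have X_near: "norm (X (xb + c, wb) - xb) \<le> 2 * norm c" if "norm c \<le> r" for c
    using X_lip_fst(1)[OF in1[OF that], of xb] in1[of 0] r(1) by (simp add: G_base)
  have XP: "X (xb + c, wb) \<in> cball xb P" if "norm c \<le> r" for c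
    using X_near[OF that] that r(3) by (simp add: dist_norm norm_minus_commute)
  \<comment> \<open>At fixed w the inverse chart is strongly monotone, since
    \<open>X_lip_fst\<close> keeps its increments close to those of the identity. Orthogonality to
    \<open>S\<close> can thus identify points.\<close>
  have X_mono: "b \<bullet> (X (xb + a + b, wb) - X (xb + a, wb)) \<ge> (norm b)\<^sup>2 / 2" if "norm a \<le> r" "norm (a + b) \<le> r" for a b
  proof -
    let ?a = "X (xb + a + b, wb) - X (xb + a, wb)"
    have "norm (?a - b) \<le> norm ?a / 2"
      using X_lip_fst(2)[OF in1[OF that(2)] in1[OF that(1)]] by (simp add: add.assoc)
    then have "(norm (?a - b))\<^sup>2 \<le> (norm ?a / 2)\<^sup>2" by (intro power_mono) auto
    moreover have "(norm (?a - b))\<^sup>2 = (norm ?a)\<^sup>2 - 2 * (b \<bullet> ?a) + (norm b)\<^sup>2"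
      by (simp add: power2_norm_eq_inner algebra_simps inner_commute)
    moreover have "(norm ?a / 2)\<^sup>2 = (norm ?a)\<^sup>2 / 4" by (simp add: power_divide)
    ultimately show ?thesis using zero_le_power2[of "norm ?a"] by linarith
  qed
  have m_upper: "m v \<le> k (xb + c, wb) v" if "v \<in> V" "c \<in> C" "norm c \<le> r" for v c
    using m_le[OF that(1) XP[OF that(3)]] val[OF that(2,3) wb0(1)] by simp
  have m_base: "m vb = L (xb, wb) - vb \<bullet> xb"
    using val[OF C_zero _ wb0(1), of vb] x_val[OF V(2)] r(1) by (simp add: xb G_base k_def)
  define U where "U = norm u0 + \<epsilon>"
  \<comment> \<open>If the minimizing tilt had norm \<open>t * R\<close>, a test point would give
    \<open>R * \<epsilon> * t\<^sup>2 / 2 \<le> 4 * M * (t * U)\<^sup>2\<close>; \<open>R\<close> is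
    chosen to violate this for every \<open>t\<close>.\<close>
  define R where "R = 8 * M * U\<^sup>2 / \<epsilon> + 1"
  have U: "U > 0" "norm u0 \<le> U" using \<epsilon> by (auto simp: U_def add_nonneg_pos)
  have R: "R > 0" "R * \<epsilon> > 8 * M * U\<^sup>2"
  proof -
    have "8 * M * U\<^sup>2 / \<epsilon> \<ge> 0" using M \<epsilon> by (intro divide_nonneg_nonneg) auto
    then show "R > 0" by (simp add: R_def)
    show "R * \<epsilon> > 8 * M * U\<^sup>2" using \<epsilon> by (simp add: R_def distrib_right)
  qed
  define b where "b = min r (min \<rho> \<delta>)"
  \<comment> \<open>The four summands are the rates at which the lengths below shrink with
    \<open>t\<close>: points of \<open>C\<close>, tilts, minimizers, and the extra tilts in the
    growth inequality. Their total is \<open>b / 2\<close>.\<close>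
  define Q where "Q = U + R + \<Lambda> * R + \<epsilon> / \<Lambda>"
  define t where "t = b / (2 * Q)"
  have b: "b > 0" "b \<le> r" "b \<le> \<rho>" "b \<le> \<delta>" using r \<delta> by (auto simp: b_def)
  have pos: "\<Lambda> * R > 0" "\<epsilon> / \<Lambda> > 0" using \<Lambda> R \<epsilon> by auto
  then have den: "Q > 0" using U R unfolding Q_def by linarith
  have t: "t > 0" using b den by (simp add: t_def)
  have "t * Q = b / 2" using den by (simp add: t_def)
  then have tsum: "t * U + t * R + t * (\<Lambda> * R) + t * (\<epsilon> / \<Lambda>) = b / 2" by (simp only: Q_def distrib_left)
  have tpos: "t * U > 0" "t * R > 0" "t * (\<Lambda> * R) > 0" "t * (\<epsilon> / \<Lambda>) > 0" 
    by (rule mult_pos_pos[OF t U(1)] mult_pos_pos[OF t R(1)] mult_pos_pos[OF t pos(1)] mult_pos_pos[OF t pos(2)])+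
  have tL: "\<Lambda> * (t * R) = t * (\<Lambda> * R)" by simp
  have tle: "t * U \<le> r" "t * R \<le> r" "\<Lambda> * (t * R) \<le> \<rho>" "t * R + t * (\<epsilon> / \<Lambda>) < \<delta>" "t * R < \<delta>"
    using tsum tpos b tL by linarith+
  have tC: "t *\<^sub>R u0 + e \<in> C" "norm (t *\<^sub>R u0 + e) \<le> r" if "e \<in> S" "norm e \<le> t * \<epsilon>" for e
  proof -
    have "norm (e /\<^sub>R t) \<le> \<epsilon>" using that(2) t by (simp add: field_simps)
    then have "u0 + e /\<^sub>R t \<in> C" using that(1) by (intro u0_int subspace_scale S)
    then have "t *\<^sub>R (u0 + e /\<^sub>R t) \<in> C" using t by (intro C_scale) auto
    then show "t *\<^sub>R u0 + e \<in> C" using t by (simp add: scaleR_right_distrib)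
    have "norm (t *\<^sub>R u0 + e) \<le> t * norm u0 + t * \<epsilon>" using norm_triangle_ineq[of "t *\<^sub>R u0" e] that(2) t by simp
    then show "norm (t *\<^sub>R u0 + e) \<le> r" using tle(1) by (simp add: U_def distrib_left)
  qed
  have tC0: "t *\<^sub>R u0 \<in> C" "norm (t *\<^sub>R u0) \<le> r" using tC[of 0] subspace_0[OF S] t \<epsilon> by auto
  define xt where "xt = X (xb + t *\<^sub>R u0, wb)"
  define T where "T = S \<inter> cball 0 (t * R)"
  have TV: "vb + e \<in> V" if "e \<in> T" for e
  proof -
    have "norm e < \<delta>" using that tle(5) by (simp add: T_def)
    then have "vb + e \<in> ball vb \<delta>" by (simp add: dist_norm)
    then show ?thesis using \<delta>(2) by blast
  qed
  define \<Psi> where "\<Psi> e = - m (vb + e) - (vb + e) \<bullet> xt" for e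
  have compT: "compact T" unfolding T_def by (intro closed_Int_compact closed_subspace S compact_cball)
  have T0: "0 \<in> T" using tpos subspace_0[OF S] by (simp add: T_def)
  have "continuous_on T (\<lambda>e. m (vb + e))"
  proof (rule lipschitz_on_continuous_on)
    show "Lg-lipschitz_on T (\<lambda>e. m (vb + e))"
    proof (rule lipschitz_onI)
      fix a e assume "a \<in> T" "e \<in> T"
      then show "dist (m (vb + a)) (m (vb + e)) \<le> Lg * dist a e"
        using lipschitz_onD[OF gL, of "(wb, vb + a)" "(wb, vb + e)"] TV W by (simp add: dist_norm m_def)
    qed (rule lipschitz_on_nonneg[OF gL])
  qed
  then have "continuous_on T \<Psi>" unfolding \<Psi>_def by (intro continuous_intros)
  from continuous_attains_inf[OF compT _ this] T0 obtain d0 where d0: "d0 \<in> T" "\<And>e. e \<in> T \<Longrightarrow> \<Psi> d0 \<le> \<Psi> e" by blast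
  define v where "v = vb + d0"
  have vV: "v \<in> V" unfolding v_def by (rule TV[OF d0(1)])
  have nd0: "d0 \<in> S" "norm d0 \<le> t * R" using d0(1) by (auto simp: T_def)
  have interior: "norm d0 < t * R"
  proof (rule ccontr)
    assume "\<not> norm d0 < t * R"
    then have nd: "norm d0 = t * R" using nd0 by simp
    \<comment> \<open>\<open>d0\<close> rescaled to norm \<open>t * \<epsilon>\<close>, the largest
      step that \<open>tC\<close> allows. Monotonicity bounds \<open>d0 \<bullet> (y - xt)\<close>
      below. Comparing \<open>\<Psi> d0\<close> with \<open>\<Psi> 0\<close> bounds it above by the
      first-order Taylor remainder of \<open>L\<close>, whose linear part cancels against
      \<open>vb\<close>.\<close>
    define e1 where "e1 = (\<epsilon> / R) *\<^sub>R d0"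
    have e1: "e1 \<in> S" "norm e1 = t * \<epsilon>" using nd0 nd R(1) \<epsilon> by (auto simp: e1_def subspace_scale[OF S])
    note c1 = tC[OF e1(1) eq_refl[OF e1(2)]]
    define y where "y = X (xb + (t *\<^sub>R u0 + e1), wb)"
    have "m v \<le> k (xb + (t *\<^sub>R u0 + e1), wb) v" by (rule m_upper[OF vV c1])
    then have mv: "m v \<le> L (y, wb) - v \<bullet> y" by (simp add: k_def G_def y_def)
    have "\<Psi> d0 \<le> \<Psi> 0" by (rule d0(2)[OF T0])
    then have "d0 \<bullet> (y - xt) \<le> L (y, wb) - L (xb, wb) - vb \<bullet> (y - xb)"
      using mv m_base by (simp add: \<Psi>_def v_def inner_add_left inner_diff_right)
    also have "\<dots> \<le> M * (norm (y - xb))\<^sup>2"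
    proof -
      have "(y, wb) \<in> cball (xb, wb) r0" using X_props(4)[OF in1[OF c1(2)]] by (simp add: G_def y_def)
      from taylor[OF this] show ?thesis by linarith
    qed
    also have "\<dots> \<le> M * (2 * (t * U))\<^sup>2"
    proof -
      have "norm (t *\<^sub>R u0 + e1) \<le> t * U" using norm_triangle_ineq[of "t *\<^sub>R u0" e1] e1(2) t by (simp add: U_def distrib_left)
      then have "norm (y - xb) \<le> 2 * (t * U)" using X_near[OF c1(2)] by (simp add: y_def)
      then show ?thesis using M by (intro mult_left_mono power_mono) auto
    qed
    finally have up: "d0 \<bullet> (y - xt) \<le> M * (2 * (t * U))\<^sup>2" .
    have "(norm e1)\<^sup>2 / 2 \<le> e1 \<bullet> (y - xt)"
      using X_mono[OF tC0(2) c1(2)] by (simp add: y_def xt_def add.assoc)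
    then have "(t * \<epsilon>)\<^sup>2 / 2 \<le> (\<epsilon> / R) * (d0 \<bullet> (y - xt))" unfolding e1(2) by (simp add: e1_def)
    also have "\<dots> \<le> (\<epsilon> / R) * (M * (2 * (t * U))\<^sup>2)" using up \<epsilon> R(1) by (intro mult_left_mono) auto
    finally have "R * ((t * \<epsilon>)\<^sup>2 / 2) \<le> \<epsilon> * (M * (2 * (t * U))\<^sup>2)" using R(1) by (simp add: field_simps)
    then have "(t\<^sup>2 * \<epsilon>) * (R * \<epsilon>) \<le> (t\<^sup>2 * \<epsilon>) * (8 * M * U\<^sup>2)" by (simp add: power2_eq_square mult_ac)
    moreover have "t\<^sup>2 * \<epsilon> > 0" using t \<epsilon> by simp
    ultimately show False using R(2) by (simp add: mult_le_cancel_left)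
  qed
  \<comment> \<open>First-order condition without differentiating \<open>m\<close>: by
    \<open>m_diff\<close> the increment of \<open>\<Psi>\<close> in direction
    \<open>\<tau> e\<close> is at most \<open>\<tau> (e \<bullet> (x v' - xt))\<close>, and
    \<open>x v'\<close> tends to \<open>x v\<close> with \<open>\<tau>\<close>.\<close>
  have stat: "0 \<le> e \<bullet> (x v - xt)" if e: "e \<in> S" for e
  proof -
    have ev: "\<forall>\<^sub>F \<tau> in at_right 0. - (\<Lambda> * (norm e)\<^sup>2) * \<tau> \<le> e \<bullet> (x v - xt)"
    proof -
      have "((\<lambda>\<tau>. norm (d0 + \<tau> *\<^sub>R e)) \<longlongrightarrow> norm (d0 + 0 *\<^sub>R e)) (at_right 0)" by (intro tendsto_intros)
      then have "\<forall>\<^sub>F \<tau> in at_right 0. norm (d0 + \<tau> *\<^sub>R e) < t * R" using interior by (intro order_tendstoD) auto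
      with eventually_at_right_less[of "0::real"] show ?thesis
      proof eventually_elim
        case (elim \<tau>)
        then have eT: "d0 + \<tau> *\<^sub>R e \<in> T" using nd0 e by (auto simp: T_def intro!: subspace_add subspace_scale S)
        define v' where "v' = v + \<tau> *\<^sub>R e"
        have v': "v' \<in> V" "v' = vb + (d0 + \<tau> *\<^sub>R e)" using TV[OF eT] by (auto simp: v'_def v_def add.assoc)
        have "\<Psi> d0 \<le> \<Psi> (d0 + \<tau> *\<^sub>R e)" by (rule d0(2)[OF eT])
        then have "m v' - m v + (v' - v) \<bullet> xt \<le> 0"
          unfolding \<Psi>_def v'(2)[symmetric] v_def[symmetric] by (simp add: inner_diff_left)
        moreover have "m v \<le> m v' + (v' - v) \<bullet> x v'" by (rule m_diff[OF vV v'(1)])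
        ultimately have "0 \<le> \<tau> * (e \<bullet> (x v' - xt))" by (simp add: v'_def inner_diff_right right_diff_distrib)
        then have p: "0 \<le> e \<bullet> (x v' - xt)" using elim(1) by (simp add: zero_le_mult_iff)
        have "norm (x v' - x v) \<le> \<Lambda> * (\<tau> * norm e)" using x_lip[OF v'(1) vV] elim(1) by (simp add: v'_def)
        then have "norm e * norm (x v' - x v) \<le> norm e * (\<Lambda> * (\<tau> * norm e))" by (intro mult_left_mono) auto
        then have "e \<bullet> (x v' - x v) \<le> norm e * (\<Lambda> * (\<tau> * norm e))" using norm_cauchy_schwarz[of e "x v' - x v"] by linarith
        then have "e \<bullet> (x v' - x v) \<le> \<Lambda> * (norm e)\<^sup>2 * \<tau>" by (simp add: power2_eq_square mult_ac)
        then show ?case using p by (simp add: inner_diff_right)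
      qed
    qed
    have "((\<lambda>\<tau>. - (\<Lambda> * (norm e)\<^sup>2) * \<tau>) \<longlongrightarrow> - (\<Lambda> * (norm e)\<^sup>2) * 0) (at_right 0)" by (intro tendsto_intros)
    from tendsto_upperbound[OF this ev] show ?thesis by simp
  qed
  have nv: "norm (v - vb) \<le> t * R" using nd0 by (simp add: v_def)
  have xv: "x v = xt"
  proof -
    have "norm (x v - xb) \<le> \<Lambda> * norm (v - vb)" using x_lip[OF vV V(2)] by (simp add: xb)
    also have "\<dots> \<le> \<Lambda> * (t * R)" using nv \<Lambda> by (intro mult_left_mono) auto
    finally have "norm (x v - xb) \<le> \<rho>" using tle(3) by simp
    moreover have "norm (v - vb) \<le> r" using nv tle(2) by simp
    ultimately obtain c where c: "c \<in> C" "norm c \<le> r" "x v = X (xb + c, wb) \<or> ereal (k (xb + c, wb) v) < f (x v, wb) - ereal (v \<bullet> x v)"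
      using red wb0(2) by blast
    have "\<not> ereal (k (xb + c, wb) v) < f (x v, wb) - ereal (v \<bullet> x v)"
      using m_upper[OF vV c(1,2)] by (simp add: x_val[OF vV])
    then have xc: "x v = X (xb + c, wb)" using c(3) by blast
    \<comment> \<open>Stationarity in the direction \<open>- e\<close> against strong monotonicity
      in the direction \<open>e\<close> leaves only \<open>e = 0\<close>.\<close>
    define e where "e = c - t *\<^sub>R u0"
    have "e \<in> S" unfolding e_def using c(1) tC0(1) C_S by (intro subspace_diff S) auto
    then have "- e \<in> S" by (rule subspace_neg[OF S])
    from stat[OF this] have "e \<bullet> (x v - xt) \<le> 0" by simp
    moreover have "(norm e)\<^sup>2 / 2 \<le> e \<bullet> (x v - xt)"
      using X_mono[OF tC0(2), of e] c(2) by (simp add: e_def xc xt_def)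
    ultimately have "(norm e)\<^sup>2 \<le> 0" by linarith
    then have "e = 0" by simp
    then show ?thesis by (simp add: e_def xc xt_def)
  qed
  define \<sigma> where "\<sigma> = t * \<epsilon> / norm d"
  define u where "u = \<sigma> *\<^sub>R d"
  have \<sigma>: "\<sigma> > 0" using t \<epsilon> d by (simp add: \<sigma>_def)
  have u: "u \<in> S" "- u \<in> S" "norm u = t * \<epsilon>" using d t \<epsilon> by (auto simp: u_def \<sigma>_def subspace_scale[OF S] subspace_neg[OF S])
  have up: "k (xb + t *\<^sub>R u0, wb) v + (norm e)\<^sup>2 / (9 * \<Lambda>) \<le> k (xb + t *\<^sub>R u0 + e, wb) v"
    if e: "e \<in> S" "norm e = t * \<epsilon>" for e
  proof -
    note c = tC[OF e(1) eq_refl[OF e(2)]]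
    define y where "y = X (xb + (t *\<^sub>R u0 + e), wb)"
    have dy: "norm (y - xt) \<le> 2 * norm e" "norm e \<le> 3/2 * norm (y - xt)"
      using X_lip_fst(1,3)[OF in1[OF c(2)] in1[OF tC0(2)]] by (auto simp: y_def xt_def)
    have "v + (1 / (2 * \<Lambda>)) *\<^sub>R (y - x v) \<in> V"
    proof -
      have "norm ((v - vb) + (1 / (2 * \<Lambda>)) *\<^sub>R (y - xt)) \<le> norm (v - vb) + norm ((1 / (2 * \<Lambda>)) *\<^sub>R (y - xt))"
        by (rule norm_triangle_ineq)
      also have "norm ((1 / (2 * \<Lambda>)) *\<^sub>R (y - xt)) = (1 / (2 * \<Lambda>)) * norm (y - xt)" using \<Lambda> by simp
      also have "\<dots> \<le> (1 / (2 * \<Lambda>)) * (2 * (t * \<epsilon>))" using dy(1) e(2) \<Lambda> by (intro mult_left_mono) auto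
      also have "\<dots> = t * (\<epsilon> / \<Lambda>)" by simp
      finally have "norm ((v - vb) + (1 / (2 * \<Lambda>)) *\<^sub>R (y - xt)) < \<delta>" using nv tle(4) by linarith
      moreover have "norm (vb - (v + (1 / (2 * \<Lambda>)) *\<^sub>R (y - xt))) = norm ((v - vb) + (1 / (2 * \<Lambda>)) *\<^sub>R (y - xt))"
        by (subst norm_minus_commute) (simp add: algebra_simps)
      ultimately have "v + (1 / (2 * \<Lambda>)) *\<^sub>R (y - xt) \<in> ball vb \<delta>" by (simp only: mem_ball dist_norm)
      then show ?thesis using \<delta>(2) xv by auto
    qed
    from growth[OF vV XP[OF c(2)] this[unfolded y_def]]
    have gr: "m v + (norm (y - xt))\<^sup>2 / (4 * \<Lambda>) \<le> k (xb + (t *\<^sub>R u0 + e), wb) v"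
      using val[OF c wb0(1)] by (simp add: y_def xv)
    have mv: "m v = k (xb + t *\<^sub>R u0, wb) v"
      using x_val[OF vV] val[OF tC0 wb0(1), of v] by (simp add: xv xt_def)
    have "(norm e)\<^sup>2 \<le> (3/2 * norm (y - xt))\<^sup>2" using dy(2) by (intro power_mono) auto
    then have "(norm e)\<^sup>2 / (9 * \<Lambda>) \<le> (3/2 * norm (y - xt))\<^sup>2 / (9 * \<Lambda>)" using \<Lambda> by (intro divide_right_mono) auto
    also have "\<dots> = (norm (y - xt))\<^sup>2 / (4 * \<Lambda>)" by (simp add: power_mult_distrib power_divide)
    finally show ?thesis using gr mv by (simp add: add.assoc)
  qed
  \<comment> \<open>\<open>u\<close> is \<open>d\<close> rescaled so that both
    \<open>t u0 + u\<close> and \<open>t u0 - u\<close> lie in \<open>C\<close>. Adding the growth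
    at the two points compares the second difference of \<open>k\<close> with
    \<open>H u\<close>.\<close>
  have "\<bar>k (xb + t *\<^sub>R u0 + u, wb) v + k (xb + t *\<^sub>R u0 - u, wb) v - 2 * k (xb + t *\<^sub>R u0, wb) v - H u\<bar> \<le> 1 / (9 * \<Lambda>) * (norm u)\<^sup>2"
    using tC(2)[OF u(1) eq_refl[OF u(3)]] tC(2)[OF u(2)] u(3) nv tle(2)
    by (intro B wb0(1)) (simp_all add: algebra_simps)
  moreover have "k (xb + t *\<^sub>R u0, wb) v + (norm u)\<^sup>2 / (9 * \<Lambda>) \<le> k (xb + t *\<^sub>R u0 - u, wb) v"
    using up[OF u(2)] u(3) by simp
  moreover note up[OF u(1,3)]
  moreover have "1 / (9 * \<Lambda>) * (norm u)\<^sup>2 = (norm u)\<^sup>2 / (9 * \<Lambda>)" by simp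
  moreover have "(norm u)\<^sup>2 / (9 * \<Lambda>) > 0" using \<Lambda> t \<epsilon> u(3) by simp
  ultimately have "H u > 0" by linarith
  then show ?thesis using \<sigma> by (simp add: u_def H_scale zero_less_mult_iff)
qed

end

section \<open>Charts and derivatives of smooth data\<close>

lemma finite_common_radius:
  assumes "finite N" and "\<And>k. k \<in> N \<Longrightarrow> \<exists>r>0. P k r"
    and mono: "\<And>k r r'. k \<in> N \<Longrightarrow> P k r \<Longrightarrow> 0 < r' \<Longrightarrow> r' \<le> r \<Longrightarrow> P k r'"
  shows "\<exists>r>0::real. \<forall>k\<in>N. P k r"
proof -
  obtain R where R: "\<And>k. k \<in> N \<Longrightarrow> R k > 0 \<and> P k (R k)" using assms(2) by metis
  define r where "r = Min (insert 1 (R ` N))"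
  have "r > 0" unfolding r_def using assms(1) R by (subst Min_gr_iff) auto
  moreover have "P k r" if "k \<in> N" for k
  proof (rule mono[OF that])
    show "P k (R k)" using R[OF that] by blast
    show "r \<le> R k" unfolding r_def using assms(1) that by (intro Min_le) auto
  qed fact
  ultimately show ?thesis by blast
qed

lemma parallelogram_bound_mono:
  assumes "parallelogram_bound M U f" "M \<le> M'" "U' \<subseteq> U"
  shows "parallelogram_bound M' U' f"
  unfolding parallelogram_bound_def
proof (intro ballI impI)
  fix a b c d assume "a \<in> U'" "b \<in> U'" "c \<in> U'" "d \<in> U'" "a + d = b + c"
  then have "norm (f d - f b - f c + f a) \<le> M * norm (b - a) * norm (c - a)"
    using assms(3) by (intro parallelogram_boundD[OF assms(1)]) auto
  also have "\<dots> \<le> M' * norm (b - a) * norm (c - a)" using assms(2) by (intro mult_right_mono) auto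
  finally show "norm (f d - f b - f c + f a) \<le> M' * norm (b - a) * norm (c - a)" .
qed

lemma C2_witness_sum:
  fixes g :: "'k \<Rightarrow> 'a::euclidean_space \<Rightarrow> real"
  assumes g: "\<And>k. k \<in> N \<Longrightarrow> C2_witness (g k) (g' k) (g'' k)"
  shows "C2_witness (\<lambda>q. (\<Sum>k\<in>N. \<gamma> k * g k q) - \<beta>) (\<lambda>q. \<Sum>k\<in>N. \<gamma> k *\<^sub>R g' k q) (\<lambda>q. \<Sum>k\<in>N. \<gamma> k *\<^sub>R g'' k q)"
  unfolding C2_witness_def
proof (intro conjI allI)
  fix x
  have "((\<lambda>q. (\<Sum>k\<in>N. \<gamma> k * g k q) - \<beta>) has_derivative (\<lambda>h. (\<Sum>k\<in>N. \<gamma> k * g' k x h) - 0)) (at x)"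
    using g by (intro has_derivative_diff has_derivative_sum has_derivative_mult_right has_derivative_const) (auto simp: C2_witness_def)
  then show "((\<lambda>q. (\<Sum>k\<in>N. \<gamma> k * g k q) - \<beta>) has_derivative blinfun_apply (\<Sum>k\<in>N. \<gamma> k *\<^sub>R g' k x)) (at x)"
    by (rule has_derivative_eq_rhs) (auto simp: blinfun.sum_left blinfun.scaleR_left)
  have "((\<lambda>q. \<Sum>k\<in>N. \<gamma> k *\<^sub>R g' k q) has_derivative (\<lambda>h. \<Sum>k\<in>N. \<gamma> k *\<^sub>R g'' k x h)) (at x)"
    using g by (intro has_derivative_sum has_derivative_scaleR_right) (auto simp: C2_witness_def)
  then show "((\<lambda>q. \<Sum>k\<in>N. \<gamma> k *\<^sub>R g' k q) has_derivative blinfun_apply (\<Sum>k\<in>N. \<gamma> k *\<^sub>R g'' k x)) (at x)"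
    by (rule has_derivative_eq_rhs) (auto simp: blinfun.sum_left blinfun.scaleR_left)
  show "continuous_on UNIV (\<lambda>q. \<Sum>k\<in>N. \<gamma> k *\<^sub>R g'' k q)"
    using g by (intro continuous_intros) (auto simp: C2_witness_def)
qed

lemma C2_witness_minus_linear:
  fixes g :: "'a::euclidean_space \<Rightarrow> real" and l :: "'a \<Rightarrow>\<^sub>L real"
  assumes g: "C2_witness g g' g''"
  shows "C2_witness (\<lambda>q. g q - \<beta> - l (q - q0)) (\<lambda>q. g' q - l) g''"
  unfolding C2_witness_def
proof (intro conjI allI)
  fix x
  have "((\<lambda>q. l (q - q0)) has_derivative (\<lambda>h. l (h - 0))) (at x)"
    by (rule bounded_linear.has_derivative[OF blinfun.bounded_linear_right has_derivative_diff[OF has_derivative_ident has_derivative_const]])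
  from has_derivative_diff[OF has_derivative_diff[OF C2_D1[OF g] has_derivative_const] this]
  show "((\<lambda>q. g q - \<beta> - l (q - q0)) has_derivative blinfun_apply (g' x - l)) (at x)"
    by (rule has_derivative_eq_rhs) (auto simp: blinfun.diff_left)
  from has_derivative_diff[OF C2_D2[OF g] has_derivative_const]
  show "((\<lambda>q. g' q - l) has_derivative blinfun_apply (g'' x)) (at x)" by simp
  show "continuous_on UNIV g''" by (rule C2_cont[OF g])
qed

text \<open>The \<open>h k\<close> vanish at the base together with their x-derivatives, so adding
  them to x keeps \<open>\<psi>\<close> tangent to the identity in x; a first-order dependence on w
  is allowed. \<open>psi_half\<close> is the strict estimate with \<open>e = 1/2\<close>, and
  \<open>M\<close> sums the constants of all assumptions of \<open>chart\<close>.\<close>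

lemma chart_from_C2:
  fixes h :: "'k \<Rightarrow> 'a::euclidean_space \<times> 'w::euclidean_space \<Rightarrow> real" and \<rho> :: "'k \<Rightarrow> 'a"
  assumes N: "finite N" and h: "\<And>k. k \<in> N \<Longrightarrow> C2_witness (h k) (h' k) (h'' k)"
    and h0: "\<And>k. k \<in> N \<Longrightarrow> h k (xb, wb) = 0" "\<And>k u. k \<in> N \<Longrightarrow> h' k (xb, wb) (u, 0) = 0"
    and L: "C2_witness L L' L''" and vb: "\<And>u. L' (xb, wb) (u, 0) = vb \<bullet> u"
  shows "\<exists>r0 M. chart (\<lambda>q. fst q + (\<Sum>k\<in>N. h k q *\<^sub>R \<rho> k)) L (\<lambda>u. L'' (xb, wb) (u, 0) (u, 0)) xb wb vb r0 M"
proof -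
  let ?qb = "(xb, wb)"
  define \<psi> where "\<psi> q = fst q + (\<Sum>k\<in>N. h k q *\<^sub>R \<rho> k)" for q
  define H where "H u = L'' ?qb (u, 0) (u, 0)" for u
  define \<Sigma> where "\<Sigma> = (\<Sum>k\<in>N. norm (\<rho> k))"
  have \<Sigma>: "\<Sigma> \<ge> 0" unfolding \<Sigma>_def by (intro sum_nonneg) auto
  have sumb: "norm (\<Sum>k\<in>N. a k *\<^sub>R \<rho> k) \<le> B * \<Sigma>" if "\<And>k. k \<in> N \<Longrightarrow> \<bar>a k\<bar> \<le> B" for a B
  proof -
    have "norm (\<Sum>k\<in>N. a k *\<^sub>R \<rho> k) \<le> (\<Sum>k\<in>N. norm (a k *\<^sub>R \<rho> k))" by (rule norm_sum)
    also have "\<dots> \<le> (\<Sum>k\<in>N. B * norm (\<rho> k))" using that by (intro sum_mono) (auto intro: mult_right_mono)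
    finally show ?thesis by (simp add: \<Sigma>_def sum_distrib_left)
  qed
  have "\<forall>k\<in>N. \<exists>M\<ge>0. M-lipschitz_on (cball ?qb 1) (h k) \<and> parallelogram_bound M (cball ?qb 1) (h k)"
    using C2_lipschitz_parallelogram[OF h] by blast
  then obtain Mh where Mh: "\<And>k. k \<in> N \<Longrightarrow> Mh k \<ge> 0 \<and> (Mh k)-lipschitz_on (cball ?qb 1) (h k) \<and> parallelogram_bound (Mh k) (cball ?qb 1) (h k)"
    by metis
  define Ms where "Ms = (\<Sum>k\<in>N. Mh k)"
  have Ms: "Mh k \<le> Ms" if "k \<in> N" for k unfolding Ms_def using N that Mh by (intro member_le_sum) auto
  have Ms0: "Ms \<ge> 0" unfolding Ms_def using Mh by (intro sum_nonneg) auto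
  have hL: "Ms-lipschitz_on (cball ?qb 1) (h k)" "parallelogram_bound Ms (cball ?qb 1) (h k)" if "k \<in> N" for k
    using Mh[OF that] Ms[OF that] by (auto intro: lipschitz_on_le parallelogram_bound_mono)
  obtain BL where BL: "BL \<ge> 0" "BL-lipschitz_on (cball ?qb 1) L" "parallelogram_bound BL (cball ?qb 1) L"
    using C2_lipschitz_parallelogram[OF L] by blast
  obtain BT where BT: "BT \<ge> 0" "\<And>q. q \<in> cball ?qb 1 \<Longrightarrow> \<bar>L q - L ?qb - L' ?qb (q - ?qb)\<bar> \<le> BT * (norm (q - ?qb))\<^sup>2"
    using C2_taylor1[OF L] by blast
  define M where "M = (1 + Ms * \<Sigma>) + BL + BT + norm (L'' ?qb)"
  have Mge: "M \<ge> 0" "1 + Ms * \<Sigma> \<le> M" "BL \<le> M" "BT \<le> M" "norm (L'' ?qb) \<le> M"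
    unfolding M_def using Ms0 \<Sigma> BL(1) BT(1) by auto
  have h_strict: "\<exists>r>0. \<forall>k\<in>N. \<forall>x\<in>cball ?qb r. \<forall>y\<in>cball ?qb r. \<bar>h k x - h k y - h' k ?qb (x - y)\<bar> \<le> e * norm (x - y)"
    if "e > 0" for e
    by (rule finite_common_radius[OF N]) (use C2_strict_derivative[OF h that] in auto)
  have psi_strict: "\<exists>r>0. \<forall>x x' w. (x, w) \<in> cball ?qb r \<longrightarrow> (x', w) \<in> cball ?qb r \<longrightarrow>
      norm (\<psi> (x, w) - \<psi> (x', w) - (x - x')) \<le> e * norm (x - x')" if e: "e > 0" for e
  proof -
    have "e / (1 + \<Sigma>) > 0" using e \<Sigma> by simp
    from h_strict[OF this] obtain r where r: "r > 0" "\<And>k x y. k \<in> N \<Longrightarrow> x \<in> cball ?qb r \<Longrightarrow> y \<in> cball ?qb r \<Longrightarrow>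
        \<bar>h k x - h k y - h' k ?qb (x - y)\<bar> \<le> e / (1 + \<Sigma>) * norm (x - y)" by blast
    have "norm (\<psi> (x, w) - \<psi> (x', w) - (x - x')) \<le> e * norm (x - x')" if U: "(x, w) \<in> cball ?qb r" "(x', w) \<in> cball ?qb r" for x x' w
    proof -
      have "\<psi> (x, w) - \<psi> (x', w) - (x - x') = (\<Sum>k\<in>N. (h k (x, w) - h k (x', w)) *\<^sub>R \<rho> k)"
        by (simp add: \<psi>_def scaleR_left_diff_distrib sum_subtractf)
      also have "norm \<dots> \<le> (e / (1 + \<Sigma>) * norm (x - x')) * \<Sigma>"
        using r(2)[OF _ U] h0(2) by (intro sumb) simp
      also have "\<dots> = e * norm (x - x') * (\<Sigma> / (1 + \<Sigma>))" by simp
      also have "\<dots> \<le> e * norm (x - x') * 1" using e \<Sigma> by (intro mult_left_mono) auto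
      finally show ?thesis by simp
    qed
    then show ?thesis using r(1) by blast
  qed
  obtain rh where rh: "rh > 0" "\<And>x x' w. (x, w) \<in> cball ?qb rh \<Longrightarrow> (x', w) \<in> cball ?qb rh \<Longrightarrow>
      norm (\<psi> (x, w) - \<psi> (x', w) - (x - x')) \<le> 1/2 * norm (x - x')"
    using psi_strict[of "1/2"] by auto
  define r0 where "r0 = min rh 1"
  have r0: "r0 > 0" "cball ?qb r0 \<subseteq> cball ?qb 1" "cball ?qb r0 \<subseteq> cball ?qb rh"
    using rh(1) by (auto simp: r0_def)
  have "chart \<psi> L H xb wb vb r0 M"
  proof
    show "r0 > 0" "M \<ge> 0" by fact+
    show "\<psi> ?qb = xb" by (simp add: \<psi>_def h0)
    have "(1 + Ms * \<Sigma>)-lipschitz_on (cball ?qb 1) \<psi>"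
    proof (rule lipschitz_onI)
      fix p q assume pq: "p \<in> cball ?qb 1" "q \<in> cball ?qb 1"
      have "\<psi> p - \<psi> q = (fst p - fst q) + (\<Sum>k\<in>N. (h k p - h k q) *\<^sub>R \<rho> k)"
        by (simp add: \<psi>_def scaleR_left_diff_distrib sum_subtractf)
      also have "norm \<dots> \<le> norm (fst p - fst q) + norm (\<Sum>k\<in>N. (h k p - h k q) *\<^sub>R \<rho> k)" by (rule norm_triangle_ineq)
      also have "norm (\<Sum>k\<in>N. (h k p - h k q) *\<^sub>R \<rho> k) \<le> (Ms * norm (p - q)) * \<Sigma>"
        using lipschitz_onD[OF hL(1) pq] by (intro sumb) (simp add: dist_norm)
      also have "norm (fst p - fst q) \<le> norm (p - q)"
        using norm_fst_le[of "fst p - fst q" "snd p - snd q"] by (simp add: minus_prod_def)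
      finally show "dist (\<psi> p) (\<psi> q) \<le> (1 + Ms * \<Sigma>) * dist p q" by (simp add: dist_norm algebra_simps)
    qed (use Ms0 \<Sigma> in simp)
    then show "M-lipschitz_on (cball ?qb r0) \<psi>"
      using lipschitz_on_le[OF lipschitz_on_subset[OF _ r0(2)] Mge(2)] by blast
    have "parallelogram_bound (1 + Ms * \<Sigma>) (cball ?qb 1) \<psi>"
      unfolding parallelogram_bound_def
    proof (intro ballI impI)
      fix a b c d assume U: "a \<in> cball ?qb 1" "b \<in> cball ?qb 1" "c \<in> cball ?qb 1" "d \<in> cball ?qb 1" and eq: "a + d = b + c"
      have f: "fst d - fst b - fst c + fst a = 0" using arg_cong[OF eq, of fst] by (simp add: algebra_simps)
      have "\<psi> d - \<psi> b - \<psi> c + \<psi> a = (fst d - fst b - fst c + fst a) + (\<Sum>k\<in>N. (h k d - h k b - h k c + h k a) *\<^sub>R \<rho> k)"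
        by (simp add: \<psi>_def scaleR_left_diff_distrib scaleR_left_distrib sum_subtractf sum.distrib)
      also have "\<dots> = (\<Sum>k\<in>N. (h k d - h k b - h k c + h k a) *\<^sub>R \<rho> k)" unfolding f by simp
      also have "norm \<dots> \<le> (Ms * norm (b - a) * norm (c - a)) * \<Sigma>"
        using parallelogram_boundD[OF hL(2) U eq] by (intro sumb) simp
      also have "\<dots> = (Ms * \<Sigma>) * (norm (b - a) * norm (c - a))" by simp
      also have "\<dots> \<le> (1 + Ms * \<Sigma>) * (norm (b - a) * norm (c - a))" by (intro mult_right_mono) auto
      finally show "norm (\<psi> d - \<psi> b - \<psi> c + \<psi> a) \<le> (1 + Ms * \<Sigma>) * norm (b - a) * norm (c - a)" by (simp only: mult.assoc)
    qed
    then show "parallelogram_bound M (cball ?qb r0) \<psi>" using Mge(2) r0(2) by (rule parallelogram_bound_mono)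
    show "M-lipschitz_on (cball ?qb r0) L"
      using lipschitz_on_le[OF lipschitz_on_subset[OF BL(2) r0(2)] Mge(3)] .
    show "parallelogram_bound M (cball ?qb r0) L" using BL(3) Mge(3) r0(2) by (rule parallelogram_bound_mono)
    show "norm (\<psi> (x, w) - \<psi> (x', w) - (x - x')) \<le> norm (x - x') / 2"
      if "(x, w) \<in> cball ?qb r0" "(x', w) \<in> cball ?qb r0" for x x' w
      using rh(2)[OF subsetD[OF r0(3) that(1)] subsetD[OF r0(3) that(2)]] by simp
    show "\<bar>L (x, wb) - L ?qb - vb \<bullet> (x - xb)\<bar> \<le> M * (norm (x - xb))\<^sup>2" if "(x, wb) \<in> cball ?qb r0" for x
    proof -
      have "\<bar>L (x, wb) - L ?qb - L' ?qb ((x, wb) - ?qb)\<bar> \<le> BT * (norm ((x, wb) - ?qb))\<^sup>2"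
        by (rule BT(2)[OF subsetD[OF r0(2) that]])
      then have "\<bar>L (x, wb) - L ?qb - vb \<bullet> (x - xb)\<bar> \<le> BT * (norm (x - xb))\<^sup>2" by (simp add: vb)
      also have "\<dots> \<le> M * (norm (x - xb))\<^sup>2" using Mge(4) by (intro mult_right_mono) auto
      finally show ?thesis .
    qed
    show "\<bar>H u - H u'\<bar> \<le> M * norm (u - u') * (norm u + norm u')" for u u'
    proof -
      have bil: "\<bar>L'' ?qb (a, 0) (b, 0)\<bar> \<le> M * norm a * norm b" for a b
      proof -
        have "\<bar>L'' ?qb (a, 0) (b, 0)\<bar> \<le> norm (L'' ?qb (a, 0)) * norm (b, 0::'w)"
          using norm_blinfun[of "L'' ?qb (a, 0)" "(b, 0)"] by simp
        also have "\<dots> \<le> (norm (L'' ?qb) * norm (a, 0::'w)) * norm (b, 0::'w)"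
          by (intro mult_right_mono norm_blinfun) auto
        also have "\<dots> \<le> (M * norm a) * norm b" using Mge by (auto intro!: mult_right_mono)
        finally show ?thesis .
      qed
      have "(u, 0::'w) = (u - u', 0) + (u', 0)" by simp
      then have "H u = L'' ?qb (u - u', 0) (u, 0) + L'' ?qb (u', 0) (u, 0)"
        unfolding H_def by (metis blinfun.add_left blinfun.add_right)
      moreover have "L'' ?qb (u', 0) (u, 0) = L'' ?qb (u', 0) (u - u', 0) + H u'"
        unfolding H_def using \<open>(u, 0::'w) = (u - u', 0) + (u', 0)\<close> by (metis blinfun.add_right)
      ultimately have "\<bar>H u - H u'\<bar> \<le> M * norm (u - u') * norm u + M * norm u' * norm (u - u')"
        using bil[of "u - u'" u] bil[of u' "u - u'"] by linarith
      then show ?thesis by (simp add: algebra_simps)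
    qed
    show "H (s *\<^sub>R u) = s\<^sup>2 * H u" for s u
    proof -
      have "(s *\<^sub>R u, 0::'w) = s *\<^sub>R (u, 0)" by simp
      then show ?thesis unfolding H_def by (simp only: blinfun.scaleR_left blinfun.scaleR_right) (simp add: power2_eq_square)
    qed
    fix e :: real assume e: "e > 0"
    obtain ra where ra: "ra > 0" "\<And>x x' w. (x, w) \<in> cball ?qb ra \<Longrightarrow> (x', w) \<in> cball ?qb ra \<Longrightarrow>
        norm (\<psi> (x, w) - \<psi> (x', w) - (x - x')) \<le> e * norm (x - x')" using psi_strict[OF e] by blast
    obtain rb where rb: "rb > 0" "\<And>x y. x \<in> cball ?qb rb \<Longrightarrow> y \<in> cball ?qb rb \<Longrightarrow> \<bar>L x - L y - L' ?qb (x - y)\<bar> \<le> e * norm (x - y)"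
      using C2_strict_derivative[OF L e] by blast
    obtain rc where rc: "rc > 0" "\<And>x u. x + u \<in> cball ?qb rc \<Longrightarrow> x - u \<in> cball ?qb rc \<Longrightarrow>
        \<bar>L (x + u) + L (x - u) - 2 * L x - L'' ?qb u u\<bar> \<le> e * (norm u)\<^sup>2"
      using C2_second_difference[OF L e] by blast
    define r where "r = min ra (min rb rc)"
    have sub: "cball ?qb r \<subseteq> cball ?qb ra" "cball ?qb r \<subseteq> cball ?qb rb" "cball ?qb r \<subseteq> cball ?qb rc"
      by (auto simp: r_def)
    show "\<exists>r>0. (\<forall>x x' w. (x, w) \<in> cball ?qb r \<longrightarrow> (x', w) \<in> cball ?qb r \<longrightarrow>
           norm (\<psi> (x, w) - \<psi> (x', w) - (x - x')) \<le> e * norm (x - x') \<and>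
           \<bar>L (x, w) - L (x', w) - vb \<bullet> (x - x')\<bar> \<le> e * norm (x - x')) \<and>
        (\<forall>x u w. (x + u, w) \<in> cball ?qb r \<longrightarrow> (x - u, w) \<in> cball ?qb r \<longrightarrow>
           \<bar>L (x + u, w) + L (x - u, w) - 2 * L (x, w) - H u\<bar> \<le> e * (norm u)\<^sup>2)"
    proof (intro exI conjI allI impI)
      show "r > 0" using ra(1) rb(1) rc(1) by (simp add: r_def)
      fix x x' w assume U: "(x, w) \<in> cball ?qb r" "(x', w) \<in> cball ?qb r"
      show "norm (\<psi> (x, w) - \<psi> (x', w) - (x - x')) \<le> e * norm (x - x')"
        by (rule ra(2)[OF subsetD[OF sub(1) U(1)] subsetD[OF sub(1) U(2)]])
      show "\<bar>L (x, w) - L (x', w) - vb \<bullet> (x - x')\<bar> \<le> e * norm (x - x')"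
        using rb(2)[OF subsetD[OF sub(2) U(1)] subsetD[OF sub(2) U(2)]] by (simp add: vb)
    next
      fix x u w assume U: "(x + u, w) \<in> cball ?qb r" "(x - u, w) \<in> cball ?qb r"
      show "\<bar>L (x + u, w) + L (x - u, w) - 2 * L (x, w) - H u\<bar> \<le> e * (norm u)\<^sup>2"
        using rc(2)[of "(x, w)" "(u, 0)"] subsetD[OF sub(3) U(1)] subsetD[OF sub(3) U(2)] by (simp add: H_def del: mem_cball)
    qed
  qed
  then show ?thesis unfolding \<psi>_def H_def by blast
qed

section \<open>Partial gradients and Hessians in x from joint derivatives\<close>

context
  fixes f :: "'a::euclidean_space \<times> 'w::euclidean_space \<Rightarrow> real" and f' f''
  assumes f: "C2_witness f f' f''"
begin

lemma C2_partial: "((\<lambda>x. f (x, w)) has_derivative (\<lambda>u. f' (x, w) (u, 0))) (at x)"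
proof -
  have "((\<lambda>x. (x, w)) has_derivative (\<lambda>u. (u, 0))) (at x)"
    by (intro has_derivative_Pair has_derivative_ident has_derivative_const)
  from has_derivative_compose[OF this C2_D1[OF f]] show ?thesis .
qed

lemma partial_gradient: "(\<Sum>b\<in>Basis. f' (x, w) (b, 0) *\<^sub>R b) \<bullet> u = f' (x, w) (u, 0)"
proof -
  have lin: "linear (\<lambda>u. f' (x, w) (u, 0))" by (rule has_derivative_linear[OF C2_partial])
  have "f' (x, w) (u, 0) = f' (x, w) (\<Sum>b\<in>Basis. (u \<bullet> b) *\<^sub>R b, 0)" by (simp add: euclidean_representation)
  also have "\<dots> = (\<Sum>b\<in>Basis. (u \<bullet> b) * f' (x, w) (b, 0))"
    using linear_sum[OF lin, of "\<lambda>b. (u \<bullet> b) *\<^sub>R b" Basis] linear_scale[OF lin] by simp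
  finally have e: "f' (x, w) (u, 0) = (\<Sum>b\<in>Basis. (u \<bullet> b) * f' (x, w) (b, 0))" .
  show ?thesis unfolding e inner_sum_left inner_scaleR_left
    by (rule sum.cong) (simp_all add: inner_commute mult.commute)
qed

lemma grad_x_eq: "grad_x f x w = (\<Sum>b\<in>Basis. f' (x, w) (b, 0) *\<^sub>R b)"
proof -
  let ?D = "\<Sum>b\<in>Basis. f' (x, w) (b, 0) *\<^sub>R b"
  have "GDERIV (\<lambda>x. f (x, w)) x :> ?D"
    unfolding gderiv_def using C2_partial[of w x] by (simp only: inner_commute[of _ ?D] partial_gradient)
  moreover have "D = ?D" if "GDERIV (\<lambda>x. f (x, w)) x :> D" for D
  proof -
    have "((\<lambda>x. f (x, w)) has_derivative (\<lambda>u. u \<bullet> D)) (at x)" using that by (simp only: gderiv_def)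
    from has_derivative_unique[OF this C2_partial] have "u \<bullet> D = f' (x, w) (u, 0)" for u by (rule fun_cong)
    then have "D \<bullet> u = ?D \<bullet> u" for u by (simp only: partial_gradient inner_commute[of D])
    then show ?thesis by (rule euclidean_eqI)
  qed
  ultimately show ?thesis unfolding grad_x_def grad_def by (rule the_equality)
qed

lemma grad_x_inner: "grad_x f x w \<bullet> u = f' (x, w) (u, 0)"
  unfolding grad_x_eq by (rule partial_gradient)

lemma hessian_xx_inner: "u \<bullet> hessian_xx f x w u = f'' (x, w) (u, 0) (u, 0)"
proof -
  have "((\<lambda>x. (x, w)) has_derivative (\<lambda>u. (u, 0))) (at x)"
    by (intro has_derivative_Pair has_derivative_ident has_derivative_const)
  from has_derivative_compose[OF this C2_D2[OF f]]
  have d: "((\<lambda>x. f' (x, w)) has_derivative (\<lambda>u. f'' (x, w) (u, 0))) (at x)" .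
  have "((\<lambda>x. \<Sum>b\<in>Basis. f' (x, w) (b, 0) *\<^sub>R b) has_derivative (\<lambda>u. \<Sum>b\<in>Basis. f'' (x, w) (u, 0) (b, 0) *\<^sub>R b)) (at x)"
    by (intro has_derivative_sum has_derivative_scaleR_left bounded_linear.has_derivative[OF blinfun.bounded_linear_left d])
  moreover have "grad (\<lambda>x'. f (x', w)) = (\<lambda>x. \<Sum>b\<in>Basis. f' (x, w) (b, 0) *\<^sub>R b)"
    using grad_x_eq[of _ w] unfolding grad_x_def by blast
  ultimately have "hessian_xx f x w = (\<lambda>u. \<Sum>b\<in>Basis. f'' (x, w) (u, 0) (b, 0) *\<^sub>R b)"
    unfolding hessian_xx_def hessian_def by (simp only: frechet_derivative_at[symmetric])
  then have "u \<bullet> hessian_xx f x w u = (\<Sum>b\<in>Basis. f'' (x, w) (u, 0) (b, 0) * (u \<bullet> b))"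
    by (simp add: inner_sum_right)
  also have "\<dots> = f'' (x, w) (u, 0) (\<Sum>b\<in>Basis. (u \<bullet> b) *\<^sub>R b, 0)"
  proof -
    have "linear (\<lambda>a. f'' (x, w) (u, 0) (a, 0))"
      by (rule bounded_linear.linear[OF bounded_linear_compose[OF blinfun.bounded_linear_right
            bounded_linear_Pair[OF bounded_linear_ident bounded_linear_zero]]])
    note lin = this
    show ?thesis using linear_sum[OF lin, of "\<lambda>b. (u \<bullet> b) *\<^sub>R b" Basis] linear_scale[OF lin] by (simp add: mult.commute)
  qed
  also have "(\<Sum>b\<in>Basis. (u \<bullet> b) *\<^sub>R b) = u" by (rule euclidean_representation)
  finally show ?thesis .
qed

end

lemma deriv_x_vec:
  fixes g :: "'k::finite \<Rightarrow> 'a::euclidean_space \<times> 'w::euclidean_space \<Rightarrow> real"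
  assumes g: "\<And>k. C2_witness (g k) (g' k) (g'' k)"
  shows "deriv_x (\<lambda>q. \<chi> k. g k q) x w = (\<lambda>u. \<chi> k. g' k (x, w) (u, 0))"
proof -
  have e: "(\<chi> k. a k) = (\<Sum>k\<in>UNIV. a k *\<^sub>R axis k (1::real))" for a :: "'k \<Rightarrow> real"
    by (simp add: vec_eq_iff axis_def if_distrib cong: if_cong)
  have "((\<lambda>x. \<chi> k. g k (x, w)) has_derivative (\<lambda>u. \<chi> k. g' k (x, w) (u, 0))) (at x)"
    unfolding e by (intro has_derivative_sum has_derivative_scaleR_left C2_partial[OF g])
  then show ?thesis unfolding deriv_x_def by (rule frechet_derivative_at[symmetric])
qed

section \<open>The minimax problem\<close>

text \<open>In the chart, \<open>\<theta> \<circ> \<Phi> - \<langle>\<varpi>, \<Phi>\<rangle>\<close> becomes \<open>penalty\<close> up to a constant, with \<open>a i = \<nabla>\<^sub>x\<phi>\<^sub>i\<close> and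
  \<open>d t = (\<nabla>\<^sub>x\<Upsilon>)\<^sup>* c\<^sub>t\<close>.\<close>

definition penalty ::
  "'l::finite set \<Rightarrow> nat set \<Rightarrow> ('l \<Rightarrow> real) \<Rightarrow> (nat \<Rightarrow> real) \<Rightarrow> ('l \<Rightarrow> 'a::real_inner) \<Rightarrow> (nat \<Rightarrow> 'a) \<Rightarrow> 'a \<Rightarrow> ereal" where
  "penalty K I lam nu a d u =
     (if \<forall>t\<in>I. d t \<bullet> u \<le> 0
      then ereal ((MAX i\<in>K. a i \<bullet> u) - (\<Sum>i\<in>UNIV. lam i * (a i \<bullet> u)) - (\<Sum>t\<in>I. nu t * (d t \<bullet> u)))
      else \<infinity>)"

text \<open>Their polyhedral cone is the critical cone: equality holds for pairs in
  \<open>J1\<close>, since both differences occur, and for \<open>t\<close> in \<open>J2\<close>,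
  where both signs occur; the other active indices give inequalities.\<close>

definition critical_vectors ::
  "'l set \<Rightarrow> 'l set \<Rightarrow> nat set \<Rightarrow> nat set \<Rightarrow> ('l \<Rightarrow> 'a::real_inner) \<Rightarrow> (nat \<Rightarrow> 'a) \<Rightarrow> 'a set" where
  "critical_vectors K J1 I J2 a d = {a i - a j | i j. i \<in> K \<and> j \<in> J1} \<union> d ` I \<union> (\<lambda>t. - d t) ` J2"

context
  fixes K J1 :: "'l::finite set" and I J2 :: "nat set" and lam :: "'l \<Rightarrow> real" and nu :: "nat \<Rightarrow> real"
    and a :: "'l \<Rightarrow> 'a::euclidean_space" and d :: "nat \<Rightarrow> 'a"
  assumes I: "finite I" and lam: "\<And>i. 0 \<le> lam i" "sum lam UNIV = 1" "\<And>i. i \<notin> K \<Longrightarrow> lam i = 0"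
    and nu: "\<And>t. t \<in> I \<Longrightarrow> 0 \<le> nu t"
    and J1: "J1 = {i\<in>K. 0 < lam i}" and J2: "J2 = {t\<in>I. 0 < nu t}"
begin

lemma multiplier_support_nonempty: "J1 \<noteq> {}"
proof
  assume "J1 = {}"
  then have "lam i = 0" for i using lam(1)[of i] lam(3)[of i] by (auto simp: J1 less_le)
  then show False using lam(2) by simp
qed

lemma finite_critical_vectors: "finite (critical_vectors K J1 I J2 a d)"
proof -
  have "{a i - a j | i j. i \<in> K \<and> j \<in> J1} = (\<lambda>(i, j). a i - a j) ` (K \<times> J1)" by auto
  then have "finite {a i - a j | i j. i \<in> K \<and> j \<in> J1}" by simp
  then show ?thesis using I by (simp add: critical_vectors_def J2)
qed

text \<open>On the cone the maximum is attained at every index carrying a positive multiplier, so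
  averaging returns it, and the constraint terms vanish by complementarity.\<close>

lemma penalty_zero:
  assumes u: "u \<in> poly_cone (critical_vectors K J1 I J2 a d) (\<lambda>x. x)"
  shows "penalty K I lam nu a d u = 0"
proof -
  obtain j where j: "j \<in> J1" using multiplier_support_nonempty by blast
  have jK: "j \<in> K" using j by (simp add: J1)
  have le: "a i \<bullet> u \<le> a j' \<bullet> u" if "i \<in> K" "j' \<in> J1" for i j'
  proof -
    have "a i - a j' \<in> critical_vectors K J1 I J2 a d" using that by (auto simp: critical_vectors_def)
    then have "(a i - a j') \<bullet> u \<le> 0" using u by (auto simp: poly_cone_def)
    then show ?thesis by (simp add: inner_diff_left)
  qed
  have eq: "a i \<bullet> u = a j \<bullet> u" if "i \<in> J1" for i
    using le[of i j] le[of j i] that j by (auto simp: J1)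
  have mx: "(MAX i\<in>K. a i \<bullet> u) = a j \<bullet> u"
    using le[OF _ j] jK by (intro Max_eqI) auto
  have "(\<Sum>i\<in>UNIV. lam i * (a i \<bullet> u)) = (\<Sum>i\<in>UNIV. lam i * (a j \<bullet> u))"
  proof (rule sum.cong[OF refl])
    fix i
    show "lam i * (a i \<bullet> u) = lam i * (a j \<bullet> u)"
      using eq[of i] lam(1)[of i] lam(3)[of i] by (cases "i \<in> J1") (auto simp: J1 less_le)
  qed
  also have "\<dots> = a j \<bullet> u" using lam(2) by (simp flip: sum_distrib_right)
  finally have s: "(\<Sum>i\<in>UNIV. lam i * (a i \<bullet> u)) = a j \<bullet> u" .
  have dle: "d t \<bullet> u \<le> 0" if "t \<in> I" for t
    using u that by (auto simp: poly_cone_def critical_vectors_def)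
  have "nu t * (d t \<bullet> u) = 0" if t: "t \<in> I" for t
  proof (cases "t \<in> J2")
    case True
    then have "- d t \<in> critical_vectors K J1 I J2 a d" by (auto simp: critical_vectors_def)
    then have "- d t \<bullet> u \<le> 0" using u by (auto simp: poly_cone_def)
    then show ?thesis using dle[OF t] by simp
  next
    case False
    then show ?thesis using nu[OF t] t by (auto simp: J2 less_le)
  qed
  then have "(\<Sum>t\<in>I. nu t * (d t \<bullet> u)) = 0" by (intro sum.neutral) auto
  then show ?thesis unfolding penalty_def using dle mx s by (simp add: zero_ereal_def)
qed

text \<open>Since the multipliers sum to 1, the penalty is a sum of nonnegative terms
  \<open>lam i * (mx - a i \<bullet> u)\<close> and \<open>- nu t * (d t \<bullet> u)\<close>. Each
  violation of a critical inequality is dominated by a term with positive weight, at least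
  \<open>\<beta>\<close>; the Hoffman bound then measures the distance to the cone.\<close>

lemma penalty_sharp:
  "\<exists>\<alpha>>0. \<forall>u. ereal (\<alpha> * norm (u - closest_point (poly_cone (critical_vectors K J1 I J2 a d) (\<lambda>x. x)) u))
      \<le> penalty K I lam nu a d u"
proof -
  define N where "N = critical_vectors K J1 I J2 a d"
  have N: "finite N" unfolding N_def by (rule finite_critical_vectors)
  obtain \<alpha> where \<alpha>: "\<alpha> > 0" "\<And>u. \<alpha> * norm (u - closest_point (poly_cone N (\<lambda>x. x)) u) \<le> (\<Sum>k\<in>N. max 0 (k \<bullet> u))"
    using Hoffman_cone[OF N, of "\<lambda>x. x"] by blast
  have "\<exists>\<beta>>0. \<forall>j\<in>J1. \<beta> \<le> lam j" by (rule finite_common_radius) (auto simp: J1)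
  then obtain \<beta>1 where \<beta>1: "\<beta>1 > 0" "\<And>j. j \<in> J1 \<Longrightarrow> \<beta>1 \<le> lam j" by blast
  have "\<exists>\<beta>>0. \<forall>t\<in>J2. \<beta> \<le> nu t" by (rule finite_common_radius) (use I in \<open>auto simp: J2\<close>)
  then obtain \<beta>2 where \<beta>2: "\<beta>2 > 0" "\<And>t. t \<in> J2 \<Longrightarrow> \<beta>2 \<le> nu t" by blast
  define \<beta> where "\<beta> = min 1 (min \<beta>1 \<beta>2)"
  have \<beta>: "\<beta> > 0" "\<And>j. j \<in> J1 \<Longrightarrow> \<beta> \<le> lam j" "\<And>t. t \<in> J2 \<Longrightarrow> \<beta> \<le> nu t"
    using \<beta>1 \<beta>2 by (auto simp: \<beta>_def min_le_iff_disj)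
  define n where "n = real (card N) + 1"
  have n: "n > 0" by (simp add: n_def)
  have "ereal (\<alpha> * \<beta> / n * norm (u - closest_point (poly_cone N (\<lambda>x. x)) u)) \<le> penalty K I lam nu a d u" for u
  proof (cases "\<forall>t\<in>I. d t \<bullet> u \<le> 0")
    case True
    define mx where "mx = (MAX i\<in>K. a i \<bullet> u)"
    define p where "p = mx - (\<Sum>i\<in>UNIV. lam i * (a i \<bullet> u)) - (\<Sum>t\<in>I. nu t * (d t \<bullet> u))"
    have mx: "a i \<bullet> u \<le> mx" if "i \<in> K" for i unfolding mx_def using that by (intro Max_ge) auto
    have "mx = (\<Sum>i\<in>UNIV. lam i * mx)" using lam(2) by (simp flip: sum_distrib_right)
    then have p: "p = (\<Sum>i\<in>UNIV. lam i * (mx - a i \<bullet> u)) + (\<Sum>t\<in>I. nu t * (- (d t \<bullet> u)))"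
      by (simp add: p_def right_diff_distrib sum_subtractf sum_negf)
    have t1: "0 \<le> lam i * (mx - a i \<bullet> u)" for i
      using lam(1)[of i] lam(3)[of i] mx[of i] by (cases "i \<in> K") auto
    have t2: "0 \<le> nu t * (- (d t \<bullet> u))" if "t \<in> I" for t
      using nu[OF that] True that by (intro mult_nonneg_nonneg) auto
    have s1: "0 \<le> (\<Sum>i\<in>UNIV. lam i * (mx - a i \<bullet> u))" and s2: "0 \<le> (\<Sum>t\<in>I. nu t * (- (d t \<bullet> u)))"
      using t1 t2 by (auto intro: sum_nonneg)
    have p0: "0 \<le> p" using s1 s2 p by simp
    have kp: "\<beta> * max 0 (k \<bullet> u) \<le> p" if k: "k \<in> N" for k
    proof -
      consider i j where "i \<in> K" "j \<in> J1" "k = a i - a j" | t where "t \<in> I" "k = d t" | t where "t \<in> J2" "k = - d t"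
        using k by (auto simp: N_def critical_vectors_def)
      then show ?thesis
      proof cases
        case (1 i j)
        have "j \<in> K" using 1 by (simp add: J1)
        then have nn: "0 \<le> mx - a j \<bullet> u" using mx by simp
        have "max 0 (k \<bullet> u) \<le> mx - a j \<bullet> u" using 1 mx[of i] nn by (simp add: inner_diff_left)
        then have "\<beta> * max 0 (k \<bullet> u) \<le> \<beta> * (mx - a j \<bullet> u)" using \<beta>(1) by (intro mult_left_mono) auto
        also have "\<dots> \<le> lam j * (mx - a j \<bullet> u)" using \<beta>(2)[OF 1(2)] nn by (intro mult_right_mono) auto
        also have "\<dots> \<le> (\<Sum>i\<in>UNIV. lam i * (mx - a i \<bullet> u))"
          using t1 by (intro member_le_sum) auto
        finally show ?thesis using s2 p by simp
      next
        case (2 t)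
        then show ?thesis using True p0 by simp
      next
        case (3 t)
        have tI: "t \<in> I" using 3 by (simp add: J2)
        have nn: "0 \<le> - (d t \<bullet> u)" using True tI by simp
        then have "\<beta> * max 0 (k \<bullet> u) = \<beta> * (- (d t \<bullet> u))" using 3 by simp
        also have "\<dots> \<le> nu t * (- (d t \<bullet> u))" using \<beta>(3)[OF 3(1)] nn by (intro mult_right_mono) auto
        also have "\<dots> \<le> (\<Sum>t\<in>I. nu t * (- (d t \<bullet> u)))" by (rule member_le_sum[OF tI t2 I]) auto
        finally show ?thesis using s1 p by simp
      qed
    qed
    have "\<beta> * (\<alpha> * norm (u - closest_point (poly_cone N (\<lambda>x. x)) u)) \<le> \<beta> * (\<Sum>k\<in>N. max 0 (k \<bullet> u))"
      using \<alpha>(2) \<beta>(1) by (intro mult_left_mono) auto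
    also have "\<dots> = (\<Sum>k\<in>N. \<beta> * max 0 (k \<bullet> u))" by (rule sum_distrib_left)
    also have "\<dots> \<le> (\<Sum>k\<in>N. p)" by (rule sum_mono[OF kp])
    also have "\<dots> \<le> n * p" using p0 by (simp add: n_def algebra_simps)
    finally have "\<alpha> * \<beta> / n * norm (u - closest_point (poly_cone N (\<lambda>x. x)) u) \<le> p"
      using n by (simp add: field_simps)
    then show ?thesis unfolding penalty_def using True by (simp add: p_def mx_def)
  qed (simp only: penalty_def if_False ereal_less_eq)
  moreover have "\<alpha> * \<beta> / n > 0" using \<alpha>(1) \<beta>(1) n by simp
  ultimately show ?thesis unfolding N_def by blast
qed

end

section \<open>Relative interior of the cone defining \<Gamma>\<close>

lemma G_cone_add:
  assumes "y \<in> G_cone K J1 I J2 c" "y' \<in> G_cone K J1 I J2 c"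
  shows "y + y' \<in> G_cone K J1 I J2 c"
  using assms unfolding G_cone_def by (auto simp: inner_add_right intro: add_nonpos_nonpos)

lemma G_cone_sum: "(\<And>k. k \<in> N \<Longrightarrow> y k \<in> G_cone K J1 I J2 c) \<Longrightarrow> sum y N \<in> G_cone K J1 I J2 c"
proof (induction N rule: infinite_finite_induct)
  case (insert k N)
  then show ?case by (simp add: G_cone_add)
qed (auto simp: G_cone_def)

text \<open>A point of the relative interior of \<open>G_cone\<close>, obtained by adding up, for each index outside
  \<open>\<Gamma>\<close>, a point of the cone at which the corresponding inequality is strict.\<close>

lemma G_cone_interior_point:
  fixes K J1 :: "'l::finite set" and c :: "nat \<Rightarrow> real ^ 'r::finite"
  assumes I: "finite I" and J1: "J1 \<subseteq> K" "J1 \<noteq> {}" and J2: "J2 \<subseteq> I"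
  obtains y where "y \<in> G_cone K J1 I J2 c"
    "\<And>i j. i \<in> K - Gamma1 K J1 I J2 c \<Longrightarrow> j \<in> J1 \<Longrightarrow> ((axis i 1, 0) - (axis j 1, 0)) \<bullet> y < 0"
    "\<And>t. t \<in> I - Gamma2 K J1 I J2 c \<Longrightarrow> (0, c t) \<bullet> y < 0"
proof -
  let ?G = "G_cone K J1 I J2 c" and ?K = "K - Gamma1 K J1 I J2 c" and ?I = "I - Gamma2 K J1 I J2 c"
  let ?a = "\<lambda>i j. (axis i 1, 0) - (axis j 1, 0) :: (real ^ 'l) \<times> (real ^ 'r)"
  have le1: "?a i j \<bullet> y \<le> 0" if "y \<in> ?G" "i \<in> K" "j \<in> J1" for y i j
    using that unfolding G_cone_def by (cases "i \<in> J1") auto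
  have le2: "(0, c t) \<bullet> y \<le> 0" if "y \<in> ?G" "t \<in> I" for y t
    using that unfolding G_cone_def by (cases "t \<in> J2") auto
  \<comment> \<open>Strictness for one \<open>j\<close> suffices, because elements of the cone take
    the same value at all indices of \<open>J1\<close>.\<close>
  have "\<exists>y\<in>?G. \<forall>j\<in>J1. ?a i j \<bullet> y < 0" if i: "i \<in> ?K" for i
  proof -
    obtain j y where jy: "j \<in> J1" "y \<in> ?G" "?a i j \<bullet> y \<noteq> 0" using i by (auto simp: Gamma1_def)
    have "?a i j' \<bullet> y < 0" if j': "j' \<in> J1" for j'
    proof -
      have "?a j j' \<bullet> y = 0" using jy(1,2) j' by (auto simp: G_cone_def)
      moreover have "?a i j' = ?a i j + ?a j j'" by simp
      ultimately have "?a i j' \<bullet> y = ?a i j \<bullet> y" by (simp only: inner_add_left)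
      moreover have "?a i j \<bullet> y \<le> 0" using i by (intro le1 jy) auto
      ultimately show ?thesis using jy(3) by linarith
    qed
    then show ?thesis using jy(2) by blast
  qed
  then obtain y1 where y1: "\<And>i. i \<in> ?K \<Longrightarrow> y1 i \<in> ?G" "\<And>i j. i \<in> ?K \<Longrightarrow> j \<in> J1 \<Longrightarrow> ?a i j \<bullet> y1 i < 0" by metis
  have "\<exists>y\<in>?G. (0, c t) \<bullet> y < 0" if t: "t \<in> ?I" for t
  proof -
    obtain y where "y \<in> ?G" "(0, c t) \<bullet> y \<noteq> 0" using t by (auto simp: Gamma2_def)
    then show ?thesis using le2[of y t] t by (intro bexI[of _ y]) auto
  qed
  then obtain y2 where y2: "\<And>t. t \<in> ?I \<Longrightarrow> y2 t \<in> ?G" "\<And>t. t \<in> ?I \<Longrightarrow> (0, c t) \<bullet> y2 t < 0" by metis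
  define s1 s2 where "s1 = sum y1 ?K" and "s2 = sum y2 ?I"
  have s: "s1 \<in> ?G" "s2 \<in> ?G" unfolding s1_def s2_def using y1(1) y2(1) by (auto intro: G_cone_sum)
  show ?thesis
  proof (rule that[of "s1 + s2"])
    show "s1 + s2 \<in> ?G" by (rule G_cone_add[OF s])
    fix i j assume i: "i \<in> ?K" and j: "j \<in> J1"
    have "s1 = y1 i + sum y1 (?K - {i})" unfolding s1_def using i by (intro sum.remove) auto
    moreover have "?a i j \<bullet> sum y1 (?K - {i}) \<le> 0"
      using y1(1) i j by (intro le1 G_cone_sum) auto
    moreover have "?a i j \<bullet> s2 \<le> 0" using s i j by (intro le1) auto
    ultimately show "?a i j \<bullet> (s1 + s2) < 0" using y1(2)[OF i j] by (simp only: inner_add_right)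
  next
    fix t assume t: "t \<in> ?I"
    have "s2 = y2 t + sum y2 (?I - {t})" unfolding s2_def using t I by (intro sum.remove) auto
    moreover have "(0, c t) \<bullet> sum y2 (?I - {t}) \<le> 0"
      using y2(1) t by (intro le2 G_cone_sum) auto
    moreover have "(0, c t) \<bullet> s1 \<le> 0" using s t by (intro le2) auto
    ultimately show "(0, c t) \<bullet> (s1 + s2) < 0" using y2(2)[OF t] by (simp only: inner_add_right)
  qed
qed

text \<open>By nondegeneracy \<open>(y1, y2) \<mapsto> A\<^sup>* y1 + B\<^sup>* y2\<close> has a left inverse on \<open>D\<close>, and the adjoint of
  that left inverse is a right inverse of \<open>(A, B)\<close> modulo the orthogonal complement of \<open>D\<close>.\<close>

lemma nondegenerate_right_inverse:
  fixes A :: "'a::euclidean_space \<Rightarrow> real ^ 'l" and B :: "'a \<Rightarrow> real ^ 'r"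
  assumes A: "linear A" and B: "linear B" and nd: "D_space K I c \<inter> kernel_adj A B = {0}"
  obtains T where "linear T"
    "\<And>d y. d \<in> D_space K I c \<Longrightarrow> fst d \<bullet> A (T y) + snd d \<bullet> B (T y) = d \<bullet> y"
proof -
  let ?D = "D_space K I c"
  define F where "F y = adjoint A (fst y) + adjoint B (snd y)" for y
  have linF: "linear F" unfolding F_def
    by (intro linear_compose_add linear_compose[OF linear_fst, unfolded o_def] linear_compose[OF linear_snd, unfolded o_def]
        adjoint_linear A B)
  have D: "?D = span {axis i 1 - axis j 1 | i j. i \<in> K \<and> j \<in> K} \<times> span {c t | t. t \<in> I}"
    unfolding D_space_def by auto
  have subD: "subspace ?D" unfolding D by (intro subspace_Times subspace_span)
  have "inj_on F ?D"
  proof (rule inj_onI)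
    fix y y' assume y: "y \<in> ?D" "y' \<in> ?D" and "F y = F y'"
    then have "F (y - y') = 0" by (simp add: linear_diff[OF linF])
    then have "y - y' \<in> kernel_adj A B" by (simp add: kernel_adj_def F_def case_prod_beta)
    then have "y - y' \<in> ?D \<inter> kernel_adj A B" using subspace_diff[OF subD y] by (rule IntI[rotated])
    then show "y = y'" unfolding nd by simp
  qed
  from linear_exists_left_inverse_on[OF linF subD this]
  obtain g where g: "linear g" "\<And>d. d \<in> ?D \<Longrightarrow> g (F d) = d" by blast
  show ?thesis
  proof (rule that)
    show "linear (adjoint g)" by (rule adjoint_linear[OF g(1)])
    fix d y assume d: "d \<in> ?D"
    have "adjoint A y1 \<bullet> z = y1 \<bullet> A z" "adjoint B y2 \<bullet> z = y2 \<bullet> B z" for y1 y2 z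
      using adjoint_works[OF A, of z y1] adjoint_works[OF B, of z y2] by (simp_all only: inner_commute)
    then have "fst d \<bullet> A (adjoint g y) + snd d \<bullet> B (adjoint g y) = F d \<bullet> adjoint g y"
      by (simp only: F_def inner_add_left)
    also have "\<dots> = d \<bullet> y" using adjoint_works[OF g(1), of "F d" y] unfolding g(2)[OF d] .
    finally show "fst d \<bullet> A (adjoint g y) + snd d \<bullet> B (adjoint g y) = d \<bullet> y" .
  qed
qed

theorem theorem5p1:
  fixes \<phi> :: "'l::finite \<Rightarrow> (real ^ 'n) \<times> (real ^ 'd) \<Rightarrow> real"
    and \<zeta> :: "'r::finite \<Rightarrow> (real ^ 'n) \<times> (real ^ 'd) \<Rightarrow> real"
    and p :: nat and c :: "nat \<Rightarrow> real ^ 'r" and \<tau> :: "nat \<Rightarrow> real"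
    and xb vb :: "real ^ 'n" and wb :: "real ^ 'd"
    and lam :: "real ^ 'l" and mu :: "real ^ 'r" and nu :: "nat \<Rightarrow> real"
    and \<Xi> :: "(real ^ 'n) \<times> (real ^ 'd) \<Rightarrow> real ^ 'l"
    and \<Upsilon> :: "(real ^ 'n) \<times> (real ^ 'd) \<Rightarrow> real ^ 'r"
    and \<Phi> :: "(real ^ 'n) \<times> (real ^ 'd) \<Rightarrow> (real ^ 'l) \<times> (real ^ 'r)"
    and Z :: "(real ^ 'r) set" and K J1 :: "'l set" and I J2 :: "nat set"
    and S :: "(real ^ 'n) set"
  assumes \<phi>_C2: "\<And>i. C2_smooth (\<phi> i)"
    and \<zeta>_C2: "\<And>s. C2_smooth (\<zeta> s)"
    and \<Xi>_eq: "\<Xi> = (\<lambda>q. \<chi> i. \<phi> i q)"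
    and \<Upsilon>_eq: "\<Upsilon> = (\<lambda>q. \<chi> s. \<zeta> s q)"
    and \<Phi>_eq: "\<Phi> = (\<lambda>q. (\<Xi> q, \<Upsilon> q))"
    and Z_eq: "Z = poly_set p c \<tau>"
    and feasible: "\<Upsilon> (xb, wb) \<in> Z"
    and stationary: "vb \<in> limiting_subdifferential (\<lambda>x. (theta Z \<circ> \<Phi>) (x, wb)) xb"
    and K_eq: "K = active_max (\<Xi> (xb, wb))"
    and I_eq: "I = active_constr p c \<tau> (\<Upsilon> (xb, wb))"
    and nondegenerate: "D_space K I c \<inter> kernel_adj (deriv_x \<Xi> xb wb) (deriv_x \<Upsilon> xb wb) = {0}"
    and KKT_stationarity:
      "vb = (\<Sum>i\<in>UNIV. lam $ i *\<^sub>R grad_x (\<phi> i) xb wb) + (\<Sum>s\<in>UNIV. mu $ s *\<^sub>R grad_x (\<zeta> s) xb wb)"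
    and KKT_lam: "\<And>i. 0 \<le> lam $ i" "(\<Sum>i\<in>UNIV. lam $ i) = 1" "\<And>i. i \<notin> K \<Longrightarrow> lam $ i = 0"
    and KKT_mu: "mu \<in> normal_cone (\<Upsilon> (xb, wb)) Z"
    and nu_nonneg: "\<And>t. t \<in> I \<Longrightarrow> 0 \<le> nu t"
    and mu_eq: "mu = (\<Sum>t\<in>I. nu t *\<^sub>R c t)"
    and J1_eq: "J1 = {i\<in>K. 0 < lam $ i}"
    and J2_eq: "J2 = {t\<in>I. 0 < nu t}"
    and S_eq: "S = {u. (\<exists>\<gamma>. \<forall>i\<in>Gamma1 K J1 I J2 c. grad_x (\<phi> i) xb wb \<bullet> u = \<gamma>) \<and>
                    (\<forall>t\<in>Gamma2 K J1 I J2 c. c t \<bullet> deriv_x \<Upsilon> xb wb u = 0)}"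
  shows "fully_stable_local_minimizer (minimax_objective \<phi> \<Upsilon> Z) xb wb vb \<longleftrightarrow>
    (\<forall>u\<in>S. u \<noteq> 0 \<longrightarrow>
       (\<Sum>i\<in>UNIV. lam $ i * (u \<bullet> hessian_xx (\<phi> i) xb wb u)) +
       (\<Sum>s\<in>UNIV. mu $ s * (u \<bullet> hessian_xx (\<zeta> s) xb wb u)) > 0)"
proof -
  let ?qb = "(xb, wb)"
  obtain \<phi>' \<phi>'' where \<phi>': "\<And>i. C2_witness (\<phi> i) (\<phi>' i) (\<phi>'' i)"
    using \<phi>_C2 unfolding C2_smooth_def C2_witness_def[symmetric] by metis
  obtain \<zeta>' \<zeta>'' where \<zeta>': "\<And>s. C2_witness (\<zeta> s) (\<zeta>' s) (\<zeta>'' s)"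
    using \<zeta>_C2 unfolding C2_smooth_def C2_witness_def[symmetric] by metis
  define A where "A u = (\<chi> i. \<phi>' i ?qb (u, 0))" for u
  define B where "B u = (\<chi> s. \<zeta>' s ?qb (u, 0))" for u
  have dA: "deriv_x \<Xi> xb wb = A" unfolding \<Xi>_eq A_def by (rule deriv_x_vec[OF \<phi>'])
  have dB: "deriv_x \<Upsilon> xb wb = B" unfolding \<Upsilon>_eq B_def by (rule deriv_x_vec[OF \<zeta>'])
  have linP: "linear (\<lambda>u. l (u, 0))" for l :: "((real ^ 'n) \<times> (real ^ 'd)) \<Rightarrow>\<^sub>L real"
    by (rule bounded_linear.linear[OF bounded_linear_compose[OF blinfun.bounded_linear_right
            bounded_linear_Pair[OF bounded_linear_ident bounded_linear_zero]]])
  have linA: "linear A" and linB: "linear B"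
    unfolding A_def B_def
    by (auto intro!: linearI simp: vec_eq_iff linear_add[OF linP] linear_scale[OF linP])
  have nd: "D_space K I c \<inter> kernel_adj A B = {0}" using nondegenerate unfolding dA dB .
  obtain T where T: "linear T"
    "\<And>d y. d \<in> D_space K I c \<Longrightarrow> fst d \<bullet> A (T y) + snd d \<bullet> B (T y) = d \<bullet> y"
    using nondegenerate_right_inverse[OF linA linB nd] by blast
  define a where "a i = grad_x (\<phi> i) xb wb" for i
  define d where "d t = adjoint B (c t)" for t
  have a: "a i \<bullet> u = A u $ i" for i u by (simp add: a_def A_def grad_x_inner[OF \<phi>'])
  have d: "d t \<bullet> u = c t \<bullet> B u" for t u
    using adjoint_works[OF linB, of u "c t"] by (simp add: d_def inner_commute)
  have D1: "(axis i 1 - axis j 1, 0) \<in> D_space K I c" if "i \<in> K" "j \<in> K" for i j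
    using that by (auto simp: D_space_def span_zero intro!: span_base)
  have D2: "(0, c t) \<in> D_space K I c" if "t \<in> I" for t
    using that by (auto simp: D_space_def span_zero intro!: span_base)
  \<comment> \<open>Tested against the generators of \<open>D_space\<close>, \<open>T\<close>
    realizes prescribed differences of active components and prescribed values of active
    constraints.\<close>
  have aT: "(a i - a j) \<bullet> T y = fst y $ i - fst y $ j" if "i \<in> K" "j \<in> K" for i j y
    using T(2)[OF D1[OF that], of y]
    by (simp add: a inner_diff_left inner_axis' inner_prod_def)
  have dT: "d t \<bullet> T y = c t \<bullet> snd y" if "t \<in> I" for t y
    using T(2)[OF D2[OF that], of y] by (simp add: d inner_prod_def)
  have finI: "finite I" by (simp add: I_eq active_constr_def)
  have It: "t \<in> {1..p}" "c t \<bullet> \<Upsilon> ?qb = \<tau> t" if "t \<in> I" for t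
    using that by (auto simp: I_eq active_constr_def)

  \<comment> \<open>Pieces and constraints as one family, and the Lagrangian\<close>
  define g where "g k = (case k of Inl i \<Rightarrow> \<phi> i | Inr s \<Rightarrow> \<zeta> s)" for k
  define g' where "g' k = (case k of Inl i \<Rightarrow> \<phi>' i | Inr s \<Rightarrow> \<zeta>' s)" for k
  define g'' where "g'' k = (case k of Inl i \<Rightarrow> \<phi>'' i | Inr s \<Rightarrow> \<zeta>'' s)" for k
  define \<gamma> where "\<gamma> k = (case k of Inl i \<Rightarrow> lam $ i | Inr s \<Rightarrow> mu $ s)" for k
  define e :: "'l + 'r \<Rightarrow> (real ^ 'l) \<times> (real ^ 'r)" where
    "e k = (case k of Inl i \<Rightarrow> (axis i 1, 0) | Inr s \<Rightarrow> (0, axis s 1))" for k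
  have sumk: "(\<Sum>k\<in>UNIV. F k) = (\<Sum>i\<in>UNIV. F (Inl i)) + (\<Sum>s\<in>UNIV. F (Inr s))"
    for F :: "'l + 'r \<Rightarrow> 'z::comm_monoid_add"
    unfolding UNIV_Plus_UNIV[symmetric] by (subst sum.Plus) (auto simp: o_def)
  have gC2: "C2_witness (g k) (g' k) (g'' k)" for k
    using \<phi>' \<zeta>' by (auto simp: g_def g'_def g''_def split: sum.split)

  \<comment> \<open>Normalizes \<open>L\<close> so that the decomposition holds exactly: the penalty
    measures constraints relative to the base point.\<close>
  define \<beta> where "\<beta> = mu \<bullet> \<Upsilon> ?qb"
  define L where "L q = (\<Sum>k\<in>UNIV. \<gamma> k * g k q) - \<beta>" for q
  define L' where "L' q = (\<Sum>k\<in>UNIV. \<gamma> k *\<^sub>R g' k q)" for q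
  define L'' where "L'' q = (\<Sum>k\<in>UNIV. \<gamma> k *\<^sub>R g'' k q)" for q
  have LC2: "C2_witness L L' L''" unfolding L_def L'_def L''_def by (intro C2_witness_sum gC2)
  have vb: "L' ?qb (u, 0) = vb \<bullet> u" for u
    unfolding L'_def KKT_stationarity
    by (simp add: sumk \<gamma>_def g'_def blinfun.sum_left blinfun.scaleR_left blinfun.add_left inner_add_left inner_sum_left
        grad_x_inner[OF \<phi>'] grad_x_inner[OF \<zeta>'])
  define H where "H u = L'' ?qb (u, 0) (u, 0)" for u
  have H: "H u = (\<Sum>i\<in>UNIV. lam $ i * (u \<bullet> hessian_xx (\<phi> i) xb wb u)) +
       (\<Sum>s\<in>UNIV. mu $ s * (u \<bullet> hessian_xx (\<zeta> s) xb wb u))" for u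
    unfolding H_def L''_def
    by (simp add: sumk \<gamma>_def g''_def blinfun.sum_left blinfun.scaleR_left blinfun.add_left
        hessian_xx_inner[OF \<phi>'] hessian_xx_inner[OF \<zeta>'])

  \<comment> \<open>Straightening chart\<close>
  define P :: "((real ^ 'n) \<times> (real ^ 'd)) \<Rightarrow>\<^sub>L ((real ^ 'n) \<times> (real ^ 'd))" where "P = Blinfun (\<lambda>q. (fst q, 0))"
  have P: "P q = (fst q, 0)" for q
    unfolding P_def by (subst bounded_linear_Blinfun_apply) (auto intro: bounded_linear_Pair bounded_linear_fst bounded_linear_zero)
  \<comment> \<open>Only the linear part in x is removed, by composing with \<open>P\<close>; all
    dependence on w remains in the remainder and is absorbed by the chart.\<close>
  define h where "h k q = g k q - g k ?qb - (g' k ?qb o\<^sub>L P) (q - ?qb)" for k q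
  define h' where "h' k q = g' k q - (g' k ?qb o\<^sub>L P)" for k q
  have hC2: "C2_witness (h k) (h' k) (g'' k)" for k
    unfolding h_def h'_def by (rule C2_witness_minus_linear[OF gC2])
  have h0: "h k ?qb = 0" "h' k ?qb (u, 0) = 0" for k u
    by (simp_all add: h_def h'_def blinfun.diff_left P)
  define \<psi> where "\<psi> q = fst q + (\<Sum>k\<in>UNIV. h k q *\<^sub>R T (e k))" for q
  obtain r0 M where chart: "chart \<psi> L H xb wb vb r0 M"
    using chart_from_C2[where N = UNIV and h = h and h' = h' and h'' = g'' and \<rho> = "\<lambda>k. T (e k)", OF finite hC2 h0 LC2 vb] unfolding \<psi>_def H_def by blast
  define Y where "Y q = (\<Sum>k\<in>UNIV. h k q *\<^sub>R e k)" for q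
  have psi: "\<psi> q - xb = (fst q - xb) + T (Y q)" for q
    unfolding \<psi>_def Y_def by (simp add: linear_sum[OF T(1)] linear_scale[OF T(1)])
  have Y1: "fst (Y q) $ i = h (Inl i) q" for q i
    unfolding Y_def by (simp add: sumk e_def fst_sum axis_def if_distrib cong: if_cong)
  have Y2: "snd (Y q) $ s = h (Inr s) q" for q s
    unfolding Y_def by (simp add: sumk e_def snd_sum axis_def if_distrib cong: if_cong)
  have Y1': "fst (Y q) $ i = \<phi> i q - \<phi> i ?qb - A (fst q - xb) $ i" for q i
    by (simp add: Y1 h_def g_def g'_def P A_def)
  have Y2': "snd (Y q) = \<Upsilon> q - \<Upsilon> ?qb - B (fst q - xb)" for q
    by (simp add: vec_eq_iff Y2 h_def g_def g'_def P B_def \<Upsilon>_eq)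
  have \<phi>K: "\<phi> i ?qb = (MAX j\<in>UNIV. \<phi> j ?qb)" if "i \<in> K" for i
    using that by (simp add: K_eq active_max_def \<Xi>_eq)
  \<comment> \<open>\<open>T (Y q)\<close> adds back precisely the nonlinear remainder of the
    difference; the base values cancel because both pieces are active there.\<close>
  have a_psi: "(a i - a j) \<bullet> (\<psi> q - xb) = \<phi> i q - \<phi> j q" if "i \<in> K" "j \<in> K" for i j q
    using aT[OF that, of "Y q"] \<phi>K[OF that(1)] \<phi>K[OF that(2)]
    unfolding psi inner_add_right by (simp add: Y1' inner_diff_left a)
  have d_psi: "d t \<bullet> (\<psi> q - xb) = c t \<bullet> \<Upsilon> q - \<tau> t" if "t \<in> I" for t q
    unfolding psi inner_add_right dT[OF that] Y2' d[of t "fst q - xb"] inner_diff_right[of "c t"] It(2)[OF that] by simp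

  \<comment> \<open>Decomposition of the objective into Lagrangian and penalty\<close>
  have lam0: "0 \<le> lam $ i" "sum (($) lam) UNIV = 1" "i \<notin> K \<Longrightarrow> lam $ i = 0" for i
    using KKT_lam by auto
  define \<pi> where "\<pi> = penalty K I (($) lam) nu a d"
  define N where "N = critical_vectors K J1 I J2 a d"
  define C where "C = poly_cone N (\<lambda>x. x)"
  note pen = finI lam0 nu_nonneg J1_eq J2_eq
  obtain j0 where j0: "j0 \<in> J1" using multiplier_support_nonempty[OF pen] by blast
  have J1K: "J1 \<subseteq> K" and J2I: "J2 \<subseteq> I" by (auto simp: J1_eq J2_eq)
  have j0K: "j0 \<in> K" using j0 J1K by blast
  have finN: "finite N" unfolding N_def by (rule finite_critical_vectors[OF pen])
  obtain \<alpha> where \<alpha>: "\<alpha> > 0" "\<And>u. ereal (\<alpha> * norm (u - closest_point C u)) \<le> \<pi> u"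
    using penalty_sharp[OF pen, of a d] unfolding C_def N_def \<pi>_def by blast

  \<comment> \<open>Near the base point inactive pieces stay below \<open>\<phi> j0\<close> and
    inactive constraints stay strict, so only \<open>K\<close> and \<open>I\<close> matter.\<close>
  have f_eq: "\<forall>\<^sub>F q in nhds ?qb. minimax_objective \<phi> \<Upsilon> Z q = ereal (L q) + \<pi> (\<psi> q - xb)"
  proof -
    have cont\<phi>: "isCont (\<phi> i) ?qb" for i by (rule has_derivative_continuous[OF C2_D1[OF \<phi>']])
    have cont\<zeta>: "isCont (\<zeta> s) ?qb" for s by (rule has_derivative_continuous[OF C2_D1[OF \<zeta>']])
    have t\<phi>: "(\<phi> i \<longlongrightarrow> \<phi> i ?qb) (nhds ?qb)" for i using cont\<phi> by (simp add: isCont_def tendsto_at_iff_tendsto_nhds)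
    have t\<zeta>: "(\<zeta> s \<longlongrightarrow> \<zeta> s ?qb) (nhds ?qb)" for s using cont\<zeta> by (simp add: isCont_def tendsto_at_iff_tendsto_nhds)
    have t\<Upsilon>: "(\<Upsilon> \<longlongrightarrow> \<Upsilon> ?qb) (nhds ?qb)" unfolding \<Upsilon>_eq by (intro tendsto_vec_lambda t\<zeta>)
    have "\<forall>\<^sub>F q in nhds ?qb. \<phi> i q < \<phi> j0 q" if i: "i \<in> - K" for i
    proof -
      have "\<phi> i ?qb \<noteq> (MAX j\<in>UNIV. \<phi> j ?qb)" using i by (simp add: K_eq active_max_def \<Xi>_eq)
      moreover have "\<phi> i ?qb \<le> (MAX j\<in>UNIV. \<phi> j ?qb)" by (intro Max_ge) auto
      ultimately have "\<phi> j0 ?qb - \<phi> i ?qb > 0" using \<phi>K[OF j0K] by linarith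
      with tendsto_diff[OF t\<phi> t\<phi>] have "\<forall>\<^sub>F q in nhds ?qb. 0 < \<phi> j0 q - \<phi> i q" by (rule order_tendstoD(1))
      then show ?thesis by eventually_elim simp
    qed
    then have E1: "\<forall>\<^sub>F q in nhds ?qb. \<forall>i\<in>-K. \<phi> i q < \<phi> j0 q" by (intro eventually_ball_finite) auto
    have "\<forall>\<^sub>F q in nhds ?qb. c t \<bullet> \<Upsilon> q < \<tau> t" if t: "t \<in> {1..p} - I" for t
    proof -
      have "c t \<bullet> \<Upsilon> ?qb \<noteq> \<tau> t" using t by (simp add: I_eq active_constr_def)
      moreover have "c t \<bullet> \<Upsilon> ?qb \<le> \<tau> t" using feasible t by (simp add: Z_eq poly_set_def)
      ultimately have "c t \<bullet> \<Upsilon> ?qb < \<tau> t" by simp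
      with tendsto_inner[OF tendsto_const t\<Upsilon>] show ?thesis by (rule order_tendstoD(2))
    qed
    then have E2: "\<forall>\<^sub>F q in nhds ?qb. \<forall>t\<in>{1..p} - I. c t \<bullet> \<Upsilon> q < \<tau> t" by (intro eventually_ball_finite) auto
    from E1 E2 show ?thesis
    proof eventually_elim
      case (elim q)
      have ZI: "\<Upsilon> q \<in> Z \<longleftrightarrow> (\<forall>t\<in>I. c t \<bullet> \<Upsilon> q \<le> \<tau> t)"
        using elim(2) It(1) by (force simp: Z_eq poly_set_def)
      have feas: "(\<forall>t\<in>I. d t \<bullet> (\<psi> q - xb) \<le> 0) \<longleftrightarrow> \<Upsilon> q \<in> Z"
        unfolding ZI by (rule ball_cong) (simp_all add: d_psi)
      have MK: "(MAX i\<in>UNIV. \<phi> i q) = (MAX i\<in>K. \<phi> i q)"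
      proof (rule Max_eqI)
        have "(MAX i\<in>K. \<phi> i q) \<in> (\<lambda>i. \<phi> i q) ` K" using j0K by (intro Max_in) auto
        then show "(MAX i\<in>K. \<phi> i q) \<in> range (\<lambda>i. \<phi> i q)" by blast
        fix y assume "y \<in> range (\<lambda>i. \<phi> i q)"
        then obtain i where i: "y = \<phi> i q" by blast
        have mK: "\<phi> j q \<le> (MAX i\<in>K. \<phi> i q)" if "j \<in> K" for j using that by (intro Max_ge) auto
        show "y \<le> (MAX i\<in>K. \<phi> i q)"
        proof (cases "i \<in> K")
          case True
          then show ?thesis using mK i by simp
        next
          case False
          then have "y \<le> \<phi> j0 q" using elim(1) i by (simp add: less_imp_le)
          then show ?thesis using mK[OF j0K] by linarith
        qed
      qed simp
      show ?case
      proof (cases "\<Upsilon> q \<in> Z")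
        case True
        \<comment> \<open>The common shift of the straightened active pieces. It enters the maximum
          and the convex combination once each, and cancels.\<close>
        define s where "s = a j0 \<bullet> (\<psi> q - xb) - \<phi> j0 q"
        have ai: "a i \<bullet> (\<psi> q - xb) = \<phi> i q + s" if "i \<in> K" for i
          using a_psi[OF that j0K, of q] by (simp add: s_def inner_diff_left)
        have "(MAX i\<in>K. a i \<bullet> (\<psi> q - xb)) = (MAX i\<in>K. \<phi> i q + s)" by (simp add: ai cong: image_cong)
        also have "\<dots> = (MAX i\<in>K. \<phi> i q) + s" using j0K by (intro Max_add_commute) auto
        finally have m: "(MAX i\<in>K. a i \<bullet> (\<psi> q - xb)) = (MAX i\<in>K. \<phi> i q) + s" .
        have "(\<Sum>i\<in>UNIV. lam $ i * (a i \<bullet> (\<psi> q - xb))) = (\<Sum>i\<in>UNIV. lam $ i * \<phi> i q + lam $ i * s)"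
        proof (rule sum.cong[OF refl])
          fix i
          show "lam $ i * (a i \<bullet> (\<psi> q - xb)) = lam $ i * \<phi> i q + lam $ i * s"
            by (cases "i \<in> K") (simp_all add: ai lam0(3) distrib_left)
        qed
        also have "\<dots> = (\<Sum>i\<in>UNIV. lam $ i * \<phi> i q) + s"
          using lam0(2) by (simp add: sum.distrib flip: sum_distrib_right)
        finally have l: "(\<Sum>i\<in>UNIV. lam $ i * (a i \<bullet> (\<psi> q - xb))) = (\<Sum>i\<in>UNIV. lam $ i * \<phi> i q) + s" .
        have "(\<Sum>t\<in>I. nu t * (d t \<bullet> (\<psi> q - xb))) = (\<Sum>t\<in>I. nu t * (c t \<bullet> \<Upsilon> q) - nu t * (c t \<bullet> \<Upsilon> ?qb))"
          by (rule sum.cong) (simp_all add: d_psi It right_diff_distrib)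
        also have "\<dots> = mu \<bullet> \<Upsilon> q - \<beta>" by (simp add: sum_subtractf mu_eq inner_sum_left \<beta>_def)
        finally have n: "(\<Sum>t\<in>I. nu t * (d t \<bullet> (\<psi> q - xb))) = mu \<bullet> \<Upsilon> q - \<beta>" .
        have "L q = (\<Sum>i\<in>UNIV. lam $ i * \<phi> i q) + mu \<bullet> \<Upsilon> q - \<beta>"
          by (simp add: L_def sumk \<gamma>_def g_def \<Upsilon>_eq inner_vec_def)
        then show ?thesis
          using True feas by (simp add: minimax_objective_def indicator_fn_def \<pi>_def penalty_def m l n MK)
      next
        case False
        then show ?thesis using feas by (simp add: minimax_objective_def indicator_fn_def \<pi>_def penalty_def)
      qed
    qed
  qed

  \<comment> \<open>Critical cone and the subspace \<open>S\<close>\<close>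
  let ?G = "G_cone K J1 I J2 c"
  have inn1: "((axis i 1, 0) - (axis j 1, 0)) \<bullet> y = fst y $ i - fst y $ j" for i j and y :: "(real ^ 'l) \<times> (real ^ 'r)"
    by (simp add: inner_prod_def inner_diff_left inner_axis')
  have inn2: "(0, c t) \<bullet> y = c t \<bullet> snd y" for t and y :: "(real ^ 'l) \<times> (real ^ 'r)"
    by (simp add: inner_prod_def)
  have J1G: "J1 \<subseteq> Gamma1 K J1 I J2 c" and J2G: "J2 \<subseteq> Gamma2 K J1 I J2 c"
    using J1K J2I by (auto simp: Gamma1_def Gamma2_def G_cone_def)
  \<comment> \<open>The derivative of \<Phi> maps \<open>C\<close> into the cone that defines
    \<Gamma>; its implicit equalities therefore hold on \<open>C\<close>, which places
    \<open>C\<close> in \<open>S\<close>.\<close>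
  have CG: "(A u, B u) \<in> ?G" if u: "u \<in> C" for u
  proof -
    have le1: "A u $ i \<le> A u $ j" if "i \<in> K" "j \<in> J1" for i j
    proof -
      have "a i - a j \<in> N" using that by (auto simp: N_def critical_vectors_def)
      then have "(a i - a j) \<bullet> u \<le> 0" using u by (auto simp: C_def poly_cone_def)
      then show ?thesis by (simp add: inner_diff_left a)
    qed
    have le2: "c t \<bullet> B u \<le> 0" if "t \<in> I" for t
    proof -
      have "d t \<in> N" using that by (auto simp: N_def critical_vectors_def)
      then have "d t \<bullet> u \<le> 0" using u by (auto simp: C_def poly_cone_def)
      then show ?thesis by (simp add: d)
    qed
    have ge2: "c t \<bullet> B u \<ge> 0" if "t \<in> J2" for t
    proof -
      have "- d t \<in> N" using that by (auto simp: N_def critical_vectors_def)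
      then have "- d t \<bullet> u \<le> 0" using u unfolding C_def poly_cone_def by blast
      then show ?thesis by (simp add: d)
    qed
    show ?thesis unfolding G_cone_def mem_Collect_eq inn1 inn2
      using le1 le2 ge2 J1K J2I by (auto intro!: antisym dest: subsetD)
  qed
  have S_alt: "u \<in> S \<longleftrightarrow> (\<exists>\<gamma>. \<forall>i\<in>Gamma1 K J1 I J2 c. A u $ i = \<gamma>) \<and> (\<forall>t\<in>Gamma2 K J1 I J2 c. c t \<bullet> B u = 0)" for u
    unfolding S_eq mem_Collect_eq dB by (simp add: a[unfolded a_def])
  have CS: "C \<subseteq> S"
  proof
    fix u assume "u \<in> C"
    note G = CG[OF this]
    have "A u $ i = A u $ j0" if "i \<in> Gamma1 K J1 I J2 c" for i
    proof -
      have "((axis i 1, 0) - (axis j0 1, 0)) \<bullet> (A u, B u) = 0" using that j0 G unfolding Gamma1_def by blast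
      then show ?thesis unfolding inn1 by simp
    qed
    moreover have "c t \<bullet> B u = 0" if "t \<in> Gamma2 K J1 I J2 c" for t
    proof -
      have "(0, c t) \<bullet> (A u, B u) = 0" using that G unfolding Gamma2_def by blast
      then show ?thesis unfolding inn2 by simp
    qed
    ultimately show "u \<in> S" unfolding S_alt by blast
  qed
  have S: "subspace S"
  proof (rule subspaceI)
    show "0 \<in> S" unfolding S_alt linear_0[OF linA] linear_0[OF linB] by simp
    show "x + y \<in> S" if "x \<in> S" "y \<in> S" for x y
      using that unfolding S_alt linear_add[OF linA] linear_add[OF linB] by (fastforce simp: inner_add_right)
    show "r *\<^sub>R x \<in> S" if "x \<in> S" for r x
      using that unfolding S_alt linear_scale[OF linA] linear_scale[OF linB] by fastforce
  qed
  have comp: "composite \<psi> L H xb wb vb r0 M (minimax_objective \<phi> \<Upsilon> Z) \<pi> C S \<alpha>"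
  proof (intro composite.intro composite_axioms.intro chart f_eq \<alpha> CS S)
    show "closed C" "convex C" "0 \<in> C" unfolding C_def by (simp_all add: closed_poly_cone convex_poly_cone)
    show "s *\<^sub>R u \<in> C" if "u \<in> C" "0 \<le> s" for s u using that unfolding C_def by (rule poly_cone_scale)
    show "\<pi> u = 0" if "u \<in> C" for u
      using penalty_zero[OF pen] that unfolding C_def N_def \<pi>_def by blast
  qed

  \<comment> \<open>A point of \<open>C\<close> interior relative to \<open>S\<close>\<close>
  obtain y0 where y0: "y0 \<in> ?G"
    "\<And>i j. i \<in> K - Gamma1 K J1 I J2 c \<Longrightarrow> j \<in> J1 \<Longrightarrow> ((axis i 1, 0) - (axis j 1, 0)) \<bullet> y0 < 0"
    "\<And>t. t \<in> I - Gamma2 K J1 I J2 c \<Longrightarrow> (0, c t) \<bullet> y0 < 0"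
    using G_cone_interior_point[OF finI J1K _ J2I, of c] j0 by blast
  \<comment> \<open>\<open>T\<close> lifts \<open>y0\<close> to x-space with the same values of all
    critical functionals, so strict inequalities stay strict.\<close>
  define u0 where "u0 = T y0"
  have a0: "(a i - a j) \<bullet> u0 = ((axis i 1, 0) - (axis j 1, 0)) \<bullet> y0" if "i \<in> K" "j \<in> J1" for i j
    using aT[of i j y0] that J1K unfolding u0_def inn1 by blast
  have d0: "d t \<bullet> u0 = (0, c t) \<bullet> y0" if "t \<in> I" for t
    using dT[OF that, of y0] unfolding u0_def inn2 .
  \<comment> \<open>Every critical vector is either strictly negative at \<open>u0\<close>, hence
    also nearby, or vanishes on \<open>S\<close>; steps within \<open>S\<close> thus stay in
    \<open>C\<close>.\<close>
  have dich: "k \<bullet> u0 < 0 \<or> k \<bullet> u0 \<le> 0 \<and> (\<forall>u\<in>S. k \<bullet> u = 0)" if k: "k \<in> N" for k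
  proof -
    consider i j where "i \<in> K" "j \<in> J1" "k = a i - a j" | t where "t \<in> I" "k = d t" | t where "t \<in> J2" "k = - d t"
      using k by (auto simp: N_def critical_vectors_def)
    then show ?thesis
    proof cases
      case (1 i j)
      show ?thesis
      proof (cases "i \<in> Gamma1 K J1 I J2 c")
        case True
        have "((axis i 1, 0) - (axis j 1, 0)) \<bullet> y0 = 0" using True 1 y0(1) unfolding Gamma1_def by blast
        moreover have "k \<bullet> u = 0" if "u \<in> S" for u
          using that True 1 J1G by (force simp: S_alt inner_diff_left a)
        ultimately show ?thesis using a0[OF 1(1,2)] 1(3) by simp
      next
        case False
        then show ?thesis using y0(2)[of i j] a0[OF 1(1,2)] 1 by simp
      qed
    next
      case (2 t)
      show ?thesis
      proof (cases "t \<in> Gamma2 K J1 I J2 c")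
        case True
        have "(0, c t) \<bullet> y0 = 0" using True y0(1) unfolding Gamma2_def by blast
        moreover have "k \<bullet> u = 0" if "u \<in> S" for u using that True 2 by (simp add: S_alt d)
        ultimately show ?thesis using d0[OF 2(1)] 2(2) by simp
      next
        case False
        then show ?thesis using y0(3)[of t] d0[OF 2(1)] 2 by simp
      qed
    next
      case (3 t)
      then have t: "t \<in> I" "t \<in> Gamma2 K J1 I J2 c" using J2I J2G by auto
      have "(0, c t) \<bullet> y0 = 0" using t(2) y0(1) unfolding Gamma2_def by blast
      moreover have "k \<bullet> u = 0" if "u \<in> S" for u using that t 3 by (simp add: S_alt d)
      ultimately show ?thesis using d0[OF t(1)] 3(2) by simp
    qed
  qed
  have u0C: "u0 \<in> C" using dich unfolding C_def poly_cone_def by force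
  have "\<exists>\<epsilon>>0. \<forall>k\<in>N. k \<bullet> u0 < 0 \<longrightarrow> norm k * \<epsilon> \<le> - (k \<bullet> u0)"
  proof (rule finite_common_radius[OF finN])
    fix k
    show "\<exists>\<epsilon>>0. k \<bullet> u0 < 0 \<longrightarrow> norm k * \<epsilon> \<le> - (k \<bullet> u0)"
    proof (cases "k \<bullet> u0 < 0")
      case True
      then have "norm k > 0" by auto
      then show ?thesis using True by (intro exI[of _ "- (k \<bullet> u0) / norm k"]) (auto simp: divide_neg_pos)
    qed (auto intro: exI[of _ 1])
    show "k \<bullet> u0 < 0 \<longrightarrow> norm k * r' \<le> - (k \<bullet> u0)"
      if "k \<bullet> u0 < 0 \<longrightarrow> norm k * r \<le> - (k \<bullet> u0)" "r' \<le> r" for r r'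
      using that mult_left_mono[OF that(2), of "norm k"] by auto
  qed
  then obtain \<epsilon> where \<epsilon>: "\<epsilon> > 0" "\<And>k. k \<in> N \<Longrightarrow> k \<bullet> u0 < 0 \<Longrightarrow> norm k * \<epsilon> \<le> - (k \<bullet> u0)" by blast
  have interior: "u0 + u \<in> C" if u: "u \<in> S" "norm u \<le> \<epsilon>" for u
  proof -
    have "k \<bullet> (u0 + u) \<le> 0" if k: "k \<in> N" for k
      using dich[OF k]
    proof
      assume neg: "k \<bullet> u0 < 0"
      have "k \<bullet> u \<le> norm k * norm u" by (rule norm_cauchy_schwarz)
      also have "\<dots> \<le> norm k * \<epsilon>" using u(2) by (intro mult_left_mono) auto
      finally show ?thesis using \<epsilon>(2)[OF k neg] by (simp add: inner_add_right)
    next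
      assume "k \<bullet> u0 \<le> 0 \<and> (\<forall>u\<in>S. k \<bullet> u = 0)"
      then show ?thesis using u(1) by (simp add: inner_add_right)
    qed
    then show ?thesis by (simp add: C_def poly_cone_def)
  qed

  show ?thesis unfolding H[symmetric]
  proof
    assume fs: "fully_stable_local_minimizer (minimax_objective \<phi> \<Upsilon> Z) xb wb vb"
    show "\<forall>u\<in>S. u \<noteq> 0 \<longrightarrow> 0 < H u"
      using composite.positive_definite_if_fully_stable[OF comp fs u0C \<epsilon>(1) interior] by blast
  next
    assume "\<forall>u\<in>S. u \<noteq> 0 \<longrightarrow> 0 < H u"
    then show "fully_stable_local_minimizer (minimax_objective \<phi> \<Upsilon> Z) xb wb vb"
      using composite.fully_stable_if_positive_definite[OF comp] by blast
  qed
qed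

end
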